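(* Let $m,n\ge 2$ be integers and $\mathcal{T}=(t_{i_1\ldots i_m})\in\mathbb{T}(\mathbb{C}^n,m)$. Then $$|\mathrm{Edet}(\mathcal{T})|\leq\prod_{1\leq i\leq n}\left(\sum_{i_2,\ldots,i_m=1}^n|t_{ii_2\ldots i_m}|\right)^{(m-1)^{n-1}}.$$
   Context: $\mathbb{T}(\mathbb{C}^n,m)$ is the space of $m$-th order $n$-dimensional complex tensors $\mathcal{T}=(t_{i_1\ldots i_m})$, $1\le i_1,\ldots,i_m\le n$. For $\mathbf{x}\in\mathbb{C}^n$, $\mathcal{T}\mathbf{x}^{m-1}\in\mathbb{C}^n$ has $i$-th entry $\sum_{i_2,\ldots,i_m=1}^n t_{ii_2\ldots i_m}x_{i_2}\cdots x_{i_m}$. The resultant $\mathrm{Res}$ of $n$ homogeneous polynomials in $n$ variables, each of degree $m-1$, is the irreducible polynomial in their coefficients that vanishes if and only if the polynomials have a common zero in $\mathbb{C}^n\setminus\{\mathbf{0}\}$, normalized by $\mathrm{Res}(x_1^{m-1},\ldots,x_n^{m-1})=1$. The E-determinant $\mathrm{Edet}(\mathcal{T})$ is the resultant of the $n$ components of $\mathcal{T}\mathbf{x}^{m-1}$. *)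

theory Defs
  imports Complex_Main "HOL-Library.Poly_Mapping" "HOL-Computational_Algebra.Factorial_Ring"
begin

section \<open>Polynomials in several variables with complex coefficients\<close>

text \<open>
  A monomial is a finitely supported exponent function \<open>'v \<Rightarrow>\<^sub>0 nat\<close>, and a polynomial is a
  finitely supported map from monomials to coefficients. With the convolution product of
  \<open>Poly_Mapping\<close> this is the usual polynomial ring, and \<^const>\<open>irreducible\<close> has its usual meaning.
\<close>

type_synonym 'v cpoly = "('v \<Rightarrow>\<^sub>0 nat) \<Rightarrow>\<^sub>0 complex"

definition Var :: "'v \<Rightarrow> 'v cpoly" where
  "Var v = Poly_Mapping.single (Poly_Mapping.single v 1) 1"

definition Const :: "complex \<Rightarrow> 'v cpoly" where
  "Const c = Poly_Mapping.single 0 c"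

definition poly_eval :: "('v \<Rightarrow> complex) \<Rightarrow> 'v cpoly \<Rightarrow> complex" where
  "poly_eval a p =
     (\<Sum>\<mu>\<in>Poly_Mapping.keys p.
        Poly_Mapping.lookup p \<mu> * (\<Prod>v\<in>Poly_Mapping.keys \<mu>. a v ^ Poly_Mapping.lookup \<mu> v))"

definition monomials_of_degree :: "nat \<Rightarrow> nat \<Rightarrow> (nat \<Rightarrow>\<^sub>0 nat) set" where
  "monomials_of_degree n d =
     {\<alpha>. Poly_Mapping.keys \<alpha> \<subseteq> {1..n} \<and>
         (\<Sum>v\<in>Poly_Mapping.keys \<alpha>. Poly_Mapping.lookup \<alpha> v) = d}"

text \<open>Homogeneous of degree \<open>d\<close> in the variables \<open>1, \<dots>, n\<close>; the zero polynomial is included.\<close>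

definition is_form :: "nat \<Rightarrow> nat \<Rightarrow> nat cpoly \<Rightarrow> bool" where
  "is_form n d p \<longleftrightarrow> Poly_Mapping.keys p \<subseteq> monomials_of_degree n d"


section \<open>The resultant of \<open>n\<close> forms of degree \<open>d\<close> in \<open>n\<close> variables\<close>

text \<open>
  The resultant is a polynomial in the indeterminates \<open>(i, \<alpha>)\<close>, where \<open>(i, \<alpha>)\<close> stands for the
  coefficient of the monomial \<open>\<alpha>\<close> in the \<open>i\<close>-th form.
\<close>

definition coeffs_of :: "(nat \<Rightarrow> nat cpoly) \<Rightarrow> nat \<times> (nat \<Rightarrow>\<^sub>0 nat) \<Rightarrow> complex" where
  "coeffs_of F = (\<lambda>(i, \<alpha>). Poly_Mapping.lookup (F i) \<alpha>)"

text \<open>Only the entries \<open>x 1, \<dots>, x n\<close> matter, so the common zero is nonzero iff one of these is.\<close>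

definition has_nontrivial_common_zero :: "nat \<Rightarrow> (nat \<Rightarrow> nat cpoly) \<Rightarrow> bool" where
  "has_nontrivial_common_zero n F \<longleftrightarrow>
     (\<exists>x :: nat \<Rightarrow> complex. (\<exists>j\<in>{1..n}. x j \<noteq> 0) \<and> (\<forall>i\<in>{1..n}. poly_eval x (F i) = 0))"

definition is_resultant :: "nat \<Rightarrow> nat \<Rightarrow> (nat \<times> (nat \<Rightarrow>\<^sub>0 nat)) cpoly \<Rightarrow> bool" where
  "is_resultant n d R \<longleftrightarrow>
     (\<forall>\<mu>\<in>Poly_Mapping.keys R. Poly_Mapping.keys \<mu> \<subseteq> {1..n} \<times> monomials_of_degree n d) \<and>
     irreducible R \<and>
     (\<forall>F. (\<forall>i\<in>{1..n}. is_form n d (F i)) \<longrightarrow>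
        (poly_eval (coeffs_of F) R = 0 \<longleftrightarrow> has_nontrivial_common_zero n F)) \<and>
     poly_eval (coeffs_of (\<lambda>i. Var i ^ d)) R = 1"

text \<open>
  For \<open>n \<ge> 1\<close> and \<open>d \<ge> 1\<close> exactly one polynomial satisfies \<^const>\<open>is_resultant\<close>: its zero set
  determines an irreducible polynomial up to a scalar factor, and the last condition fixes the
  factor.
\<close>

definition resultant_poly :: "nat \<Rightarrow> nat \<Rightarrow> (nat \<times> (nat \<Rightarrow>\<^sub>0 nat)) cpoly" where
  "resultant_poly n d = (THE R. is_resultant n d R)"

definition Res :: "nat \<Rightarrow> nat \<Rightarrow> (nat \<Rightarrow> nat cpoly) \<Rightarrow> complex" where
  "Res n d F = poly_eval (coeffs_of F) (resultant_poly n d)"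


section \<open>Tensors and the E-determinant\<close>

text \<open>
  A tensor of order \<open>m\<close> and dimension \<open>n\<close> is given by its entries \<open>T [i\<^sub>1, \<dots>, i\<^sub>m]\<close> with
  \<open>1 \<le> i\<^sub>1, \<dots>, i\<^sub>m \<le> n\<close>; the values of \<open>T\<close> on other lists are never used.
\<close>

definition multi_indices :: "nat \<Rightarrow> nat \<Rightarrow> nat list set" where
  "multi_indices n k = {l. length l = k \<and> set l \<subseteq> {1..n}}"

definition tensor_apply ::
    "nat \<Rightarrow> nat \<Rightarrow> (nat list \<Rightarrow> complex) \<Rightarrow> (nat \<Rightarrow> complex) \<Rightarrow> nat \<Rightarrow> complex" where
  "tensor_apply n m T x i = (\<Sum>l\<in>multi_indices n (m - 1). T (i # l) * prod_list (map x l))"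

text \<open>
  The components of \<^const>\<open>tensor_apply\<close> as polynomials in the entries of \<open>x\<close>; see
  \<open>poly_eval_tensor_form\<close> below.
\<close>

definition tensor_form :: "nat \<Rightarrow> nat \<Rightarrow> (nat list \<Rightarrow> complex) \<Rightarrow> nat \<Rightarrow> nat cpoly" where
  "tensor_form n m T i = (\<Sum>l\<in>multi_indices n (m - 1). Const (T (i # l)) * prod_list (map Var l))"

definition Edet :: "nat \<Rightarrow> nat \<Rightarrow> (nat list \<Rightarrow> complex) \<Rightarrow> complex" where
  "Edet n m T = Res n (m - 1) (tensor_form n m T)"

lemma finite_multi_indices: "finite (multi_indices n k)"
  unfolding multi_indices_def using finite_lists_length_eq[of "{1..n}" k]
  by (simp add: conj_commute)

lemma poly_eval_superset:
  assumes "finite A" "Poly_Mapping.keys p \<subseteq> A"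
  shows "poly_eval a p =
    (\<Sum>\<mu>\<in>A. Poly_Mapping.lookup p \<mu> * (\<Prod>v\<in>Poly_Mapping.keys \<mu>. a v ^ Poly_Mapping.lookup \<mu> v))"
  unfolding poly_eval_def using assms
  by (intro sum.mono_neutral_left) (auto simp: in_keys_iff)

lemma poly_eval_zero: "poly_eval a 0 = 0"
  by (simp add: poly_eval_def)

lemma poly_eval_add: "poly_eval a (p + q) = poly_eval a p + poly_eval a q"
proof -
  let ?A = "Poly_Mapping.keys p \<union> Poly_Mapping.keys q"
  have "Poly_Mapping.keys (p + q) \<subseteq> ?A"
    by (rule Poly_Mapping.keys_add)
  then show ?thesis
    by (simp add: poly_eval_superset[of ?A] lookup_add distrib_right sum.distrib)
qed

lemma poly_eval_sum: "poly_eval a (\<Sum>i\<in>I. p i) = (\<Sum>i\<in>I. poly_eval a (p i))"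
  by (induction I rule: infinite_finite_induct) (auto simp: poly_eval_zero poly_eval_add)

lemma Const_times_prod_list_Var:
  "Const c * prod_list (map Var l) =
     Poly_Mapping.single (\<Sum>v\<leftarrow>l. Poly_Mapping.single v 1) c"
proof -
  have "prod_list (map Var l) =
      (Poly_Mapping.single (\<Sum>v\<leftarrow>l. Poly_Mapping.single v 1) 1 :: 'a cpoly)"
    by (induction l) (simp_all add: Var_def mult_single)
  then show ?thesis
    by (simp add: Const_def mult_single)
qed

lemma monomial_value_add:
  fixes a :: "'v \<Rightarrow> complex" and \<mu> \<nu> :: "'v \<Rightarrow>\<^sub>0 nat"
  shows "(\<Prod>v\<in>Poly_Mapping.keys (\<mu> + \<nu>). a v ^ Poly_Mapping.lookup (\<mu> + \<nu>) v) =
    (\<Prod>v\<in>Poly_Mapping.keys \<mu>. a v ^ Poly_Mapping.lookup \<mu> v) *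
    (\<Prod>v\<in>Poly_Mapping.keys \<nu>. a v ^ Poly_Mapping.lookup \<nu> v)"
proof -
  let ?A = "Poly_Mapping.keys \<mu> \<union> Poly_Mapping.keys \<nu>"
  have ext: "(\<Prod>v\<in>Poly_Mapping.keys \<rho>. a v ^ Poly_Mapping.lookup \<rho> v) =
      (\<Prod>v\<in>?A. a v ^ Poly_Mapping.lookup \<rho> v)" if "Poly_Mapping.keys \<rho> \<subseteq> ?A" for \<rho>
    using that by (intro prod.mono_neutral_left) (auto simp: in_keys_iff)
  have "Poly_Mapping.keys (\<mu> + \<nu>) \<subseteq> ?A"
    by (rule Poly_Mapping.keys_add)
  from ext[OF this] show ?thesis
    by (simp add: ext[of \<mu>] ext[of \<nu>] lookup_add power_add prod.distrib)
qed

lemma monomial_value_list: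
  fixes a :: "'v \<Rightarrow> complex"
  defines "mon \<equiv> \<lambda>l. (\<Sum>v\<leftarrow>l. Poly_Mapping.single v 1 :: 'v \<Rightarrow>\<^sub>0 nat)"
  shows "(\<Prod>v\<in>Poly_Mapping.keys (mon l). a v ^ Poly_Mapping.lookup (mon l) v) =
    prod_list (map a l)"
  unfolding mon_def by (induction l) (simp_all add: monomial_value_add)

lemma poly_eval_tensor_form: "poly_eval x (tensor_form n m T i) = tensor_apply n m T x i"
proof -
  have "poly_eval x (Poly_Mapping.single \<mu> c) =
      c * (\<Prod>v\<in>Poly_Mapping.keys \<mu>. x v ^ Poly_Mapping.lookup \<mu> v)" for c \<mu>
    by (subst poly_eval_superset[of "{\<mu>}"]) auto
  then show ?thesis
    unfolding tensor_form_def tensor_apply_def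
    by (simp only: poly_eval_sum Const_times_prod_list_Var monomial_value_list)
qed

end

theory Submission
  imports
    Defs
    "HOL-Library.Product_Lexorder"
    "HOL-Computational_Algebra.Fundamental_Theorem_Algebra"
    "HOL-Analysis.Continuum_Not_Denumerable"
    "Jordan_Normal_Form.Determinant"
begin

text \<open>
  Let \<open>F = (F\<^sub>1, \<dots>, F\<^sub>n)\<close> be forms of degree \<open>d = m - 1\<close>. If \<open>F + s (x\<^sub>1\<^sup>d, \<dots>, x\<^sub>n\<^sup>d)\<close> has a common zero
  \<open>x \<noteq> 0\<close>, then at an index \<open>i\<close> where \<open>x\<^sub>i\<close> has largest modulus, \<open>F\<^sub>i x = - s x\<^sub>i\<^sup>d\<close> bounds \<open>s\<close> by
  the sum of the absolute values of the coefficients of \<open>F\<^sub>i\<close>. So if all these sums are at most \<open>1\<close>,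
  the roots of the monic polynomial \<open>s \<mapsto> Res (F + s x\<^sup>d)\<close> lie in the unit disc, and its constant
  coefficient \<open>Res F\<close> has modulus at most \<open>1\<close>. Since \<open>Res\<close> is homogeneous of degree \<open>d^(n - 1)\<close> in
  the coefficients of each form, rescaling the forms gives the bound in general.

  The resultant exists and is unique because the polynomials that vanish on all systems with a
  nontrivial common zero form a prime ideal which is principal: the variety of these systems is
  parametrised rationally and is a hypersurface, and polynomial rings are factorial. By
  the Nullstellensatz, a generator vanishes nowhere else. Its degree is at most \<open>d^(n - 1)\<close> as it
  divides Macaulay's determinants, and at least that by counting the solutions of one system.
\<close>

text \<open>The row sums can lie on either side of 1, so the rescaling needs the exact degree of
  \<open>R\<close> in each form; an upper bound alone or a lower bound alone would not give the
  stated exponent. Homogeneity also makes the leading coefficient of the polynomial in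
  \<open>s\<close> the value of \<open>R\<close> at the diagonal system, which is normalized to 1. A
  row sum 0 cannot be scaled to 1 and is treated apart. \<open>Res\<close> is specified by its zero
  set and by irreducibility in a ring with infinitely many indeterminates, while factoriality is
  reached by adjoining finitely many indeterminates one by one. Rings are therefore subsets
  \<open>vars_in V\<close> of one domain, with relative primes that are later shown to be prime in
  the whole ring. That the variety is a hypersurface is used in one shape: no nonzero polynomial
  free of the coefficient of \<open>x_n^d\<close> in the \<open>n\<close>-th form vanishes on it.
  The Nullstellensatz serves to construct, for every system with only the trivial zero, a
  determinant similar to Macaulay's that is nonzero there; the generator divides it and so is
  nonzero too.\<close>

hide_const (open) module.smult

section \<open>Gauss's lemma for subrings of integral domains\<close>

locale subring_set =
  fixes A :: "'a::idom set"
  assumes zero_mem: "0 \<in> A" and one_mem: "1 \<in> A"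
    and add_mem: "x \<in> A \<Longrightarrow> y \<in> A \<Longrightarrow> x + y \<in> A"
    and mult_mem: "x \<in> A \<Longrightarrow> y \<in> A \<Longrightarrow> x * y \<in> A"
    and uminus_mem: "x \<in> A \<Longrightarrow> - x \<in> A"
begin

lemma diff_mem: "x \<in> A \<Longrightarrow> y \<in> A \<Longrightarrow> x - y \<in> A"
  using add_mem[of x "- y"] uminus_mem[of y] by simp

lemma sum_mem: "(\<And>i. i \<in> I \<Longrightarrow> f i \<in> A) \<Longrightarrow> sum f I \<in> A"
  by (induction I rule: infinite_finite_induct) (auto intro: zero_mem add_mem)

lemma prod_mem: "(\<And>i. i \<in> I \<Longrightarrow> f i \<in> A) \<Longrightarrow> prod f I \<in> A"
  by (induction I rule: infinite_finite_induct) (auto intro: one_mem mult_mem)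

lemma power_mem: "x \<in> A \<Longrightarrow> x ^ k \<in> A"
  by (induction k) (auto intro: one_mem mult_mem)

lemma prod_list_mem: "set xs \<subseteq> A \<Longrightarrow> prod_list xs \<in> A"
  by (induction xs) (auto intro: one_mem mult_mem)

end

text \<open>Cofactors are confined to \<open>A\<close>, so a ring can be any suitable subset of a
  fixed domain, and units and primes vary with it.\<close>

definition dvd_in :: "'a::idom set \<Rightarrow> 'a \<Rightarrow> 'a \<Rightarrow> bool" where
  "dvd_in A x y \<longleftrightarrow> (\<exists>z\<in>A. y = x * z)"

definition prime_in :: "'a::idom set \<Rightarrow> 'a \<Rightarrow> bool" where
  "prime_in A q \<longleftrightarrow> q \<in> A \<and> q \<noteq> 0 \<and> \<not> dvd_in A q 1 \<and>
     (\<forall>x\<in>A. \<forall>y\<in>A. dvd_in A q (x * y) \<longrightarrow> dvd_in A q x \<or> dvd_in A q y)"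

definition prime_product :: "'a::idom set \<Rightarrow> 'a \<Rightarrow> 'a list \<Rightarrow> 'a \<Rightarrow> bool" where
  "prime_product A u qs x \<longleftrightarrow>
     u \<in> A \<and> dvd_in A u 1 \<and> (\<forall>q\<in>set qs. prime_in A q) \<and> x = u * prod_list qs"

text \<open>The factors are primes rather than irreducibles, so uniqueness up to units is built
  in.\<close>

definition factorial_in :: "'a::idom set \<Rightarrow> bool" where
  "factorial_in A \<longleftrightarrow> (\<forall>x\<in>A. x \<noteq> 0 \<longrightarrow> (\<exists>u qs. prime_product A u qs x))"

definition polys_over :: "'a::idom set \<Rightarrow> 'a poly set" where
  "polys_over A = {p. \<forall>i. coeff p i \<in> A}"

lemma coeff_mem: "p \<in> polys_over A \<Longrightarrow> coeff p i \<in> A"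
  by (simp add: polys_over_def)

context subring_set
begin

lemma dvd_in_refl: "dvd_in A x x"
  unfolding dvd_in_def using one_mem by (intro bexI[of _ 1]) auto

lemma dvd_in_triv: "y \<in> A \<Longrightarrow> dvd_in A x (x * y)"
  unfolding dvd_in_def by auto

lemma dvd_in_mult: "dvd_in A x y \<Longrightarrow> z \<in> A \<Longrightarrow> dvd_in A x (y * z)"
  unfolding dvd_in_def by (metis mult.assoc mult_mem)

lemma dvd_in_mult2: "dvd_in A x y \<Longrightarrow> z \<in> A \<Longrightarrow> dvd_in A x (z * y)"
  using dvd_in_mult[of x y z] by (simp add: mult.commute)

lemma dvd_in_add: "dvd_in A x y \<Longrightarrow> dvd_in A x z \<Longrightarrow> dvd_in A x (y + z)"
  unfolding dvd_in_def by (metis distrib_left add_mem)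

lemma dvd_in_diff: "dvd_in A x y \<Longrightarrow> dvd_in A x z \<Longrightarrow> dvd_in A x (y - z)"
  unfolding dvd_in_def by (metis right_diff_distrib diff_mem)

lemma dvd_in_sum: "(\<And>i. i \<in> I \<Longrightarrow> dvd_in A x (f i)) \<Longrightarrow> dvd_in A x (sum f I)"
proof (induction I rule: infinite_finite_induct)
  case (insert i I) then show ?case by (auto intro: dvd_in_add)
qed (auto simp: dvd_in_def intro: bexI[OF _ zero_mem])

lemma unit_mult: "dvd_in A u 1 \<Longrightarrow> dvd_in A v 1 \<Longrightarrow> dvd_in A (u * v) 1"
  unfolding dvd_in_def by (metis mult.assoc mult.left_commute mult.right_neutral mult_mem)

lemma prime_productD:
  assumes "prime_product A u qs x"
  shows "u \<in> A" "dvd_in A u 1" "\<And>q. q \<in> set qs \<Longrightarrow> prime_in A q" "x = u * prod_list qs" "x \<in> A"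
proof -
  show *: "u \<in> A" "dvd_in A u 1" "\<And>q. q \<in> set qs \<Longrightarrow> prime_in A q" "x = u * prod_list qs"
    using assms by (auto simp: prime_product_def)
  then show "x \<in> A"
    by (auto intro!: mult_mem prod_list_mem simp: prime_in_def)
qed

lemma prime_product_mult:
  assumes "prime_product A u qs x" "prime_product A v rs y"
  shows "prime_product A (u * v) (qs @ rs) (x * y)"
  using assms by (auto simp: prime_product_def mult_mem unit_mult)

lemma prime_product_prime: "prime_in A q \<Longrightarrow> prime_product A 1 [q] q"
  using one_mem dvd_in_refl by (auto simp: prime_product_def)

text \<open>One of the prime factors of \<open>p * x\<close> is an associate of \<open>p\<close>;
  dropping it factors \<open>x\<close>. The decrease in length is the inner induction measure of
  \<open>factorial_in_polys_over\<close>.\<close>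

lemma prime_quotient_shorter:
  assumes "prime_in A p" "x \<in> A" "prime_product A u qs (p * x)"
  shows "\<exists>u' qs'. prime_product A u' qs' x \<and> length qs' < length qs"
  using assms(2,3)
proof (induction qs arbitrary: x)
  case Nil
  then have "p * x = u" "dvd_in A u 1" by (auto simp: prime_product_def)
  then have "dvd_in A p 1" using Nil.prems(1) unfolding dvd_in_def by (metis mult.assoc mult_mem)
  then show ?case using assms(1) by (simp add: prime_in_def)
next
  case (Cons q qs)
  note D = prime_productD[OF Cons.prems(2)]
  have q: "prime_in A q" using D by simp
  have pA: "p \<in> A" and p0: "p \<noteq> 0" and qA: "q \<in> A" and q0: "q \<noteq> 0"
    using q assms(1) by (auto simp: prime_in_def)
  have prodA: "prod_list qs \<in> A" using D(3) by (auto intro!: prod_list_mem simp: prime_in_def)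
  have eq: "p * x = q * (u * prod_list qs)" using D(4) by (simp add: ac_simps)
  have "dvd_in A q (p * x)"
    unfolding eq using D(1) prodA by (intro dvd_in_triv mult_mem)
  then consider "dvd_in A q x" | "dvd_in A q p"
    using q pA Cons.prems(1) by (auto simp: prime_in_def)
  then show ?case
  proof cases
    case 1
    then obtain y where y: "y \<in> A" "x = q * y" by (auto simp: dvd_in_def)
    then have "p * y = u * prod_list qs" using eq q0 by (simp add: mult.left_commute)
    then have "prime_product A u qs (p * y)" using D by (auto simp: prime_product_def)
    from Cons.IH[OF y(1) this] obtain u' qs' where
      *: "prime_product A u' qs' y" "length qs' < length qs" by blast
    have "prime_product A u' (q # qs') x" using * q y
      by (auto simp: prime_product_def ac_simps)
    then show ?thesis using * by (intro exI[of _ u'] exI[of _ "q # qs'"]) simp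
  next
    case 2
    then obtain y where y: "y \<in> A" "p = q * y" by (auto simp: dvd_in_def)
    have "dvd_in A p (q * y)" using y dvd_in_refl by simp
    then consider "dvd_in A p q" | "dvd_in A p y" using assms(1) qA y by (auto simp: prime_in_def)
    then show ?thesis
    proof cases
      case 1
      then obtain z where z: "z \<in> A" "q = p * z" by (auto simp: dvd_in_def)
      have "p * x = p * ((u * z) * prod_list qs)" using eq z by (simp add: ac_simps)
      then have x: "x = (u * z) * prod_list qs" using p0 by simp
      have "q * 1 = q * (z * y)" using z y by (simp add: ac_simps)
      then have "1 = z * y" using q0 by (metis mult_left_cancel)
      then have "dvd_in A z 1" using y unfolding dvd_in_def by blast
      then have "prime_product A (u * z) qs x"
        using D x z by (auto simp: prime_product_def mult_mem unit_mult)
      then show ?thesis by (intro exI[of _ "u * z"] exI[of _ qs]) simp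
    next
      case 2
      then obtain z where z: "z \<in> A" "y = p * z" by (auto simp: dvd_in_def)
      have "p * 1 = p * (q * z)" using z y by (simp add: ac_simps)
      then have "1 = q * z" using p0 by (metis mult_left_cancel)
      then have "dvd_in A q 1" using z unfolding dvd_in_def by blast
      then show ?thesis using q by (simp add: prime_in_def)
    qed
  qed
qed

lemma subring_polys_over: "subring_set (polys_over A)"
proof
  show "0 \<in> polys_over A" "1 \<in> polys_over A"
    using zero_mem one_mem by (auto simp: polys_over_def coeff_pCons split: nat.split)
  fix x y assume *: "x \<in> polys_over A"
  then show "- x \<in> polys_over A" by (auto simp: polys_over_def uminus_mem)
  assume "y \<in> polys_over A"
  with * show "x + y \<in> polys_over A" "x * y \<in> polys_over A"
    by (auto simp: polys_over_def coeff_mult intro!: add_mem sum_mem mult_mem)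
qed

interpretation P: subring_set "polys_over A" by (rule subring_polys_over)

lemma const_mem: "a \<in> A \<Longrightarrow> [:a:] \<in> polys_over A"
  using zero_mem by (auto simp: polys_over_def coeff_pCons split: nat.split)

lemma smult_mem: "a \<in> A \<Longrightarrow> p \<in> polys_over A \<Longrightarrow> smult a p \<in> polys_over A"
  by (auto simp: polys_over_def mult_mem)

lemma monom_mem: "a \<in> A \<Longrightarrow> monom a k \<in> polys_over A"
  using zero_mem by (auto simp: polys_over_def)

lemma const_dvd_in:
  assumes "p \<in> polys_over A"
  shows "dvd_in (polys_over A) [:a:] p \<longleftrightarrow> (\<forall>i. dvd_in A a (coeff p i))"
proof
  assume "dvd_in (polys_over A) [:a:] p"
  then obtain q where "q \<in> polys_over A" "p = [:a:] * q" by (auto simp: dvd_in_def)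
  then show "\<forall>i. dvd_in A a (coeff p i)" by (auto simp: dvd_in_def polys_over_def)
next
  assume *: "\<forall>i. dvd_in A a (coeff p i)"
  show "dvd_in (polys_over A) [:a:] p"
  proof (cases "a = 0")
    case True
    then have "p = 0" using * by (auto simp: dvd_in_def poly_eq_iff)
    then show ?thesis using P.zero_mem by (auto simp: dvd_in_def)
  next
    case False
    from * obtain c where c: "\<And>i. c i \<in> A" "\<And>i. coeff p i = a * c i"
      unfolding dvd_in_def by metis
    \<comment> \<open>The quotients \<open>c\<close> are chosen coefficientwise; they form a
      polynomial because \<open>a\<close> is nonzero and \<open>p\<close> has no coefficients beyond
      its degree.\<close>
    have "c i = 0" if "i > degree p" for i using c(2)[of i] that False by (simp add: coeff_eq_0)
    then have "\<forall>\<^sub>\<infinity>i. c i = 0" unfolding MOST_nat by blast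
    then have cc: "coeff (Abs_poly c) = c" by (simp add: Abs_poly_inverse)
    then have "Abs_poly c \<in> polys_over A" using c by (simp add: polys_over_def)
    moreover have "p = [:a:] * Abs_poly c" using c cc by (auto simp: poly_eq_iff)
    ultimately show ?thesis by (auto simp: dvd_in_def)
  qed
qed

text \<open>Let \<open>i\<close> and \<open>j\<close> be the first positions where the coefficients
  of \<open>f\<close> and \<open>g\<close> are not divisible by \<open>p\<close>. In coefficient
  \<open>i + j\<close> of \<open>f * g\<close> all other summands are divisible by \<open>p\<close>,
  so this one would be too, against primality.\<close>

lemma prime_in_const:
  assumes "prime_in A p"
  shows "prime_in (polys_over A) [:p:]"
proof -
  have pA: "p \<in> A" "p \<noteq> 0" using assms by (auto simp: prime_in_def)
  have nu: "\<not> dvd_in (polys_over A) [:p:] 1"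
    using assms P.one_mem by (auto simp: const_dvd_in prime_in_def dest: spec[of _ 0])
  {
    fix f g assume f: "f \<in> polys_over A" and g: "g \<in> polys_over A"
      and d: "dvd_in (polys_over A) [:p:] (f * g)"
      and nf: "\<not> dvd_in (polys_over A) [:p:] f" and ng: "\<not> dvd_in (polys_over A) [:p:] g"
    define i where "i = (LEAST i. \<not> dvd_in A p (coeff f i))"
    define j where "j = (LEAST j. \<not> dvd_in A p (coeff g j))"
    have i: "\<not> dvd_in A p (coeff f i)" "\<And>k. k < i \<Longrightarrow> dvd_in A p (coeff f k)"
      using nf f LeastI_ex[of "\<lambda>i. \<not> dvd_in A p (coeff f i)"] unfolding i_def
      by (auto simp: const_dvd_in dest: not_less_Least)
    have j: "\<not> dvd_in A p (coeff g j)" "\<And>k. k < j \<Longrightarrow> dvd_in A p (coeff g k)"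
      using ng g LeastI_ex[of "\<lambda>i. \<not> dvd_in A p (coeff g i)"] unfolding j_def
      by (auto simp: const_dvd_in dest: not_less_Least)
    have "coeff (f * g) (i + j) = (\<Sum>k\<le>i + j. coeff f k * coeff g (i + j - k))"
      by (simp add: coeff_mult)
    also have "\<dots> = coeff f i * coeff g j +
        (\<Sum>k\<in>{..i + j} - {i}. coeff f k * coeff g (i + j - k))"
      by (subst sum.remove[of _ i]) auto
    finally have eq: "coeff f i * coeff g j =
        coeff (f * g) (i + j) - (\<Sum>k\<in>{..i + j} - {i}. coeff f k * coeff g (i + j - k))"
      by simp
    have "dvd_in A p (coeff f k * coeff g (i + j - k))" if "k \<in> {..i + j} - {i}" for k
    proof (cases "k < i")
      case True
      then show ?thesis using i(2) g by (intro dvd_in_mult) (auto simp: coeff_mem)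
    next
      case False
      then have "i + j - k < j" using that by auto
      then show ?thesis using j(2) f by (intro dvd_in_mult2) (auto simp: coeff_mem)
    qed
    moreover have "dvd_in A p (coeff (f * g) (i + j))"
      using d f g by (simp add: const_dvd_in P.mult_mem)
    ultimately have "dvd_in A p (coeff f i * coeff g j)"
      unfolding eq by (intro dvd_in_diff dvd_in_sum)
    then have False
      using assms i(1) j(1) coeff_mem[OF f, of i] coeff_mem[OF g, of j] unfolding prime_in_def by blast
  }
  then show ?thesis using pA nu by (auto simp: prime_in_def const_mem)
qed

text \<open>Division over the fraction field with denominators cleared: each reduction multiplies
  \<open>f\<close> by the leading coefficient of \<open>g\<close>, and \<open>a\<close> collects
  these factors.\<close>

lemma pseudo_division:
  assumes "f \<in> polys_over A" "g \<in> polys_over A" "g \<noteq> 0"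
  shows "\<exists>a q r. a \<in> A \<and> a \<noteq> 0 \<and> q \<in> polys_over A \<and> r \<in> polys_over A \<and>
    smult a f = q * g + r \<and> (r = 0 \<or> degree r < degree g)"
  using assms(1)
proof (induction "degree f" arbitrary: f rule: less_induct)
  case less
  show ?case
  proof (cases "f = 0 \<or> degree f < degree g")
    case True
    then show ?thesis using less.prems one_mem P.zero_mem
      by (intro exI[of _ 1] exI[of _ 0] exI[of _ f]) auto
  next
    case False
    let ?b = "lead_coeff g" and ?m = "monom (lead_coeff f) (degree f - degree g)"
    define h where "h = smult ?b f - ?m * g"
    have b: "?b \<in> A" "?b \<noteq> 0" using assms by (auto simp: coeff_mem)
    have m: "?m \<in> polys_over A" using less.prems by (intro monom_mem coeff_mem)
    have h: "h \<in> polys_over A" unfolding h_def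
      using b m assms less.prems by (intro P.diff_mem smult_mem P.mult_mem)
    have "\<exists>a q r. a \<in> A \<and> a \<noteq> 0 \<and> q \<in> polys_over A \<and> r \<in> polys_over A \<and>
        smult a h = q * g + r \<and> (r = 0 \<or> degree r < degree g)"
    proof (cases "h = 0 \<or> degree h < degree g")
      case True
      then show ?thesis using h one_mem P.zero_mem
        by (intro exI[of _ 1] exI[of _ 0] exI[of _ h]) auto
    next
      case h': False
      have "degree h < degree f"
      proof -
        have le: "degree h \<le> degree f" unfolding h_def using False
          by (intro degree_diff_le order.trans[OF degree_smult_le] order.trans[OF degree_mult_le])
            (auto simp: degree_monom_eq)
        have "coeff h (degree f) = 0" unfolding h_def using False
          by (simp add: coeff_monom_mult)
        then have "degree h \<noteq> degree f" using h' by (metis leading_coeff_0_iff)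
        then show ?thesis using le by simp
      qed
      then show ?thesis using less.hyps h by blast
    qed
    then obtain a q r where *: "a \<in> A" "a \<noteq> 0" "q \<in> polys_over A" "r \<in> polys_over A"
      "smult a h = q * g + r" "r = 0 \<or> degree r < degree g" by blast
    have "smult (a * ?b) f = (q + smult a ?m) * g + r"
      using *(5) by (simp add: h_def smult_diff_right algebra_simps)
    moreover have "q + smult a ?m \<in> polys_over A" using * m by (intro P.add_mem smult_mem)
    ultimately show ?thesis using * b mult_mem by (intro exI[of _ "a * ?b"] exI) auto
  qed
qed

text \<open>The primes of \<open>a\<close> are removed one at a time: \<open>[:q:]\<close> is prime
  and divides \<open>f * h\<close>; as \<open>f\<close> is primitive, it divides the cofactor
  \<open>h\<close> and cancels.\<close>

lemma dvd_in_smult_cancel: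
  assumes "f \<in> polys_over A" "g \<in> polys_over A" "\<And>q. prime_in A q \<Longrightarrow> \<not> dvd_in (polys_over A) [:q:] f"
    and "prime_product A u qs a" "dvd_in (polys_over A) f (smult a g)"
  shows "dvd_in (polys_over A) f g"
  using assms(4,5)
proof (induction qs arbitrary: a)
  case Nil
  then have "a = u" "dvd_in A u 1" by (auto simp: prime_product_def)
  then obtain v where v: "v \<in> A" "v * a = 1" by (auto simp: dvd_in_def mult.commute)
  have "dvd_in (polys_over A) f ([:v:] * smult a g)"
    using Nil v by (intro P.dvd_in_mult2 const_mem)
  then show ?case using v by (simp add: mult.commute[of a])
next
  case (Cons q qs)
  note D = prime_productD[OF Cons.prems(1)]
  let ?b = "u * prod_list qs"
  have b: "prime_product A u qs ?b" using D by (auto simp: prime_product_def)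
  then have bA: "?b \<in> A" by (rule prime_productD)
  have q: "prime_in A q" "prime_in (polys_over A) [:q:]" using D by (auto intro: prime_in_const)
  have a: "a = q * ?b" using D by simp
  obtain h where h: "h \<in> polys_over A" "smult a g = f * h"
    using Cons.prems by (auto simp: dvd_in_def)
  have "[:q:] * smult ?b g = f * h" using h(2) unfolding a by (simp add: mult.commute[of q])
  then have "dvd_in (polys_over A) [:q:] (f * h)"
    using P.dvd_in_triv[OF smult_mem[OF bA assms(2)]] by metis
  then have "dvd_in (polys_over A) [:q:] h"
    using q(2) assms(1) h assms(3)[OF q(1)] by (auto simp: prime_in_def)
  then obtain k where k: "k \<in> polys_over A" "h = [:q:] * k" by (auto simp: dvd_in_def)
  have "[:q:] * smult ?b g = [:q:] * (f * k)" using h(2) unfolding a k(2) by (simp add: mult.left_commute mult.commute[of q])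
  moreover have "[:q:] \<noteq> 0" using q by (auto simp: prime_in_def)
  ultimately have "smult ?b g = f * k" by (metis mult_left_cancel)
  then have "dvd_in (polys_over A) f (smult ?b g)" using k by (auto simp: dvd_in_def)
  then show ?case using Cons.IH[OF b] by blast
qed

text \<open>Gauss's lemma: a factorization over the fraction field, written
  \<open>smult a f = g * h\<close>, descends to \<open>A\<close> with the same degrees, each prime
  of \<open>a\<close> being cancelled from a factor that it divides. The link between
  \<open>h\<close> and \<open>h'\<close> is recorded so that \<open>h\<close> can be recovered
  afterwards.\<close>

lemma smult_eq_mult_split:
  assumes "prime_product A u qs a" "f \<in> polys_over A" "g \<in> polys_over A" "h \<in> polys_over A"
    "smult a f = g * h"
  shows "\<exists>g' h' c. g' \<in> polys_over A \<and> h' \<in> polys_over A \<and> c \<in> A \<and> c \<noteq> 0 \<and>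
    f = g' * h' \<and> degree g' = degree g \<and> degree h' = degree h \<and> h = smult c h'"
  using assms(1,3,4,5)
proof (induction qs arbitrary: a g h)
  case Nil
  then have "a = u" "dvd_in A u 1" by (auto simp: prime_product_def)
  then obtain v where v: "v \<in> A" "v * a = 1" by (auto simp: dvd_in_def mult.commute)
  have "f = smult v (smult a f)" using v by simp
  also have "\<dots> = smult v g * h" using Nil by simp
  finally have f: "f = smult v g * h" .
  have "v \<noteq> 0" using v by auto
  then show ?case using f v Nil smult_mem one_mem
    by (intro exI[of _ "smult v g"] exI[of _ h] exI[of _ 1]) auto
next
  case (Cons q qs)
  note D = prime_productD[OF Cons.prems(1)]
  let ?b = "u * prod_list qs"
  have b: "prime_product A u qs ?b" using D by (auto simp: prime_product_def)
  then have bA: "?b \<in> A" by (rule prime_productD)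
  have q: "prime_in A q" "prime_in (polys_over A) [:q:]" using D by (auto intro: prime_in_const)
  have qA: "q \<in> A" and q0: "q \<noteq> 0" using q(1) by (auto simp: prime_in_def)
  have q0': "[:q:] \<noteq> 0" using q by (auto simp: prime_in_def)
  have a: "a = q * ?b" using D by simp
  have eq: "[:q:] * smult ?b f = g * h" using Cons.prems(4) unfolding a by (simp add: mult.commute[of q])
  then have "dvd_in (polys_over A) [:q:] (g * h)"
    using P.dvd_in_triv[OF smult_mem[OF bA assms(2)]] by metis
  then consider "dvd_in (polys_over A) [:q:] g" | "dvd_in (polys_over A) [:q:] h"
    using q(2) Cons.prems by (auto simp: prime_in_def)
  then show ?case
  proof cases
    case 1
    then obtain k where k: "k \<in> polys_over A" "g = [:q:] * k" by (auto simp: dvd_in_def)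
    have "[:q:] * smult ?b f = [:q:] * (k * h)" unfolding eq k(2) by (simp only: mult.assoc)
    then have "smult ?b f = k * h" using q0' by (metis mult_left_cancel)
    from Cons.IH[OF b k(1) Cons.prems(3) this] show ?thesis using k q0 by simp
  next
    case 2
    then obtain k where k: "k \<in> polys_over A" "h = [:q:] * k" by (auto simp: dvd_in_def)
    have "[:q:] * smult ?b f = [:q:] * (g * k)" unfolding eq k(2) by (simp only: mult.left_commute)
    then have "smult ?b f = g * k" using q0' by (metis mult_left_cancel)
    from Cons.IH[OF b Cons.prems(2) k(1) this] obtain g' h' c where
      "g' \<in> polys_over A" "h' \<in> polys_over A" "c \<in> A" "c \<noteq> 0"
      "f = g' * h'" "degree g' = degree g" "degree h' = degree k" "k = smult c h'" by blast
    moreover from this have "h = smult (c * q) h'" "c * q \<in> A" "c * q \<noteq> 0" "degree h' = degree h"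
      using k q0 qA mult_mem by (simp_all add: mult.commute)
    ultimately show ?thesis by blast
  qed
qed

text \<open>Over the fraction field, \<open>f\<close> is irreducible in a principal ideal domain, so
  its gcd with \<open>S\<close> is constant or an associate of \<open>f\<close>. The proof is this
  Bezout argument with denominators cleared.\<close>

lemma primitive_irreducible_imp_prime_in:
  assumes fac: "factorial_in A" and f: "f \<in> polys_over A" and deg: "degree f > 0"
    and prim: "\<And>q. prime_in A q \<Longrightarrow> \<not> dvd_in (polys_over A) [:q:] f"
    and irr: "\<And>g h. g \<in> polys_over A \<Longrightarrow> h \<in> polys_over A \<Longrightarrow> f = g * h \<Longrightarrow> degree g = 0 \<or> degree h = 0"
  shows "prime_in (polys_over A) f"
proof -
  have f0: "f \<noteq> 0" using deg by auto
  have cancel: "dvd_in (polys_over A) f g"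
    if "a \<in> A" "a \<noteq> 0" "g \<in> polys_over A" "dvd_in (polys_over A) f (smult a g)" for a g
  proof -
    obtain u qs where "prime_product A u qs a"
      using fac \<open>a \<in> A\<close> \<open>a \<noteq> 0\<close> unfolding factorial_in_def by blast
    from dvd_in_smult_cancel[OF f that(3) prim this that(4)] show ?thesis by blast
  qed
  have nu: "\<not> dvd_in (polys_over A) f 1"
  proof
    assume "dvd_in (polys_over A) f 1"
    then obtain g where g: "1 = f * g" by (auto simp: dvd_in_def)
    then have "g \<noteq> 0" by auto
    then have "degree (f * g) = degree f + degree g" using f0 by (simp add: degree_mult_eq)
    moreover have "degree (f * g) = 0" unfolding g[symmetric] by simp
    ultimately show False using deg by simp
  qed
  {
    fix S T assume S: "S \<in> polys_over A" and T: "T \<in> polys_over A"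
      and ST: "dvd_in (polys_over A) f (S * T)" and nS: "\<not> dvd_in (polys_over A) f S"
    define J where "J = {x * f + y * S |x y. x \<in> polys_over A \<and> y \<in> polys_over A}"
    have fJ: "f \<in> J" unfolding J_def using P.zero_mem P.one_mem by force
    have SJ: "S \<in> J" unfolding J_def using P.zero_mem P.one_mem by force
    have Jsub: "J \<subseteq> polys_over A" unfolding J_def using f S by (auto intro!: P.add_mem P.mult_mem)
    \<comment> \<open>A nonzero element of least degree in the ideal \<open>J\<close> generated by
      \<open>f\<close> and \<open>S\<close> serves as their gcd up to constants.\<close>
    define D where "D = (ARG_MIN degree D. D \<in> J \<and> D \<noteq> 0)"
    have D: "D \<in> J" "D \<noteq> 0" "\<And>E. E \<in> J \<Longrightarrow> E \<noteq> 0 \<Longrightarrow> degree D \<le> degree E"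
      using arg_min_natI[of "\<lambda>D. D \<in> J \<and> D \<noteq> 0" f degree]
        arg_min_nat_le[of "\<lambda>D. D \<in> J \<and> D \<noteq> 0" _ degree] fJ f0 unfolding D_def by auto
    have DA: "D \<in> polys_over A" using D Jsub by auto
    have Jdiv: "\<exists>a q. a \<in> A \<and> a \<noteq> 0 \<and> q \<in> polys_over A \<and> smult a E = q * D" if "E \<in> J" for E
    proof -
      obtain a q r where *: "a \<in> A" "a \<noteq> 0" "q \<in> polys_over A" "r \<in> polys_over A"
        "smult a E = q * D + r" "r = 0 \<or> degree r < degree D"
        using pseudo_division[of E D] \<open>E \<in> J\<close> Jsub DA D by blast
      obtain x y x' y' where xy: "x \<in> polys_over A" "y \<in> polys_over A" "E = x * f + y * S"
        "x' \<in> polys_over A" "y' \<in> polys_over A" "D = x' * f + y' * S"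
        using \<open>E \<in> J\<close> D(1) unfolding J_def by auto
      have "r = (smult a x - q * x') * f + (smult a y - q * y') * S"
      proof -
        have "r = smult a E - q * D" using * by simp
        then show ?thesis unfolding xy by (simp add: algebra_simps smult_add_right)
      qed
      moreover have "smult a x - q * x' \<in> polys_over A" "smult a y - q * y' \<in> polys_over A"
        using * xy by (auto intro!: P.diff_mem smult_mem P.mult_mem)
      ultimately have "r \<in> J" unfolding J_def by blast
      then have "r = 0" using D(3)[of r] *(6) by (cases "r = 0") simp_all
      then show ?thesis using * by auto
    qed
    obtain a q where a: "a \<in> A" "a \<noteq> 0" "q \<in> polys_over A" "smult a f = q * D"
      using Jdiv[OF fJ] by blast
    obtain u qs where "prime_product A u qs a" using fac a unfolding factorial_in_def by blast
    from smult_eq_mult_split[OF this f a(3) DA a(4)] obtain q' D' c where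
      q': "q' \<in> polys_over A" "D' \<in> polys_over A" "c \<in> A" "c \<noteq> 0" "f = q' * D'"
        "degree D' = degree D" "D = smult c D'" by blast
    from irr[OF q'(1,2,5)] have "dvd_in (polys_over A) f T"
    proof
      \<comment> \<open>The gcd is a constant \<open>\<delta>\<close>: the Bezout relation
        multiplied by \<open>T\<close> shows that \<open>f\<close> divides
        \<open>smult \<delta> T\<close>.\<close>
      assume "degree D' = 0"
      then have "degree D = 0" using q'(6) by simp
      then obtain \<delta> where \<delta>: "D = [:\<delta>:]" using degree_eq_zeroE by blast
      have \<delta>A: "\<delta> \<in> A" "\<delta> \<noteq> 0" using DA D(2) \<delta> coeff_mem[of D A 0] by auto
      obtain x y where xy: "x \<in> polys_over A" "y \<in> polys_over A" "D = x * f + y * S"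
        using D(1) unfolding J_def by auto
      have "smult \<delta> T = D * T" using \<delta> by simp
      also have "\<dots> = f * (x * T) + y * (S * T)" unfolding xy by (simp add: algebra_simps)
      finally have "smult \<delta> T = f * (x * T) + y * (S * T)" .
      moreover have "dvd_in (polys_over A) f (f * (x * T) + y * (S * T))"
        by (rule P.dvd_in_add[OF P.dvd_in_triv[OF P.mult_mem[OF xy(1) T]] P.dvd_in_mult2[OF ST xy(2)]])
      ultimately show ?thesis using cancel[OF \<delta>A T] by simp
    next
      \<comment> \<open>The gcd is \<open>f\<close> up to constants, so \<open>f\<close> divides a
        constant multiple of \<open>S\<close>, hence \<open>S\<close> itself.\<close>
      assume "degree q' = 0"
      then obtain \<kappa> where \<kappa>: "q' = [:\<kappa>:]" using degree_eq_zeroE by blast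
      have \<kappa>A: "\<kappa> \<in> A" "\<kappa> \<noteq> 0" using q'(1,5) f0 \<kappa> coeff_mem[of q' A 0] by auto
      obtain b r where b: "b \<in> A" "b \<noteq> 0" "r \<in> polys_over A" "smult b S = r * D"
        using Jdiv[OF SJ] by blast
      have "smult (\<kappa> * b) S = smult \<kappa> (r * smult c D')"
        using b(4) q'(7) by (metis smult_smult)
      also have "\<dots> = f * smult c r" unfolding q'(5) \<kappa> by (simp add: ac_simps)
      finally have "dvd_in (polys_over A) f (smult (\<kappa> * b) S)"
        using P.dvd_in_triv[OF smult_mem[OF q'(3) b(3)]] by simp
      then have "dvd_in (polys_over A) f S"
        using cancel[of "\<kappa> * b" S] \<kappa>A b S mult_mem by auto
      then show ?thesis using nS by blast
    qed
  }
  then show ?thesis using f f0 nu by (auto simp: prime_in_def)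
qed

lemma prime_product_const:
  assumes "prime_product A u qs a"
  shows "prime_product (polys_over A) [:u:] (map (\<lambda>q. [:q:]) qs) [:a:]"
proof -
  note D = prime_productD[OF assms]
  obtain v where "v \<in> A" "1 = u * v" using D(2) by (auto simp: dvd_in_def)
  then have "dvd_in (polys_over A) [:u:] 1"
    unfolding dvd_in_def by (intro bexI[of _ "[:v:]"]) (auto intro: const_mem simp: one_pCons mult.commute)
  moreover have "[:u * prod_list qs:] = [:u:] * prod_list (map (\<lambda>q. [:q:]) qs)"
  proof (induction qs)
    case (Cons q qs)
    have "[:u * prod_list (q # qs):] = [:q:] * [:u * prod_list qs:]" by simp
    also have "\<dots> = [:u:] * prod_list (map (\<lambda>q. [:q:]) (q # qs))"
      unfolding Cons.IH by (simp only: list.map prod_list.Cons mult.left_commute)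
    finally show ?case .
  qed simp
  ultimately show ?thesis
    using D by (auto simp: prime_product_def intro: const_mem prime_in_const)
qed

text \<open>Splitting off a constant prime keeps the degree and shortens the factorization of the
  leading coefficient; splitting into nonconstant factors lowers the degree. A polynomial of
  positive degree admitting neither is primitive and irreducible, hence prime.\<close>

theorem factorial_in_polys_over:
  assumes fac: "factorial_in A"
  shows "factorial_in (polys_over A)"
proof -
  let ?goal = "\<lambda>f. \<exists>v rs. prime_product (polys_over A) v rs f"
  have "?goal f" if "f \<in> polys_over A" "f \<noteq> 0" for f
    using that
  proof (induction "degree f" arbitrary: f rule: less_induct)
    case outer: less
    obtain u qs where "prime_product A u qs (lead_coeff f)"
      using outer.prems fac unfolding factorial_in_def
      by (meson coeff_mem leading_coeff_0_iff)
    moreover have "?goal g" if "prime_product A u qs (lead_coeff g)" "g \<in> polys_over A" "g \<noteq> 0"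
      "degree g = degree f" for g u qs
      using that
    proof (induction "length qs" arbitrary: g u qs rule: less_induct)
      case inner: less
      show ?case
      proof (cases "degree g = 0")
        case True
        then obtain a where "g = [:a:]" using degree_eq_zeroE by blast
        then show ?thesis using prime_product_const inner.prems(1) by force
      next
        case pos: False
        consider q where "prime_in A q" "dvd_in (polys_over A) [:q:] g"
          | h k where "h \<in> polys_over A" "k \<in> polys_over A" "g = h * k" "degree h \<noteq> 0" "degree k \<noteq> 0"
          | "\<And>q. prime_in A q \<Longrightarrow> \<not> dvd_in (polys_over A) [:q:] g"
            "\<And>h k. h \<in> polys_over A \<Longrightarrow> k \<in> polys_over A \<Longrightarrow> g = h * k \<Longrightarrow> degree h = 0 \<or> degree k = 0"
          by blast
        then show ?thesis
        proof cases
          case 1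
          then obtain h where h: "h \<in> polys_over A" "g = [:q:] * h" by (auto simp: dvd_in_def)
          have q0: "q \<noteq> 0" using 1 by (auto simp: prime_in_def)
          have "prime_product A u qs (q * lead_coeff h)"
            using inner.prems(1) h q0 by simp
          from prime_quotient_shorter[OF 1(1) _ this] h obtain u' qs' where
            "prime_product A u' qs' (lead_coeff h)" "length qs' < length qs"
            by (auto simp: coeff_mem)
          then have "?goal h" using inner.hyps[of qs' u' h] h inner.prems q0 by auto
          then obtain v rs where "prime_product (polys_over A) v rs h" by blast
          from P.prime_product_mult[OF P.prime_product_prime[OF prime_in_const[OF 1(1)]] this]
          show ?thesis using h by auto
        next
          case 2
          have "h \<noteq> 0" "k \<noteq> 0" using 2 by auto
          then have "degree h < degree f" "degree k < degree f"
            using 2 inner.prems(4) by (auto simp: degree_mult_eq)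
          then have "?goal h" "?goal k" using 2 \<open>h \<noteq> 0\<close> \<open>k \<noteq> 0\<close> outer.hyps by auto
          then show ?thesis unfolding 2(3) using P.prime_product_mult by blast
        next
          case 3
          have "prime_in (polys_over A) g"
            using pos by (intro primitive_irreducible_imp_prime_in fac inner.prems 3) auto
          then show ?thesis using P.prime_product_prime by blast
        qed
      qed
    qed
    ultimately show ?case using outer.prems by blast
  qed
  then show ?thesis by (auto simp: factorial_in_def)
qed

end

text \<open>Divisibility, units and primes are multiplicative notions, so the bijection is only
  asked to respect products, 0 and 1.\<close>

locale subring_iso = A: subring_set A + B: subring_set B
  for A :: "'a::idom set" and B :: "'b::idom set" +
  fixes \<phi> :: "'a \<Rightarrow> 'b"
  assumes image: "\<phi> ` A = B" and inj: "inj_on \<phi> A"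
    and mult: "x \<in> A \<Longrightarrow> y \<in> A \<Longrightarrow> \<phi> (x * y) = \<phi> x * \<phi> y"
    and one: "\<phi> 1 = 1" and zero: "\<phi> 0 = 0"
begin

lemma dvd_in_iff:
  assumes "x \<in> A" "y \<in> A"
  shows "dvd_in B (\<phi> x) (\<phi> y) \<longleftrightarrow> dvd_in A x y"
proof
  assume "dvd_in B (\<phi> x) (\<phi> y)"
  then obtain z where z: "z \<in> A" "\<phi> y = \<phi> x * \<phi> z" unfolding dvd_in_def image[symmetric] by auto
  then have "\<phi> y = \<phi> (x * z)" using mult assms by simp
  then have "y = x * z" using inj assms z A.mult_mem by (auto dest: inj_onD)
  then show "dvd_in A x y" using z by (auto simp: dvd_in_def)
next
  assume "dvd_in A x y"
  then show "dvd_in B (\<phi> x) (\<phi> y)" using assms image mult by (auto simp: dvd_in_def)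
qed

lemma prime_in_iff: "x \<in> A \<Longrightarrow> prime_in B (\<phi> x) \<longleftrightarrow> prime_in A x"
proof -
  assume x: "x \<in> A"
  have "\<phi> x \<in> B" using x image by auto
  moreover have "\<phi> x = 0 \<longleftrightarrow> x = 0" using inj x A.zero_mem zero by (metis inj_onD)
  moreover have "dvd_in B (\<phi> x) 1 \<longleftrightarrow> dvd_in A x 1" using dvd_in_iff[OF x A.one_mem] one by simp
  moreover have "(\<forall>y\<in>B. \<forall>z\<in>B. dvd_in B (\<phi> x) (y * z) \<longrightarrow> dvd_in B (\<phi> x) y \<or> dvd_in B (\<phi> x) z) \<longleftrightarrow>
      (\<forall>y\<in>A. \<forall>z\<in>A. dvd_in A x (y * z) \<longrightarrow> dvd_in A x y \<or> dvd_in A x z)"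
  proof -
    have "dvd_in B (\<phi> x) (\<phi> y * \<phi> z) \<longleftrightarrow> dvd_in A x (y * z)" if "y \<in> A" "z \<in> A" for y z
      using dvd_in_iff[OF x A.mult_mem[OF that]] mult[OF that] by simp
    then show ?thesis using dvd_in_iff[OF x] by (simp flip: image)
  qed
  ultimately show ?thesis using x by (simp add: prime_in_def)
qed

lemma factorial_in_transfer:
  assumes "factorial_in A"
  shows "factorial_in B"
  unfolding factorial_in_def
proof (intro ballI impI)
  fix y assume y: "y \<in> B" "y \<noteq> 0"
  then obtain x where x: "x \<in> A" "y = \<phi> x" using image by auto
  then have "x \<noteq> 0" using y zero by auto
  then obtain u qs where D: "prime_product A u qs x" using assms x unfolding factorial_in_def by blast
  note D' = A.prime_productD[OF D]
  have "\<phi> (prod_list qs) = prod_list (map \<phi> qs)"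
    using D'(3)
  proof (induction qs)
    case (Cons q qs)
    have "q \<in> A" "set qs \<subseteq> A" using Cons.prems by (auto simp: prime_in_def)
    then have "\<phi> (q * prod_list qs) = \<phi> q * \<phi> (prod_list qs)"
      by (intro mult A.prod_list_mem)
    then show ?case using Cons by simp
  qed (simp add: one)
  moreover have "prod_list qs \<in> A" using D'(3) by (intro A.prod_list_mem) (auto simp: prime_in_def)
  ultimately have "y = \<phi> u * prod_list (map \<phi> qs)" using D' x mult by simp
  moreover have "dvd_in B (\<phi> u) 1" using dvd_in_iff[OF D'(1) A.one_mem] D'(2) one by simp
  moreover have "prime_in B r" if "r \<in> set (map \<phi> qs)" for r
  proof -
    obtain q where "q \<in> set qs" "r = \<phi> q" using \<open>r \<in> set (map \<phi> qs)\<close> by auto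
    then show ?thesis using D'(3) prime_in_iff by (metis prime_in_def)
  qed
  ultimately have "prime_product B (\<phi> u) (map \<phi> qs) y"
    using D' image unfolding prime_product_def by blast
  then show "\<exists>u qs. prime_product B u qs y" by blast
qed

end

section \<open>Polynomials in several variables\<close>

abbreviation "lookup \<equiv> Poly_Mapping.lookup"
abbreviation "keys \<equiv> Poly_Mapping.keys"
abbreviation "single \<equiv> Poly_Mapping.single"

text \<open>The value type is general: complex numbers give evaluation, univariate polynomials give
  restriction to a curve, and \<open>Var\<close> returns the monomial.\<close>

definition mono_val :: "('v \<Rightarrow> 'b::comm_semiring_1) \<Rightarrow> ('v \<Rightarrow>\<^sub>0 nat) \<Rightarrow> 'b" where
  "mono_val a \<mu> = (\<Prod>v\<in>keys \<mu>. a v ^ lookup \<mu> v)"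

lemma mono_val_superset:
  assumes "finite K" "keys \<mu> \<subseteq> K"
  shows "mono_val a \<mu> = (\<Prod>v\<in>K. a v ^ lookup \<mu> v)"
  unfolding mono_val_def using assms by (intro prod.mono_neutral_left) (auto simp: in_keys_iff)

lemma mono_val_0 [simp]: "mono_val a 0 = 1"
  by (simp add: mono_val_def)

lemma mono_val_single [simp]: "mono_val a (single v k) = a v ^ k"
  by (subst mono_val_superset[of "{v}"]) auto

lemma mono_val_add: "mono_val a (\<mu> + \<nu>) = mono_val a \<mu> * mono_val a \<nu>"
proof -
  let ?K = "keys \<mu> \<union> keys \<nu>"
  have "keys (\<mu> + \<nu>) \<subseteq> ?K" by (rule Poly_Mapping.keys_add)
  then show ?thesis
    by (simp add: mono_val_superset[of ?K] lookup_add power_add prod.distrib)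
qed

lemma poly_eval_altdef: "poly_eval a p = (\<Sum>\<mu>\<in>keys p. lookup p \<mu> * mono_val a \<mu>)"
  by (simp add: poly_eval_def mono_val_def)

lemma poly_eval_superset':
  assumes "finite A" "keys p \<subseteq> A"
  shows "poly_eval a p = (\<Sum>\<mu>\<in>A. lookup p \<mu> * mono_val a \<mu>)"
  using poly_eval_superset[OF assms] by (simp add: mono_val_def)

lemma poly_eval_single [simp]: "poly_eval a (single \<mu> c) = c * mono_val a \<mu>"
  by (subst poly_eval_superset'[of "{\<mu>}"]) auto

lemma poly_eval_Const [simp]: "poly_eval a (Const c) = c"
  by (simp add: Const_def)

lemma poly_eval_Var [simp]: "poly_eval a (Var v) = a v"
  by (simp add: Var_def)

lemma poly_eval_1 [simp]: "poly_eval a 1 = 1"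
  using poly_eval_Const[of a 1] by (simp add: Const_def)

lemma sum_single_keys: "(\<Sum>\<mu>\<in>keys p. single \<mu> (lookup p \<mu>)) = p"
  by (rule poly_mapping_eqI)
    (simp add: lookup_sum lookup_single when_def sum.delta' in_keys_iff)

lemma poly_eval_mult: "poly_eval a (p * q) = poly_eval a p * poly_eval a q"
proof -
  have "p * q = (\<Sum>\<mu>\<in>keys p. \<Sum>\<nu>\<in>keys q. single (\<mu> + \<nu>) (lookup p \<mu> * lookup q \<nu>))"
    by (subst sum_single_keys[of p, symmetric], subst sum_single_keys[of q, symmetric])
      (simp only: sum_product mult_single)
  then show ?thesis
    by (simp add: poly_eval_sum mono_val_add poly_eval_altdef[of a p] poly_eval_altdef[of a q]
        sum_product mult_ac)
qed

lemma poly_eval_uminus: "poly_eval a (- p) = - poly_eval a p"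
  using poly_eval_add[of a p "- p"] by (simp add: poly_eval_zero add_eq_0_iff)

lemma poly_eval_diff: "poly_eval a (p - q) = poly_eval a p - poly_eval a q"
  using poly_eval_add[of a p "- q"] by (simp add: poly_eval_uminus)

lemma poly_eval_power: "poly_eval a (p ^ k) = poly_eval a p ^ k"
  by (induction k) (auto simp: poly_eval_mult)

lemma poly_eval_prod: "poly_eval a (prod f I) = (\<Prod>i\<in>I. poly_eval a (f i))"
  by (induction I rule: infinite_finite_induct) (auto simp: poly_eval_mult)

lemmas poly_eval_hom =
  poly_eval_zero poly_eval_add poly_eval_mult poly_eval_uminus poly_eval_diff
  poly_eval_power poly_eval_prod poly_eval_sum

lemma Var_power: "Var v ^ k = single (single v k) 1"
  by (induction k) (auto simp: Var_def mult_single single_add[symmetric])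

lemma Const_add: "Const (c + d) = Const c + Const d"
  by (simp add: Const_def single_add)

lemma Const_mult: "Const (c * d) = Const c * Const d"
  by (simp add: Const_def mult_single)

lemma Const_0 [simp]: "Const 0 = 0" and Const_1 [simp]: "Const 1 = 1"
  by (simp_all add: Const_def)

lemma mono_val_Var: "mono_val Var \<mu> = (single \<mu> 1 :: 'v cpoly)"
proof -
  have "(\<Prod>v\<in>K. Var v ^ lookup \<mu> v) = (single (\<Sum>v\<in>K. single v (lookup \<mu> v)) 1 :: 'v cpoly)"
    if "finite K" for K using that
    by induction (auto simp: Var_power mult_single)
  then show ?thesis by (simp add: mono_val_def sum_single_keys)
qed

lemma single_eq_Const_mono_val: "single \<mu> c = Const c * mono_val Var \<mu>"
  by (simp add: mono_val_Var Const_def mult_single)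

lemma cpoly_induct [case_names Const Var add mult]:
  fixes p :: "'v cpoly"
  assumes c: "\<And>c. P (Const c)" and v: "\<And>v. P (Var v)"
    and add: "\<And>p q. P p \<Longrightarrow> P q \<Longrightarrow> P (p + q)" and mult: "\<And>p q. P p \<Longrightarrow> P q \<Longrightarrow> P (p * q)"
  shows "P p"
proof -
  have P0: "P 0" "P 1" using c[of 0] c[of 1] by simp_all
  have pow: "P (Var v ^ k)" for v k by (induction k) (auto intro: mult v P0)
  have "P (\<Prod>v\<in>K. Var v ^ lookup \<mu> v)" if "finite K" for K \<mu>
    using that by induction (auto intro: mult P0 pow)
  then have single: "P (single \<mu> c)" for \<mu> c
    unfolding single_eq_Const_mono_val mono_val_def by (intro mult c) simp
  have "P (\<Sum>\<mu>\<in>K. single \<mu> (lookup p \<mu>))" if "finite K" for K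
    using that by induction (auto intro: add P0 single)
  from this[of "keys p"] show ?thesis by (simp add: sum_single_keys)
qed

definition vars_in :: "'v set \<Rightarrow> 'v cpoly set" where
  "vars_in V = {p. \<forall>\<mu>\<in>keys p. keys \<mu> \<subseteq> V}"

lemma Const_in_vars [simp]: "Const c \<in> vars_in V"
  by (auto simp: vars_in_def Const_def)

lemma Var_in_vars: "v \<in> V \<Longrightarrow> Var v \<in> vars_in V"
  by (auto simp: vars_in_def Var_def)

text \<open>\<open>subring_set\<close> lives in an integral domain; the linear order on the
  indeterminates orders the monomials, which makes \<open>'v cpoly\<close> such a domain.\<close>

lemma subring_vars_in: "subring_set (vars_in V :: 'v::linorder cpoly set)"
proof
  show "0 \<in> vars_in V" "1 \<in> vars_in V"
    using Const_in_vars[of 0] Const_in_vars[of 1] by simp_all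
next
  fix p q :: "'v cpoly" assume p: "p \<in> vars_in V"
  then show "- p \<in> vars_in V" by (auto simp: vars_in_def in_keys_iff)
  assume q: "q \<in> vars_in V"
  show "p + q \<in> vars_in V"
    using p q Poly_Mapping.keys_add[of p q] by (fastforce simp: vars_in_def)
  show "p * q \<in> vars_in V" unfolding vars_in_def
  proof safe
    fix \<mu> v assume "\<mu> \<in> keys (p * q)" "v \<in> keys \<mu>"
    then obtain \<alpha> \<beta> where "\<alpha> \<in> keys p" "\<beta> \<in> keys q" "\<mu> = \<alpha> + \<beta>"
      using Poly_Mapping.keys_mult[of p q] by auto
    then show "v \<in> V"
      using p q \<open>v \<in> keys \<mu>\<close> Poly_Mapping.keys_add[of \<alpha> \<beta>] unfolding vars_in_def by blast
  qed
qed

lemma vars_in_mono: "V \<subseteq> W \<Longrightarrow> vars_in V \<subseteq> vars_in W"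
  by (auto simp: vars_in_def)

lemma poly_eval_cong:
  assumes "p \<in> vars_in V" "\<And>v. v \<in> V \<Longrightarrow> a v = b v"
  shows "poly_eval a p = poly_eval b p"
proof -
  have "mono_val a \<mu> = mono_val b \<mu>" if "\<mu> \<in> keys p" for \<mu>
    unfolding mono_val_def
  proof (intro prod.cong refl)
    fix v assume "v \<in> keys \<mu>"
    then have "v \<in> V" using assms(1) that unfolding vars_in_def by blast
    then show "a v ^ lookup \<mu> v = b v ^ lookup \<mu> v" using assms(2) by simp
  qed
  then show ?thesis by (simp add: poly_eval_altdef)
qed

section \<open>Homogeneous components and restriction to curves\<close>

definition filt :: "(('v \<Rightarrow>\<^sub>0 nat) \<Rightarrow> bool) \<Rightarrow> 'v cpoly \<Rightarrow> 'v cpoly" where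
  "filt P p = Poly_Mapping.mapp (\<lambda>\<mu> c. c when P \<mu>) p"

lemma lookup_filt: "lookup (filt P p) \<mu> = (lookup p \<mu> when P \<mu>)"
  by (auto simp: filt_def lookup_mapp when_def in_keys_iff)

lemma keys_filt: "keys (filt P p) = {\<mu>\<in>keys p. P \<mu>}"
  by (auto simp: in_keys_iff lookup_filt)

lemma filt_filt: "filt P (filt Q p) = filt (\<lambda>\<mu>. P \<mu> \<and> Q \<mu>) p"
  by (rule poly_mapping_eqI) (auto simp: lookup_filt when_def)

lemma filt_add: "filt P (p + q) = filt P p + filt P q"
  by (rule poly_mapping_eqI) (auto simp: lookup_filt lookup_add when_def)

lemma filt_0 [simp]: "filt P 0 = 0"
  by (rule poly_mapping_eqI) (auto simp: lookup_filt)

lemma filt_sum: "filt P (sum f I) = (\<Sum>i\<in>I. filt P (f i))"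
  by (induction I rule: infinite_finite_induct) (auto simp: filt_add)

lemma filt_uminus: "filt P (- p) = - filt P p"
  by (rule poly_mapping_eqI) (auto simp: lookup_filt when_def)

lemma filt_diff: "filt P (p - q) = filt P p - filt P q"
  using filt_add[of P p "- q"] by (simp add: filt_uminus)

lemma filt_in_vars: "p \<in> vars_in V \<Longrightarrow> filt P p \<in> vars_in V"
  by (auto simp: vars_in_def keys_filt)

lemma poly_eval_filt: "poly_eval a (filt P p) = (\<Sum>\<mu>\<in>keys p. lookup p \<mu> * mono_val a \<mu> when P \<mu>)"
  by (subst poly_eval_superset'[of "keys p"])
    (auto simp: keys_filt lookup_filt when_def intro!: sum.cong)

lemma filt_single: "filt P (single \<mu> c) = (single \<mu> c when P \<mu>)"
  by (rule poly_mapping_eqI) (auto simp: lookup_filt lookup_single when_def)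

text \<open>Typical use: \<open>q\<close> is homogeneous, so a degree condition on
  \<open>\<mu> + \<nu>\<close> is a shifted degree condition on \<open>\<mu>\<close>, and components
  of a product are taken in the cofactor.\<close>

lemma filt_mult:
  assumes "\<And>\<mu> \<nu>. \<nu> \<in> keys q \<Longrightarrow> P (\<mu> + \<nu>) \<longleftrightarrow> P' \<mu>"
  shows "filt P (p * q) = filt P' p * q"
proof -
  have *: "p * q = (\<Sum>\<mu>\<in>keys p. \<Sum>\<nu>\<in>keys q. single (\<mu> + \<nu>) (lookup p \<mu> * lookup q \<nu>))" for p
    by (subst sum_single_keys[of p, symmetric], subst sum_single_keys[of q, symmetric])
      (simp only: sum_product mult_single)
  have "filt P (p * q) = (\<Sum>\<mu>\<in>keys p. \<Sum>\<nu>\<in>keys q. single (\<mu> + \<nu>) (lookup p \<mu> * lookup q \<nu>) when P' \<mu>)"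
    unfolding * filt_sum filt_single by (intro sum.cong refl) (simp add: assms)
  also have "\<dots> = (\<Sum>\<mu>\<in>keys p. (single \<mu> (lookup p \<mu>) when P' \<mu>) * q)"
    by (intro sum.cong refl, subst (3) sum_single_keys[of q, symmetric])
      (simp add: when_def sum_distrib_left mult_single)
  also have "\<dots> = filt P' p * q"
    by (subst (3) sum_single_keys[of p, symmetric]) (simp add: filt_sum filt_single sum_distrib_right)
  finally show ?thesis .
qed

text \<open>Degree in the indeterminates from \<open>W\<close> alone: total degree for
  \<open>UNIV\<close>, degree in the coefficients of the \<open>k\<close>-th form for
  \<open>{k} \<times> UNIV\<close>.\<close>

definition wt :: "'v set \<Rightarrow> ('v \<Rightarrow>\<^sub>0 nat) \<Rightarrow> nat" where
  "wt W \<mu> = (\<Sum>v\<in>keys \<mu> \<inter> W. lookup \<mu> v)"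

lemma wt_superset:
  assumes "finite K" "keys \<mu> \<subseteq> K"
  shows "wt W \<mu> = (\<Sum>v\<in>K \<inter> W. lookup \<mu> v)"
  unfolding wt_def using assms by (intro sum.mono_neutral_left) (auto simp: in_keys_iff)

lemma wt_add: "wt W (\<mu> + \<nu>) = wt W \<mu> + wt W \<nu>"
proof -
  let ?K = "keys \<mu> \<union> keys \<nu>"
  have "keys (\<mu> + \<nu>) \<subseteq> ?K" by (rule Poly_Mapping.keys_add)
  then show ?thesis by (simp add: wt_superset[of ?K] lookup_add sum.distrib)
qed

text \<open>The pullback of \<open>p\<close> along a polynomial curve, so that facts about
  univariate polynomials apply to \<open>p\<close>.\<close>

definition curve_eval :: "('v \<Rightarrow> complex poly) \<Rightarrow> 'v cpoly \<Rightarrow> complex poly" where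
  "curve_eval \<gamma> p = (\<Sum>\<mu>\<in>keys p. smult (lookup p \<mu>) (mono_val \<gamma> \<mu>))"

lemma poly_curve_eval: "poly (curve_eval \<gamma> p) s = poly_eval (\<lambda>v. poly (\<gamma> v) s) p"
  by (simp add: curve_eval_def poly_eval_altdef poly_sum mono_val_def poly_prod)

lemma coeff_mult_le:
  assumes "degree p \<le> m" "degree q \<le> n"
  shows "degree (p * q) \<le> m + n" "coeff (p * q) (m + n) = coeff p m * coeff q n"
proof -
  show "degree (p * q) \<le> m + n" using assms degree_mult_le[of p q] by linarith
  show "coeff (p * q) (m + n) = coeff p m * coeff q n"
  proof (cases "degree p = m \<and> degree q = n")
    case True then show ?thesis using coeff_mult_degree_sum[of p q] by auto
  next
    case False
    then have "degree p < m \<or> degree q < n" using assms by auto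
    then have "coeff p m * coeff q n = 0" by (auto simp: coeff_eq_0)
    moreover have "degree (p * q) < m + n"
      using degree_mult_le[of p q] assms False by linarith
    ultimately show ?thesis by (simp add: coeff_eq_0)
  qed
qed

text \<open>On a line that moves only the coordinates in \<open>W\<close>, with direction
  \<open>a\<close>, just the monomials of weight \<open>e\<close> reach \<open>s^e\<close>, and the
  offset \<open>b\<close> does not enter that coefficient. Vanishing along the line thus becomes
  vanishing of the top component at \<open>a\<close>.\<close>

lemma curve_top:
  fixes a b :: "'v \<Rightarrow> complex" and W :: "'v set"
  defines "\<gamma> \<equiv> \<lambda>v. if v \<in> W then [:b v, a v:] else [:a v:]"
  assumes "\<And>\<mu>. \<mu> \<in> keys p \<Longrightarrow> wt W \<mu> \<le> e"
  shows "degree (curve_eval \<gamma> p) \<le> e"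
    and "coeff (curve_eval \<gamma> p) e = poly_eval a (filt (\<lambda>\<mu>. wt W \<mu> = e) p)"
proof -
  have pow: "degree (\<gamma> v ^ k) \<le> (if v \<in> W then k else 0) \<and>
      coeff (\<gamma> v ^ k) (if v \<in> W then k else 0) = a v ^ k" for v k
  proof (induction k)
    case (Suc k)
    show ?case
    proof (cases "v \<in> W")
      case True
      have d: "degree (\<gamma> v) \<le> 1" "coeff (\<gamma> v) 1 = a v" using True by (auto simp: \<gamma>_def)
      show ?thesis using coeff_mult_le[OF d(1), of "\<gamma> v ^ k" k] Suc True d(2) by simp
    next
      case False
      then show ?thesis using Suc by (auto simp: \<gamma>_def)
    qed
  qed simp
  have mono: "degree (\<Prod>v\<in>K. \<gamma> v ^ lookup \<mu> v) \<le> (\<Sum>v\<in>K \<inter> W. lookup \<mu> v) \<and>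
      coeff (\<Prod>v\<in>K. \<gamma> v ^ lookup \<mu> v) (\<Sum>v\<in>K \<inter> W. lookup \<mu> v) = (\<Prod>v\<in>K. a v ^ lookup \<mu> v)"
    if "finite K" for K \<mu> using that
  proof induction
    case (insert v K)
    let ?e = "if v \<in> W then lookup \<mu> v else 0"
    have "(\<Sum>v\<in>insert v K \<inter> W. lookup \<mu> v) = ?e + (\<Sum>v\<in>K \<inter> W. lookup \<mu> v)"
      using insert by (simp add: Int_insert_left)
    then show ?case
      using insert pow[of v "lookup \<mu> v"]
        coeff_mult_le[of "\<gamma> v ^ lookup \<mu> v" ?e "\<Prod>v\<in>K. \<gamma> v ^ lookup \<mu> v" "\<Sum>v\<in>K \<inter> W. lookup \<mu> v"]
      by simp
  qed simp
  have mono: "degree (mono_val \<gamma> \<mu>) \<le> wt W \<mu>" "coeff (mono_val \<gamma> \<mu>) (wt W \<mu>) = mono_val a \<mu>" for \<mu>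
    using mono[of "keys \<mu>" \<mu>] by (auto simp: mono_val_def wt_def)
  have coeff: "coeff (mono_val \<gamma> \<mu>) e = (mono_val a \<mu> when wt W \<mu> = e)" if "\<mu> \<in> keys p" for \<mu>
    using mono[of \<mu>] assms(2)[OF that] by (auto simp: when_def coeff_eq_0)
  show "degree (curve_eval \<gamma> p) \<le> e" unfolding curve_eval_def
    by (intro degree_sum_le order.trans[OF degree_smult_le] order.trans[OF mono(1)] assms(2)) auto
  show "coeff (curve_eval \<gamma> p) e = poly_eval a (filt (\<lambda>\<mu>. wt W \<mu> = e) p)"
    unfolding curve_eval_def coeff_sum poly_eval_filt
    by (intro sum.cong refl) (auto simp: coeff when_def)
qed

lemma mono_val_scale:
  "mono_val (\<lambda>v. if v \<in> W then s * a v else a v) \<mu> = s ^ wt W \<mu> * mono_val a \<mu>"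
proof -
  have "(\<Prod>v\<in>K. (if v \<in> W then s * a v else a v) ^ lookup \<mu> v) =
      s ^ (\<Sum>v\<in>K \<inter> W. lookup \<mu> v) * (\<Prod>v\<in>K. a v ^ lookup \<mu> v)" if "finite K" for K
    using that by induction (auto simp: Int_insert_left power_mult_distrib power_add mult_ac)
  then show ?thesis by (simp add: mono_val_def wt_def)
qed

lemma poly_eval_scale:
  "poly_eval (\<lambda>v. if v \<in> W then s * a v else a v) p =
    (\<Sum>\<mu>\<in>keys p. lookup p \<mu> * mono_val a \<mu> * s ^ wt W \<mu>)"
  by (simp add: poly_eval_altdef mono_val_scale mult_ac)

lemma poly_eval_scale_homogeneous:
  assumes "\<And>\<mu>. \<mu> \<in> keys p \<Longrightarrow> wt W \<mu> = e"
  shows "poly_eval (\<lambda>v. if v \<in> W then s * a v else a v) p = s ^ e * poly_eval a p"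
  using assms by (simp add: poly_eval_scale poly_eval_altdef sum_distrib_left mult_ac)

text \<open>Scaling the coordinates in \<open>W\<close> by \<open>s\<close> makes the components the
  coefficients of a polynomial in \<open>s\<close> that vanishes identically.\<close>

lemma poly_eval_filt_eq_0:
  assumes "\<And>a. poly_eval a p = 0"
  shows "poly_eval a (filt (\<lambda>\<mu>. wt W \<mu> = e) p) = 0"
proof -
  define q where "q = (\<Sum>\<mu>\<in>keys p. monom (lookup p \<mu> * mono_val a \<mu>) (wt W \<mu>))"
  have "poly q s = 0" for s
    using assms[of "\<lambda>v. if v \<in> W then s * a v else a v"]
    by (simp add: poly_eval_scale q_def poly_sum poly_monom)
  then have "q = 0" using poly_all_0_iff_0[of q] by blast
  then have "0 = coeff q e" by simp
  also have "\<dots> = poly_eval a (filt (\<lambda>\<mu>. wt W \<mu> = e) p)"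
    unfolding q_def coeff_sum poly_eval_filt by (intro sum.cong) (auto simp: when_def)
  finally show ?thesis by simp
qed

text \<open>Fixing the exponent of one indeterminate after another isolates a single monomial, whose
  coefficient is read off where all coordinates are 1.\<close>

lemma poly_eval_eq_0_imp_eq_0:
  fixes p :: "'v cpoly"
  assumes "\<And>a. poly_eval a p = 0"
  shows "p = 0"
proof (rule ccontr)
  assume "p \<noteq> 0"
  then obtain \<mu> where \<mu>: "\<mu> \<in> keys p" by (metis keys_eq_empty equals0I)
  define V where "V = (\<Union>\<nu>\<in>keys p. keys \<nu>)"
  have "poly_eval a (filt (\<lambda>\<nu>. \<forall>v\<in>K. lookup \<nu> v = lookup \<mu> v) p) = 0" if "finite K" for K a
    using that
  proof (induction arbitrary: a)
    case empty
    have "filt (\<lambda>\<nu>. \<forall>v\<in>{}. lookup \<nu> v = lookup \<mu> v) p = p"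
      by (rule poly_mapping_eqI) (simp add: lookup_filt)
    then show ?case using assms by simp
  next
    case (insert v K)
    have w: "wt {v} \<nu> = lookup \<nu> v" for \<nu> :: "'v \<Rightarrow>\<^sub>0 nat"
      by (cases "v \<in> keys \<nu>") (auto simp: wt_def in_keys_iff)
    from poly_eval_filt_eq_0[OF insert.IH, of a "{v}" "lookup \<mu> v"] show ?case
      by (simp add: w filt_filt conj_commute)
  qed
  from this[of V "\<lambda>_. 1"] have "poly_eval (\<lambda>_. 1) (filt (\<lambda>\<nu>. \<forall>v\<in>V. lookup \<nu> v = lookup \<mu> v) p) = 0"
    by (simp add: V_def)
  moreover have "filt (\<lambda>\<nu>. \<forall>v\<in>V. lookup \<nu> v = lookup \<mu> v) p = single \<mu> (lookup p \<mu>)"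
  proof (rule poly_mapping_eqI)
    fix \<nu>
    show "lookup (filt (\<lambda>\<nu>. \<forall>v\<in>V. lookup \<nu> v = lookup \<mu> v) p) \<nu> = lookup (single \<mu> (lookup p \<mu>)) \<nu>"
    proof (cases "\<nu> \<in> keys p \<and> (\<forall>v\<in>V. lookup \<nu> v = lookup \<mu> v)")
      case True
      have "lookup \<nu> v = lookup \<mu> v" for v
      proof (cases "v \<in> V")
        case False
        then have "v \<notin> keys \<nu>" "v \<notin> keys \<mu>" using True \<mu> by (auto simp: V_def)
        then show ?thesis by (simp add: in_keys_iff)
      qed (use True in auto)
      then have "\<nu> = \<mu>" by (intro poly_mapping_eqI)
      then show ?thesis by (simp add: lookup_filt)
    next
      case False
      then show ?thesis by (auto simp: lookup_filt lookup_single when_def in_keys_iff)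
    qed
  qed
  ultimately show False using \<mu> by (simp add: mono_val_def in_keys_iff)
qed

lemma poly_eval_eqI:
  assumes "\<And>a. poly_eval a p = poly_eval a q"
  shows "p = q"
  using poly_eval_eq_0_imp_eq_0[of "p - q"] assms by (simp add: poly_eval_diff)

text \<open>On the line through \<open>a\<close> and \<open>b\<close> a unit restricts to a unit of
  \<open>complex poly\<close>, which is constant.\<close>

lemma poly_eval_unit_const:
  fixes C :: "'v cpoly"
  assumes "C dvd 1"
  shows "poly_eval a C = poly_eval b C"
proof -
  obtain E where CE: "1 = C * E" using assms by (auto simp: dvd_def)
  define \<gamma> where "\<gamma> = (\<lambda>v. [:a v, b v - a v:])"
  have "poly (curve_eval \<gamma> C * curve_eval \<gamma> E) s = poly 1 s" for s
    using arg_cong[OF CE, of "poly_eval (\<lambda>v. poly (\<gamma> v) s)"] by (simp add: poly_curve_eval poly_eval_mult)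
  then have "curve_eval \<gamma> C * curve_eval \<gamma> E = 1" using poly_eq_poly_eq_iff by blast
  then have "curve_eval \<gamma> C dvd 1" by (metis dvd_triv_left)
  then obtain c where "curve_eval \<gamma> C = [:c:]" by (auto simp: is_unit_poly_iff)
  then have "poly (curve_eval \<gamma> C) 0 = poly (curve_eval \<gamma> C) 1" by simp
  then show ?thesis by (simp add: poly_curve_eval \<gamma>_def)
qed

section \<open>Factoriality of polynomial rings\<close>

definition indets :: "'v cpoly \<Rightarrow> 'v set" where
  "indets p = (\<Union>\<mu>\<in>keys p. keys \<mu>)"

lemma finite_indets [simp]: "finite (indets p)"
  by (simp add: indets_def)

lemma in_vars_in_iff: "p \<in> vars_in V \<longleftrightarrow> indets p \<subseteq> V"
  by (auto simp: vars_in_def indets_def)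

lemma vars_in_least:
  fixes S :: "'v::linorder cpoly set"
  assumes "subring_set S" and c: "\<And>c. Const c \<in> S" and v: "\<And>v. v \<in> V \<Longrightarrow> Var v \<in> S"
  shows "vars_in V \<subseteq> S"
proof
  interpret subring_set S by fact
  fix p :: "'v cpoly" assume p: "p \<in> vars_in V"
  have "single \<mu> c \<in> S" if "keys \<mu> \<subseteq> V" for \<mu> c
    unfolding single_eq_Const_mono_val mono_val_def
    using that by (intro mult_mem c prod_mem power_mem v) auto
  then have "(\<Sum>\<mu>\<in>keys p. single \<mu> (lookup p \<mu>)) \<in> S"
    using p by (intro sum_mem) (auto simp: vars_in_def)
  then show "p \<in> S" by (simp add: sum_single_keys)
qed

text \<open>Adjoining one indeterminate is forming univariate polynomials and substituting
  \<open>Var v\<close>; through this map Gauss's theorem can be iterated.\<close>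

lemma vars_in_insert_iso:
  fixes v :: "'v::linorder"
  assumes "v \<notin> V"
  shows "subring_iso (polys_over (vars_in V)) (vars_in (insert v V)) (\<lambda>q. poly q (Var v))"
proof -
  interpret A: subring_set "vars_in V" by (rule subring_vars_in)
  interpret B: subring_set "vars_in (insert v V)" by (rule subring_vars_in)
  interpret P: subring_set "polys_over (vars_in V)" by (rule A.subring_polys_over)
  let ?\<phi> = "\<lambda>q. poly q (Var v)"
  let ?I = "?\<phi> ` polys_over (vars_in V)"
  have "subring_set ?I"
  proof
    show "0 \<in> ?I" using P.zero_mem by (force intro!: image_eqI[of _ _ 0])
    show "1 \<in> ?I" using P.one_mem by (force intro!: image_eqI[of _ _ 1])
    show "- x \<in> ?I" if "x \<in> ?I" for x using that P.uminus_mem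
      by (auto simp flip: poly_minus)
    show "x + y \<in> ?I" "x * y \<in> ?I" if "x \<in> ?I" "y \<in> ?I" for x y using that P.add_mem P.mult_mem
      by (auto simp flip: poly_add poly_mult)
  qed
  moreover have "Const c \<in> ?I" for c
    by (rule image_eqI[of _ _ "[:Const c:]"]) (auto intro: A.const_mem)
  moreover have "Var w \<in> ?I" if "w \<in> insert v V" for w
  proof (cases "w = v")
    case True
    then show ?thesis
      by (intro image_eqI[of _ _ "monom 1 1"]) (auto simp: poly_monom intro: A.monom_mem A.one_mem)
  next
    case False
    then have "Var w \<in> vars_in V" using that by (auto intro: Var_in_vars)
    then show ?thesis
      by (intro image_eqI[of _ _ "[:Var w:]"]) (auto intro: A.const_mem)
  qed
  ultimately have "vars_in (insert v V) \<subseteq> ?I" by (rule vars_in_least)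
  moreover have "poly q (Var v) \<in> vars_in (insert v V)" if "q \<in> polys_over (vars_in V)" for q
    unfolding poly_altdef using that vars_in_mono[of V "insert v V"]
    by (intro B.sum_mem B.mult_mem B.power_mem Var_in_vars) (auto dest: coeff_mem)
  ultimately have image: "?I = vars_in (insert v V)" by auto
  \<comment> \<open>The coefficients of \<open>q\<close> are free of \<open>v\<close>. Varying only
    the coordinate at \<open>v\<close> gives a univariate polynomial that vanishes identically, so
    every coefficient of \<open>q\<close> is zero at every point.\<close>
  have "q = 0" if q: "q \<in> polys_over (vars_in V)" and 0: "poly q (Var v) = 0" for q
  proof -
    have "poly_eval a (coeff q i) = 0" for a i
    proof -
      have "poly (\<Sum>i\<le>degree q. monom (poly_eval a (coeff q i)) i) s = 0" for s
      proof -
        have c: "poly_eval (a(v := s)) (coeff q i) = poly_eval a (coeff q i)" for i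
          using assms by (intro poly_eval_cong[OF coeff_mem[OF q]]) auto
        have "0 = poly_eval (a(v := s)) (poly q (Var v))" by (simp add: 0 poly_eval_zero)
        also have "\<dots> = (\<Sum>i\<le>degree q. poly_eval a (coeff q i) * s ^ i)"
          by (simp add: poly_altdef poly_eval_hom c)
        finally show ?thesis by (simp add: poly_sum poly_monom)
      qed
      then have "(\<Sum>i\<le>degree q. monom (poly_eval a (coeff q i)) i) = 0"
        using poly_all_0_iff_0 by blast
      then have "coeff (\<Sum>i\<le>degree q. monom (poly_eval a (coeff q i)) i) i = 0" by simp
      then show ?thesis
        by (cases "i \<le> degree q") (auto simp: coeff_sum coeff_eq_0 poly_eval_zero)
    qed
    then show ?thesis by (intro poly_eqI) (simp add: poly_eval_eq_0_imp_eq_0)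
  qed
  then have "inj_on ?\<phi> (polys_over (vars_in V))"
    using P.diff_mem by (intro inj_onI) (metis diff_self eq_iff_diff_eq_0 poly_diff)
  with image show ?thesis by unfold_locales auto
qed

lemma factorial_in_vars_in:
  fixes V :: "'v::linorder set"
  assumes "finite V"
  shows "factorial_in (vars_in V)"
  using assms
proof induction
  case empty
  show ?case unfolding factorial_in_def
  proof (intro ballI impI)
    fix p :: "'v cpoly" assume p: "p \<in> vars_in {}" "p \<noteq> 0"
    define c where "c = lookup p 0"
    have eq: "p = Const c"
    proof (rule poly_mapping_eqI)
      fix \<mu>
      have "\<mu> = 0" if "\<mu> \<in> keys p" using p that by (auto simp: vars_in_def)
      then show "lookup p \<mu> = lookup (Const c) \<mu>"
        by (cases "\<mu> \<in> keys p") (auto simp: Const_def c_def lookup_single when_def in_keys_iff)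
    qed
    then have "c \<noteq> 0" using p by auto
    then have "1 = p * Const (1 / c)" using eq by (simp flip: Const_mult)
    then have "dvd_in (vars_in {}) p 1" unfolding dvd_in_def by (intro bexI) auto
    then have "prime_product (vars_in {}) p [] p" using p by (simp add: prime_product_def)
    then show "\<exists>u qs. prime_product (vars_in {}) u qs p" by blast
  qed
next
  case (insert v V)
  interpret S: subring_set "vars_in V" by (rule subring_vars_in)
  interpret subring_iso "polys_over (vars_in V)" "vars_in (insert v V)" "\<lambda>q. poly q (Var v)"
    using insert by (intro vars_in_insert_iso)
  show ?case by (intro factorial_in_transfer S.factorial_in_polys_over insert)
qed

lemma prime_in_vars_in_insert:
  assumes "prime_in (vars_in V) q"
  shows "prime_in (vars_in (insert v V)) q"
proof (cases "v \<in> V")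
  case True then show ?thesis using assms by (simp add: insert_absorb)
next
  case False
  interpret S: subring_set "vars_in V" by (rule subring_vars_in)
  interpret subring_iso "polys_over (vars_in V)" "vars_in (insert v V)" "\<lambda>q. poly q (Var v)"
    using False by (intro vars_in_insert_iso)
  have "[:q:] \<in> polys_over (vars_in V)" using assms by (intro S.const_mem) (simp add: prime_in_def)
  from prime_in_iff[OF this] S.prime_in_const[OF assms] show ?thesis by simp
qed

lemma prime_in_vars_in_mono:
  assumes "finite W" "prime_in (vars_in V) q"
  shows "prime_in (vars_in (W \<union> V)) q"
  using assms by induction (auto intro: prime_in_vars_in_insert)

text \<open>A divisibility relation involves finitely many indeterminates, so it already holds in
  \<open>vars_in W\<close> for a finite enlargement \<open>W\<close> of \<open>V\<close>, where
  \<open>q\<close> is still prime.\<close>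

lemma prime_in_vars_imp_prime_elem:
  assumes "prime_in (vars_in V) q"
  shows "prime_elem q"
proof (rule prime_elemI)
  show "q \<noteq> 0" using assms by (simp add: prime_in_def)
  have dvdI: "dvd_in (vars_in (W \<union> indets k \<union> V)) q (q * k)" for W k
    unfolding dvd_in_def by (intro bexI[of _ k]) (auto simp: in_vars_in_iff)
  show "\<not> q dvd 1"
  proof
    assume "q dvd 1"
    then obtain k where "1 = q * k" by (auto simp: dvd_def)
    with dvdI[of "{}" k] prime_in_vars_in_mono[OF _ assms, of "indets k"] show False
      by (simp add: prime_in_def)
  qed
  fix a b assume "q dvd a * b"
  then obtain k where k: "a * b = q * k" by (auto simp: dvd_def)
  define W where "W = indets a \<union> indets b \<union> indets k \<union> V"
  have "prime_in (vars_in W) q" unfolding W_def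
    by (rule prime_in_vars_in_mono[OF _ assms]) auto
  moreover have "dvd_in (vars_in W) q (a * b)" unfolding k W_def by (rule dvdI)
  moreover have "a \<in> vars_in W" "b \<in> vars_in W" by (auto simp: W_def in_vars_in_iff)
  ultimately have "dvd_in (vars_in W) q a \<or> dvd_in (vars_in W) q b" by (auto simp: prime_in_def)
  then show "q dvd a \<or> q dvd b" by (auto simp: dvd_in_def)
qed

text \<open>A prime ideal containing a product contains a factor, and no unit lies in
  \<open>I\<close>.\<close>

lemma prime_factor_in_prime_ideal:
  fixes p :: "'v::linorder cpoly"
  assumes "p \<in> vars_in V" "finite V" "p \<noteq> 0" "p \<in> I"
    and prime: "\<And>x y. x * y \<in> I \<Longrightarrow> x \<in> I \<or> y \<in> I" and nunit: "\<And>x. x dvd 1 \<Longrightarrow> x \<notin> I"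
  shows "\<exists>q\<in>I. q \<in> vars_in V \<and> prime_elem q"
proof -
  obtain u qs where "prime_product (vars_in V) u qs p"
    using factorial_in_vars_in[OF assms(2)] assms(1,3) unfolding factorial_in_def by blast
  then have "dvd_in (vars_in V) u 1" and qs: "\<And>q. q \<in> set qs \<Longrightarrow> prime_in (vars_in V) q"
    and p: "p = u * prod_list qs"
    unfolding prime_product_def by blast+
  then have "u dvd 1" unfolding dvd_in_def dvd_def by blast
  then have "prod_list qs \<in> I" using prime[of u "prod_list qs"] nunit[of u] \<open>p \<in> I\<close> unfolding p by blast
  then have "\<exists>q\<in>set qs. q \<in> I"
  proof (induction qs)
    case Nil
    then show ?case using nunit[of 1] by simp
  next
    case (Cons q qs)
    then show ?case using prime[of q "prod_list qs"] by (metis list.set_intros prod_list.Cons)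
  qed
  then obtain q where "q \<in> set qs" "q \<in> I" by blast
  then show ?thesis using qs[of q] prime_in_vars_imp_prime_elem[of V q] unfolding prime_in_def by blast
qed

text \<open>
  An ideal that meets the polynomials free of one indeterminate only in \<open>0\<close> becomes principal over
  their field of fractions; a prime element in the ideal clears the denominators.
\<close>

lemma prime_elem_generates:
  fixes I :: "'v::linorder cpoly set"
  assumes diff: "\<And>x y. x \<in> I \<Longrightarrow> y \<in> I \<Longrightarrow> x - y \<in> I"
    and mult: "\<And>x y. x \<in> I \<Longrightarrow> x * y \<in> I"
    and free: "\<And>x. x \<in> I \<Longrightarrow> x \<in> vars_in (- {v}) \<Longrightarrow> x = 0"
    and R: "R \<in> I" "prime_elem R" and S: "S \<in> I"
  shows "R dvd S"
proof -
  define A :: "'v cpoly set" where "A = vars_in (- {v})"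
  interpret S: subring_set A unfolding A_def by (rule subring_vars_in)
  have "insert v (- {v}) = UNIV" by auto
  then have UNIV: "vars_in (insert v (- {v})) = (UNIV :: 'v cpoly set)" by (simp add: vars_in_def)
  have iso: "subring_iso (polys_over A) (UNIV :: 'v cpoly set) (\<lambda>q. poly q (Var v))"
  proof -
    have "v \<notin> - {v}" by simp
    from vars_in_insert_iso[OF this] show ?thesis by (simp only: UNIV A_def)
  qed
  have rep: "\<exists>\<tau>. \<tau> \<in> polys_over A \<and> poly \<tau> (Var v) = T" for T
  proof -
    have "T \<in> (\<lambda>q. poly q (Var v)) ` polys_over A" unfolding subring_iso.image[OF iso] by simp
    then show ?thesis by auto
  qed
  let ?ok = "\<lambda>r. r \<in> polys_over A \<and> r \<noteq> 0 \<and> poly r (Var v) \<in> I"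
  obtain \<rho> where "\<rho> \<in> polys_over A" "poly \<rho> (Var v) = R" using rep by metis
  then have "?ok \<rho>" using R by auto
  \<comment> \<open>An element of least degree in \<open>v\<close>; over the fraction field of
    \<open>A\<close> it generates the ideal.\<close>
  define r where "r = (ARG_MIN degree r. ?ok r)"
  have r: "?ok r" unfolding r_def by (rule arg_min_natI[of ?ok, OF \<open>?ok \<rho>\<close>])
  have min: "degree r \<le> degree s" if "?ok s" for s
    unfolding r_def by (rule arg_min_nat_le[of ?ok, OF that])
  define R0 where "R0 = poly r (Var v)"
  have div: "\<exists>a Q. a \<notin> I \<and> a * T = Q * R0" if "T \<in> I" for T
  proof -
    obtain \<tau> where \<tau>: "\<tau> \<in> polys_over A" "poly \<tau> (Var v) = T" using rep by metis
    obtain a q s where *: "a \<in> A" "a \<noteq> 0" "q \<in> polys_over A" "s \<in> polys_over A"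
      "smult a \<tau> = q * r + s" "s = 0 \<or> degree s < degree r"
      using S.pseudo_division[OF \<tau>(1), of r] r by blast
    have eq: "a * T = poly q (Var v) * R0 + poly s (Var v)"
      using arg_cong[OF *(5), of "\<lambda>q. poly q (Var v)"] \<tau> by (simp add: R0_def)
    have "T * a - R0 * poly q (Var v) \<in> I" using \<open>T \<in> I\<close> r by (intro diff mult) (auto simp: R0_def)
    then have "poly s (Var v) \<in> I" using eq by (simp add: algebra_simps)
    then have "s = 0" using min[of s] * by linarith
    moreover have "a \<notin> I" using free * by (auto simp: A_def)
    ultimately show ?thesis using eq by auto
  qed
  obtain a Q where a: "a \<notin> I" "a * R = Q * R0" using div[OF R(1)] by blast
  have "R dvd Q * R0" using a by (metis dvd_triv_right)
  then have "R dvd R0"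
  proof (rule prime_elem_dvd_multD[OF R(2), THEN disjE])
    \<comment> \<open>Cancelling \<open>R\<close> would put the denominator \<open>a\<close> into
      the ideal.\<close>
    assume "R dvd Q"
    then obtain Q' where "Q = R * Q'" by (auto simp: dvd_def)
    then have "R * a = R * (R0 * Q')" using a by (simp add: mult_ac)
    then have "a = R0 * Q'" using R by auto
    then have "a \<in> I" using r mult by (simp add: R0_def)
    then show ?thesis using a by simp
  qed
  obtain b Q2 where b: "b \<notin> I" "b * S = Q2 * R0" using div[OF S] by blast
  have "R dvd b * S" unfolding b using \<open>R dvd R0\<close> by simp
  moreover have "\<not> R dvd b" using b R mult by (auto simp: dvd_def)
  ultimately show ?thesis using R(2) by (auto dest: prime_elem_dvd_multD)
qed

section \<open>The ideal of systems with a nontrivial common zero\<close>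

lemma finite_bounded_monomials:
  assumes "finite V"
  shows "finite {\<mu> :: 'v \<Rightarrow>\<^sub>0 nat. keys \<mu> \<subseteq> V \<and> (\<forall>v. lookup \<mu> v \<le> m)}"
proof (rule finite_imageD)
  show "inj_on lookup {\<mu> :: 'v \<Rightarrow>\<^sub>0 nat. keys \<mu> \<subseteq> V \<and> (\<forall>v. lookup \<mu> v \<le> m)}"
    by (intro inj_onI poly_mapping_eqI) simp
  have "lookup ` {\<mu> :: 'v \<Rightarrow>\<^sub>0 nat. keys \<mu> \<subseteq> V \<and> (\<forall>v. lookup \<mu> v \<le> m)} \<subseteq>
      {f. \<forall>v. (v \<in> V \<longrightarrow> f v \<in> {..m}) \<and> (v \<notin> V \<longrightarrow> f v = 0)}"
    by (auto simp: in_keys_iff)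
  then show "finite (lookup ` {\<mu> :: 'v \<Rightarrow>\<^sub>0 nat. keys \<mu> \<subseteq> V \<and> (\<forall>v. lookup \<mu> v \<le> m)})"
    using finite_set_of_finite_funs[OF assms, of "{..m}" 0] by (simp add: finite_subset)
qed

lemma monomials_of_degree_altdef:
  "monomials_of_degree n d = {\<alpha>. keys \<alpha> \<subseteq> {1..n} \<and> wt UNIV \<alpha> = d}"
  by (simp add: monomials_of_degree_def wt_def)

lemma lookup_le_wt: "lookup \<alpha> v \<le> wt UNIV \<alpha>"
proof (cases "v \<in> keys \<alpha>")
  case True then show ?thesis unfolding wt_def by (auto intro!: member_le_sum)
qed (simp add: in_keys_iff)

lemma finite_monomials_of_degree [simp]: "finite (monomials_of_degree n d)"
proof (rule finite_subset)
  show "monomials_of_degree n d \<subseteq> {\<mu>. keys \<mu> \<subseteq> {1..n} \<and> (\<forall>v. lookup \<mu> v \<le> d)}"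
    by (auto simp: monomials_of_degree_altdef lookup_le_wt)
qed (rule finite_bounded_monomials, simp)

lemma single_in_monomials: "j \<in> {1..n} \<Longrightarrow> single j d \<in> monomials_of_degree n d"
  by (auto simp: monomials_of_degree_def)

lemma complex_root_exists: "d > 0 \<Longrightarrow> \<exists>z :: complex. z ^ d = w"
proof -
  assume "d > 0"
  have "\<not> constant (poly (monom 1 d - [:w:]))"
  proof
    assume "constant (poly (monom 1 d - [:w:]))"
    then have "poly (monom 1 d - [:w:]) 0 = poly (monom 1 d - [:w:]) 1" unfolding constant_def by blast
    then show False using \<open>d > 0\<close> by (simp add: poly_monom power_0_left)
  qed
  from fundamental_theorem_of_algebra[OF this] show ?thesis by (auto simp: poly_monom)
qed

type_synonym coeff_point = "nat \<times> (nat \<Rightarrow>\<^sub>0 nat) \<Rightarrow> complex"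

locale generic_forms =
  fixes n d :: nat
  assumes n2: "n \<ge> 2" and d1: "d \<ge> 1"
begin

definition form_val :: "coeff_point \<Rightarrow> nat \<Rightarrow> (nat \<Rightarrow> complex) \<Rightarrow> complex" where
  "form_val a i x = (\<Sum>\<alpha>\<in>monomials_of_degree n d. a (i, \<alpha>) * mono_val x \<alpha>)"

definition common_zero :: "coeff_point \<Rightarrow> (nat \<Rightarrow> complex) \<Rightarrow> bool" where
  "common_zero a x \<longleftrightarrow> (\<exists>j\<in>{1..n}. x j \<noteq> 0) \<and> (\<forall>i\<in>{1..n}. form_val a i x = 0)"

definition vanishing :: "(nat \<times> (nat \<Rightarrow>\<^sub>0 nat)) cpoly set" where
  "vanishing = {P. \<forall>a x. common_zero a x \<longrightarrow> poly_eval a P = 0}"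

lemma vanishing_diff: "P \<in> vanishing \<Longrightarrow> Q \<in> vanishing \<Longrightarrow> P - Q \<in> vanishing"
  by (auto simp: vanishing_def poly_eval_diff)

lemma vanishing_mult: "P \<in> vanishing \<Longrightarrow> P * Q \<in> vanishing"
  by (auto simp: vanishing_def poly_eval_mult)

lemma form_val_scale: "form_val a i (\<lambda>v. s * x v) = s ^ d * form_val a i x"
proof -
  have "mono_val (\<lambda>v. s * x v) \<alpha> = s ^ d * mono_val x \<alpha>" if "\<alpha> \<in> monomials_of_degree n d" for \<alpha>
    using mono_val_scale[of UNIV s x \<alpha>] that by (simp add: monomials_of_degree_altdef)
  then show ?thesis by (simp add: form_val_def sum_distrib_left mult_ac)
qed

lemma vanishing_not_unit: "P dvd 1 \<Longrightarrow> P \<notin> vanishing"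
proof
  assume "P dvd 1" "P \<in> vanishing"
  then obtain Q where Q: "1 = P * Q" by (auto simp: dvd_def)
  have "common_zero (\<lambda>_. 0) (\<lambda>_. 1)" using n2 by (auto simp: common_zero_def form_val_def)
  then have "poly_eval (\<lambda>_. 0) P = 0" using \<open>P \<in> vanishing\<close> unfolding vanishing_def by blast
  then have "poly_eval (\<lambda>_. 0) (P * Q) = 0" by (simp add: poly_eval_mult)
  then show False unfolding Q[symmetric] by simp
qed

text \<open>
  Any two points of the variety of systems with a common zero lie on a polynomial curve whose
  general point is in the variety: the common zero moves along a line, and the interpolated forms
  are corrected by a multiple of a form \<open>h\<close> that vanishes at neither end.
\<close>

lemma vanishing_prime:
  assumes "P * Q \<in> vanishing"
  shows "P \<in> vanishing \<or> Q \<in> vanishing"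
proof (rule ccontr)
  assume "\<not> (P \<in> vanishing \<or> Q \<in> vanishing)"
  then obtain a1 x1 a2 x2 where z1: "common_zero a1 x1" and P: "poly_eval a1 P \<noteq> 0"
    and z2: "common_zero a2 x2" and Q: "poly_eval a2 Q \<noteq> 0"
    by (auto simp: vanishing_def)
  obtain j1 j2 where j: "j1 \<in> {1..n}" "x1 j1 \<noteq> 0" "j2 \<in> {1..n}" "x2 j2 \<noteq> 0"
    using z1 z2 by (auto simp: common_zero_def)
  let ?M = "monomials_of_degree n d"
  \<comment> \<open>The form \<open>c1 x_j1^d + c2 x_j2^d\<close> has to be nonzero at both points.
    A single power works unless \<open>x2 j1\<close> and \<open>x1 j2\<close> are both 0, and then
    the sum works.\<close>
  obtain c1 c2 where c: "c1 * x1 j1 ^ d + c2 * x1 j2 ^ d \<noteq> 0" "c1 * x2 j1 ^ d + c2 * x2 j2 ^ d \<noteq> 0"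
  proof -
    consider "x2 j1 \<noteq> 0" | "x2 j1 = 0" "x1 j2 \<noteq> 0" | "x2 j1 = 0" "x1 j2 = 0" by blast
    then show ?thesis
    proof cases
      case 1 then show ?thesis using j that[of 1 0] by simp
    next
      case 2 then show ?thesis using j that[of 0 1] by simp
    next
      case 3 then show ?thesis using j d1 that[of 1 1] by (simp add: power_0_left)
    qed
  qed
  define H where "H = (\<lambda>x :: nat \<Rightarrow> complex. c1 * x j1 ^ d + c2 * x j2 ^ d)"
  define h where "h = (\<lambda>\<alpha>. (c1 when \<alpha> = single j1 d) + (c2 when \<alpha> = single j2 d))"
  have h: "(\<Sum>\<alpha>\<in>?M. h \<alpha> * mono_val x \<alpha>) = H x" for x
    using j by (simp add: h_def H_def distrib_right sum.distrib when_mult when_def if_distrib[of "\<lambda>c. c * _"]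
        single_in_monomials cong: if_cong)
  define X where "X = (\<lambda>v. [:x1 v, x2 v - x1 v:])"
  define F where "F = (\<lambda>v. [:a1 v, a2 v - a1 v:])"
  \<comment> \<open>Linear interpolation of \<open>1 / H\<close>, so that \<open>e * K\<close> is 1
    at both ends.\<close>
  define e where "e = [:1 / H x1, 1 / H x2 - 1 / H x1:]"
  define K where "K = smult c1 (X j1 ^ d) + smult c2 (X j2 ^ d)"
  define E where "E = (\<lambda>i. if i \<in> {1..n} then \<Sum>\<alpha>\<in>?M. F (i, \<alpha>) * mono_val X \<alpha> else 0)"
  \<comment> \<open>At the moving point \<open>X\<close> both terms sum to
    \<open>e * K * E i\<close> and cancel. At the ends \<open>e * K\<close> is 1 and
    \<open>E i\<close> is 0, so the curve runs from \<open>a1\<close> to \<open>a2\<close>.\<close>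
  define \<gamma> where "\<gamma> = (\<lambda>(i, \<alpha>). e * K * F (i, \<alpha>) - smult (h \<alpha>) (e * E i))"
  have K: "poly K s = H (\<lambda>v. poly (X v) s)" for s by (simp add: K_def H_def)
  have poly_mono: "poly (mono_val X \<alpha>) s = mono_val (\<lambda>v. poly (X v) s) \<alpha>" for \<alpha> s
    by (simp add: mono_val_def poly_prod)
  have E: "poly (E i) s = form_val (\<lambda>v. poly (F v) s) i (\<lambda>v. poly (X v) s)" if "i \<in> {1..n}" for i s
    using that by (simp add: E_def form_val_def poly_sum poly_mono)
  have ends: "(\<lambda>v. poly (X v) 0) = x1" "(\<lambda>v. poly (X v) 1) = x2"
    "(\<lambda>v. poly (F v) 0) = a1" "(\<lambda>v. poly (F v) 1) = a2"
    by (auto simp: X_def F_def)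
  have H0: "H x1 \<noteq> 0" "H x2 \<noteq> 0" using c by (auto simp: H_def)
  have eK: "poly e 0 * poly K 0 = 1" "poly e 1 * poly K 1 = 1"
    using H0 by (auto simp: K ends e_def)
  have E0: "poly (E i) 0 = 0" "poly (E i) 1 = 0" for i
    using z1 z2 E[of i] by (cases "i \<in> {1..n}"; simp add: ends common_zero_def E_def)+
  have "poly (\<gamma> v) 0 = a1 v" "poly (\<gamma> v) 1 = a2 v" for v
    by (cases v; simp add: \<gamma>_def E0 eK; simp add: F_def)+
  then have pq: "poly (curve_eval \<gamma> P) 0 \<noteq> 0" "poly (curve_eval \<gamma> Q) 1 \<noteq> 0" "poly (X j1) 0 \<noteq> 0"
    using P Q j by (auto simp: poly_curve_eval X_def)
  \<comment> \<open>The factor \<open>X j1\<close> ensures that the moving point is nonzero at the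
    chosen parameter.\<close>
  then have "curve_eval \<gamma> P * curve_eval \<gamma> Q * X j1 \<noteq> 0" by auto
  then obtain s where s: "poly (curve_eval \<gamma> P) s \<noteq> 0" "poly (curve_eval \<gamma> Q) s \<noteq> 0" "poly (X j1) s \<noteq> 0"
    using poly_all_0_iff_0[of "curve_eval \<gamma> P * curve_eval \<gamma> Q * X j1"] by auto
  have "form_val (\<lambda>v. poly (\<gamma> v) s) i (\<lambda>v. poly (X v) s) = 0" if i: "i \<in> {1..n}" for i
  proof -
    let ?x = "\<lambda>v. poly (X v) s"
    have "form_val (\<lambda>v. poly (\<gamma> v) s) i ?x =
        (\<Sum>\<alpha>\<in>?M. poly e s * poly K s * (poly (F (i, \<alpha>)) s * mono_val ?x \<alpha>)
            - poly e s * poly (E i) s * (h \<alpha> * mono_val ?x \<alpha>))"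
      unfolding form_val_def by (intro sum.cong refl) (simp add: \<gamma>_def algebra_simps)
    also have "\<dots> = poly e s * poly K s * form_val (\<lambda>v. poly (F v) s) i ?x -
        poly e s * poly (E i) s * H ?x"
      by (simp add: sum_subtractf h form_val_def flip: sum_distrib_left)
    also have "\<dots> = 0" using i by (simp add: E K)
    finally show ?thesis .
  qed
  then have "common_zero (\<lambda>v. poly (\<gamma> v) s) (\<lambda>v. poly (X v) s)"
    using s j by (auto simp: common_zero_def)
  then have "poly_eval (\<lambda>v. poly (\<gamma> v) s) (P * Q) = 0"
    using assms unfolding vanishing_def by blast
  then show False using s by (simp add: poly_eval_mult poly_curve_eval)
qed

text \<open>
  The other coefficients of a system with a common zero can be prescribed generically. The
  leading part in the coefficients of \<open>x\<^sub>i\<^sup>d\<close> and \<open>x\<^sub>n\<^sup>d\<close> of the first \<open>n - 1\<close> forms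
  reduces this to the solvable system \<open>a\<^sub>i x\<^sub>i\<^sup>d + b\<^sub>i = 0\<close>.
\<close>

lemma vanishing_free_eq_0:
  assumes P: "P \<in> vanishing" and free: "P \<in> vars_in (- {(n, single n d)})"
  shows "P = 0"
proof (rule ccontr)
  assume "P \<noteq> 0"
  let ?M = "monomials_of_degree n d"
  define W where "W = (\<lambda>i. (i, single i d)) ` {1..<n} \<union> (\<lambda>i. (i, single n d)) ` {1..<n}"
  define e where "e = Max (wt W ` keys P)"
  have e: "wt W \<mu> \<le> e" if "\<mu> \<in> keys P" for \<mu> using that by (simp add: e_def)
  define top where "top = filt (\<lambda>\<mu>. wt W \<mu> = e) P"
  have "e \<in> wt W ` keys P" unfolding e_def using \<open>P \<noteq> 0\<close> by (intro Max_in) auto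
  then obtain \<mu> where "\<mu> \<in> keys P" "wt W \<mu> = e" by auto
  then have "\<mu> \<in> keys top" by (simp add: top_def keys_filt)
  then have "top \<noteq> 0" by auto
  have sd: "single i d \<noteq> single n d" if "i \<in> {1..<n}" for i
  proof
    assume "single i d = single n d"
    then have "lookup (single i d) i = lookup (single n d) i" by simp
    then show False using that d1 by (simp add: lookup_single when_def)
  qed
  \<comment> \<open>The extra product absorbs the points where some \<open>a (i, single i d)\<close>
    is 0 and the division below would fail.\<close>
  have "poly_eval a (top * (\<Prod>i\<in>{1..<n}. Var (i, single i d))) = 0" for a
  proof (cases "\<exists>i\<in>{1..<n}. a (i, single i d) = 0")
    case True
    then have "(\<Prod>i\<in>{1..<n}. a (i, single i d)) = 0" by (intro prod_zero) auto
    then show ?thesis by (simp add: poly_eval_mult poly_eval_prod)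
  next
    case False
    have "\<forall>i. \<exists>z. z ^ d = - a (i, single n d) / a (i, single i d)"
      using complex_root_exists d1 by simp
    then obtain y where y: "\<And>i. y i ^ d = - a (i, single n d) / a (i, single i d)" by metis
    define x where "x = y(n := 1)"
    \<comment> \<open>With \<open>x n = 1\<close>, adding \<open>g i\<close> to the coefficient of
      \<open>x_n^d\<close> cancels the terms of the \<open>i\<close>-th form other than those in
      \<open>x_i^d\<close> and \<open>x_n^d\<close>. The last form is solved by its own coefficient
      of \<open>x_n^d\<close>, which does not occur in \<open>P\<close>.\<close>
    define g where "g = (\<lambda>i. - (\<Sum>\<alpha>\<in>?M - {single i d, single n d}. a (i, \<alpha>) * mono_val x \<alpha>))"
    define b where "b = (\<lambda>(i, \<alpha>). if \<alpha> = single n d then g i else 0)"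
    define a' where "a' = a((n, single n d) := g n)"
    define \<gamma> where "\<gamma> = (\<lambda>v. if v \<in> W then [:b v, a' v:] else [:a' v:])"
    \<comment> \<open>For every \<open>s\<close> the same \<open>x\<close> is a common zero: terms
      linear in \<open>s\<close> cancel by the choice of \<open>y\<close>, the constant ones by that
      of \<open>g\<close>.\<close>
    have "poly (curve_eval \<gamma> P) s = 0" for s
    proof -
      have "form_val (\<lambda>v. poly (\<gamma> v) s) i x = 0" if i: "i \<in> {1..n}" for i
      proof (cases "i = n")
        case True
        have nW: "(n, \<alpha>) \<notin> W" for \<alpha> by (auto simp: W_def)
        have "form_val (\<lambda>v. poly (\<gamma> v) s) n x = (\<Sum>\<alpha>\<in>?M. a' (n, \<alpha>) * mono_val x \<alpha>)"
          by (simp add: form_val_def \<gamma>_def nW)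
        also have "\<dots> = a' (n, single n d) * mono_val x (single n d) +
            (\<Sum>\<alpha>\<in>?M - {single n d}. a' (n, \<alpha>) * mono_val x \<alpha>)"
          using n2 by (intro sum.remove) (auto intro: single_in_monomials)
        also have "(\<Sum>\<alpha>\<in>?M - {single n d}. a' (n, \<alpha>) * mono_val x \<alpha>) = - g n"
          by (simp add: g_def a'_def)
        also have "a' (n, single n d) * mono_val x (single n d) = g n" by (simp add: a'_def x_def)
        finally show ?thesis using True by simp
      next
        case False
        then have i': "i \<in> {1..<n}" using i by auto
        let ?f = "\<lambda>\<alpha>. poly (\<gamma> (i, \<alpha>)) s * mono_val x \<alpha>"
        have "form_val (\<lambda>v. poly (\<gamma> v) s) i x = ?f (single n d) + sum ?f (?M - {single n d})"
          unfolding form_val_def using n2 by (intro sum.remove) (auto intro: single_in_monomials)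
        also have "sum ?f (?M - {single n d}) =
            ?f (single i d) + sum ?f (?M - {single n d} - {single i d})"
          using i sd[OF i'] by (intro sum.remove) (auto intro: single_in_monomials)
        also have "?M - {single n d} - {single i d} = ?M - {single i d, single n d}" by auto
        also have "sum ?f (?M - {single i d, single n d}) = - g i"
        proof -
          have "?f \<alpha> = a (i, \<alpha>) * mono_val x \<alpha>" if "\<alpha> \<in> ?M - {single i d, single n d}" for \<alpha>
          proof -
            have "(i, \<alpha>) \<notin> W" using that by (auto simp: W_def)
            then show ?thesis using False by (simp add: \<gamma>_def a'_def)
          qed
          then have "sum ?f (?M - {single i d, single n d}) =
              (\<Sum>\<alpha>\<in>?M - {single i d, single n d}. a (i, \<alpha>) * mono_val x \<alpha>)"
            by (rule sum.cong[OF refl])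
          then show ?thesis by (simp add: g_def)
        qed
        also have "?f (single n d) = g i + s * a (i, single n d)"
          using i' by (simp add: \<gamma>_def W_def b_def a'_def x_def)
        also have "?f (single i d) = - (s * a (i, single n d))"
        proof -
          have "(i, single i d) \<in> W" using i' by (auto simp: W_def)
          then have "?f (single i d) = s * (a (i, single i d) * y i ^ d)"
            using i' sd[OF i'] by (simp add: \<gamma>_def b_def a'_def x_def)
          also have "\<dots> = s * (- a (i, single n d))"
            using \<open>\<not> (\<exists>i\<in>{1..<n}. a (i, single i d) = 0)\<close> i' by (simp add: y)
          finally show ?thesis by simp
        qed
        finally show ?thesis by simp
      qed
      then have "common_zero (\<lambda>v. poly (\<gamma> v) s) x"
        using n2 by (auto simp: common_zero_def x_def intro!: bexI[of _ n])
      then show ?thesis using P unfolding vanishing_def poly_curve_eval by blast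
    qed
    then have "curve_eval \<gamma> P = 0" using poly_all_0_iff_0 by blast
    moreover have "coeff (curve_eval \<gamma> P) e = poly_eval a' top"
      unfolding \<gamma>_def top_def using e by (rule curve_top)
    ultimately have "poly_eval a' top = 0" by simp
    moreover have "poly_eval a top = poly_eval a' top"
      unfolding top_def by (rule poly_eval_cong[OF filt_in_vars[OF free]]) (auto simp: a'_def)
    ultimately show ?thesis by (simp add: poly_eval_mult)
  qed
  then have "top * (\<Prod>i\<in>{1..<n}. Var (i, single i d)) = 0" by (rule poly_eval_eq_0_imp_eq_0)
  moreover have "Var v \<noteq> 0" for v :: "nat \<times> (nat \<Rightarrow>\<^sub>0 nat)"
  proof -
    have "poly_eval (\<lambda>_. 1) (Var v) = 1" by simp
    then show ?thesis by (auto simp: poly_eval_zero simp del: poly_eval_Var)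
  qed
  ultimately show False using \<open>top \<noteq> 0\<close> by (simp add: prod_zero_iff)
qed

end

section \<open>Determinants vanishing on systems with a common zero\<close>

lemma monomials_of_degree_add:
  assumes "\<alpha> \<in> monomials_of_degree n e" "\<beta> \<in> monomials_of_degree n f"
  shows "\<alpha> + \<beta> \<in> monomials_of_degree n (e + f)"
  using assms Poly_Mapping.keys_add[of \<alpha> \<beta>] by (auto simp: monomials_of_degree_altdef wt_add)

lemma is_form_mult:
  assumes "is_form n e p" "is_form n f q"
  shows "is_form n (e + f) (p * q)"
  unfolding is_form_def
proof
  fix \<mu> assume "\<mu> \<in> keys (p * q)"
  then obtain \<alpha> \<beta> where "\<alpha> \<in> keys p" "\<beta> \<in> keys q" "\<mu> = \<alpha> + \<beta>"
    using Poly_Mapping.keys_mult[of p q] by auto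
  then show "\<mu> \<in> monomials_of_degree n (e + f)"
    using assms monomials_of_degree_add[of \<alpha> n e \<beta> f] unfolding is_form_def by blast
qed

lemma is_form_add: "is_form n e p \<Longrightarrow> is_form n e q \<Longrightarrow> is_form n e (p + q)"
  using Poly_Mapping.keys_add[of p q] unfolding is_form_def by blast

lemma is_form_0 [simp]: "is_form n e 0"
  by (simp add: is_form_def)

lemma is_form_sum: "(\<And>i. i \<in> I \<Longrightarrow> is_form n e (f i)) \<Longrightarrow> is_form n e (sum f I)"
  by (induction I rule: infinite_finite_induct) (auto intro: is_form_add)

lemma lookup_mult_sum_single:
  assumes "finite B"
  shows "lookup (p * (\<Sum>\<alpha>\<in>B. single \<alpha> (c \<alpha>))) \<gamma> =
    (\<Sum>\<alpha>\<in>B. (\<Sum>\<eta>\<in>keys p. lookup p \<eta> when \<eta> + \<alpha> = \<gamma>) * c \<alpha>)"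
proof -
  have "p * (\<Sum>\<alpha>\<in>B. single \<alpha> (c \<alpha>)) = (\<Sum>\<alpha>\<in>B. \<Sum>\<eta>\<in>keys p. single (\<eta> + \<alpha>) (lookup p \<eta> * c \<alpha>))"
    by (subst sum_single_keys[of p, symmetric])
      (simp add: sum_distrib_left sum_distrib_right mult_single)
  then show ?thesis
    by (simp add: lookup_sum lookup_single sum_distrib_right mult_when when_mult)
qed

lemma lookup_Const_mult: "lookup (Const c * p) \<gamma> = c * lookup p \<gamma>"
  using lookup_mult_sum_single[of "keys p" "Const c" "lookup p" \<gamma>]
  by (cases "c = 0") (simp_all add: sum_single_keys Const_def when_mult in_keys_iff
    when_def[of "_ * _"] sum.delta)

lemma det_scale_rows:
  assumes "A \<in> carrier_mat k k"
  shows "det (mat k k (\<lambda>(r, c). f r * A $$ (r, c))) = (\<Prod>r<k. f r) * det A"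
proof -
  have "det (mat k k (\<lambda>(r, c). f r * A $$ (r, c))) =
      (\<Sum>p\<in>{p. p permutes {0..<k}}. signof p * (\<Prod>i = 0..<k. f i * A $$ (i, p i)))"
  proof (subst det_def'[of _ k], force, intro sum.cong refl)
    fix p assume "p \<in> {p. p permutes {0..<k}}"
    then have "p i < k" if "i < k" for i using that permutes_in_image[of p "{0..<k}" i] by auto
    then show "signof p * (\<Prod>i = 0..<k. mat k k (\<lambda>(r, c). f r * A $$ (r, c)) $$ (i, p i)) =
        signof p * (\<Prod>i = 0..<k. f i * A $$ (i, p i))"
      by (intro arg_cong[of _ _ "\<lambda>z. signof p * z"] prod.cong) auto
  qed
  then show ?thesis using assms
    by (simp add: det_def' prod.distrib sum_distrib_left mult.left_commute lessThan_atLeast0)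
qed

lemma det_mem:
  assumes "subring_set S" "A \<in> carrier_mat k k" "\<And>i j. i < k \<Longrightarrow> j < k \<Longrightarrow> A $$ (i, j) \<in> S"
  shows "det A \<in> S"
proof -
  interpret subring_set S by fact
  have "signof p * (\<Prod>i = 0..<k. A $$ (i, p i)) \<in> S" if "p permutes {0..<k}" for p
  proof (intro mult_mem prod_mem assms(3))
    show "(signof p) \<in> S" by (auto simp: sign_def intro: one_mem uminus_mem)
    fix i assume "i \<in> {0..<k}"
    then show "i < k" "p i < k" using permutes_in_image[OF that, of i] by auto
  qed
  then show ?thesis unfolding det_def'[OF assms(2)] by (intro sum_mem) auto
qed

lemma comm_ring_hom_poly_eval: "comm_ring_hom (poly_eval a)"
  by unfold_locales (auto simp: poly_eval_hom)

context generic_forms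
begin

definition form_of :: "coeff_point \<Rightarrow> nat \<Rightarrow> nat cpoly" where
  "form_of a i = (\<Sum>\<alpha>\<in>monomials_of_degree n d. single \<alpha> (a (i, \<alpha>)))"

lemma poly_eval_form_of: "poly_eval x (form_of a i) = form_val a i x"
  by (simp add: form_of_def form_val_def poly_eval_sum)

lemma is_form_form_of: "is_form n d (form_of a i)"
  unfolding form_of_def by (intro is_form_sum) (auto simp: is_form_def)

abbreviation "coeff_vars \<equiv> {1..n} \<times> monomials_of_degree n d"

text \<open>Rows and columns are indexed by the monomials of degree \<open>N\<close>, and row
  \<open>\<beta>\<close> lists the coefficients of \<open>Q a \<beta>\<close>. A common zero
  \<open>x\<close> puts the nonzero vector of monomial values at \<open>x\<close> into the kernel.
  The multipliers \<open>H\<close> do not depend on \<open>a\<close>, so the determinant is a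
  polynomial in the coefficients. It is used with Macaulay's multipliers and with those from the
  Nullstellensatz.\<close>

lemma resultant_determinant:
  fixes H :: "(nat \<Rightarrow>\<^sub>0 nat) \<Rightarrow> nat \<Rightarrow> nat cpoly"
  assumes N: "N \<ge> d" and H: "\<And>\<beta> i. is_form n (N - d) (H \<beta> i)"
  defines "Q \<equiv> \<lambda>a \<beta>. \<Sum>i=1..n. H \<beta> i * form_of a i"
  defines "B \<equiv> monomials_of_degree n N"
  obtains D where "D \<in> vanishing" "D \<in> vars_in coeff_vars"
    "\<forall>a. (\<forall>\<beta>\<in>B. Q a \<beta> = single \<beta> 1) \<longrightarrow> poly_eval a D = 1"
    "\<forall>a a' f. (\<forall>\<beta>\<in>B. Q a' \<beta> = Const (f \<beta>) * Q a \<beta>) \<longrightarrow>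
       poly_eval a' D = (\<Prod>\<beta>\<in>B. f \<beta>) * poly_eval a D"
proof -
  have "finite B" by (simp add: B_def)
  then obtain bs where bs: "set bs = B" "distinct bs" using finite_distinct_list by blast
  define k where "k = length bs"
  have bsB: "bs ! r \<in> B" if "r < k" for r using that bs by (auto simp: k_def)
  have bij: "bij_betw (\<lambda>r. bs ! r) {..<k} B"
    using bij_betw_nth[OF bs(2), of "{..<k}" B] bs by (simp add: k_def)
  define h where "h = (\<lambda>r c i \<alpha>. \<Sum>\<eta>\<in>keys (H (bs ! r) i). lookup (H (bs ! r) i) \<eta> when \<eta> + \<alpha> = bs ! c)"
  define entry where "entry = (\<lambda>r c. \<Sum>i=1..n. \<Sum>\<alpha>\<in>monomials_of_degree n d. Const (h r c i \<alpha>) * Var (i, \<alpha>))"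
  define D where "D = det (mat k k (\<lambda>(r, c). entry r c))"
  define M where "M = (\<lambda>a. mat k k (\<lambda>(r, c). lookup (Q a (bs ! r)) (bs ! c)))"
  have M [simp]: "M a \<in> carrier_mat k k" for a by (simp add: M_def)
  have entry: "poly_eval a (entry r c) = lookup (Q a (bs ! r)) (bs ! c)" for a r c
    by (simp add: entry_def Q_def lookup_sum form_of_def lookup_mult_sum_single poly_eval_sum
        poly_eval_mult h_def)
  have D: "poly_eval a D = det (M a)" for a
  proof -
    interpret comm_ring_hom "poly_eval a" by (rule comm_ring_hom_poly_eval)
    have "map_mat (poly_eval a) (mat k k (\<lambda>(r, c). entry r c)) = M a"
      by (auto simp: M_def entry intro!: eq_matI)
    then show ?thesis unfolding D_def by (simp flip: hom_det)
  qed
  have "D \<in> vars_in coeff_vars"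
  proof -
    interpret V: subring_set "vars_in coeff_vars" by (rule subring_vars_in)
    have "entry r c \<in> vars_in coeff_vars" for r c
      unfolding entry_def by (intro V.sum_mem V.mult_mem Var_in_vars Const_in_vars) auto
    then show ?thesis unfolding D_def by (intro det_mem[OF subring_vars_in, of _ k]) auto
  qed
  moreover have "D \<in> vanishing"
  proof -
    have "det (M a) = 0" if "common_zero a x" for a x
    proof -
      define v where "v = vec k (\<lambda>c. mono_val x (bs ! c))"
      have Q0: "(\<Sum>c<k. lookup (Q a \<beta>) (bs ! c) * mono_val x (bs ! c)) = 0" for \<beta>
      proof -
        have "is_form n (N - d + d) (Q a \<beta>)"
          unfolding Q_def by (intro is_form_sum is_form_mult H is_form_form_of)
        then have "keys (Q a \<beta>) \<subseteq> B" using N by (simp add: is_form_def B_def)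
        then have "poly_eval x (Q a \<beta>) = (\<Sum>\<gamma>\<in>B. lookup (Q a \<beta>) \<gamma> * mono_val x \<gamma>)"
          by (intro poly_eval_superset') (auto simp: B_def)
        also have "\<dots> = (\<Sum>c<k. lookup (Q a \<beta>) (bs ! c) * mono_val x (bs ! c))"
          by (rule sum.reindex_bij_betw[OF bij, symmetric])
        finally have "(\<Sum>c<k. lookup (Q a \<beta>) (bs ! c) * mono_val x (bs ! c)) = poly_eval x (Q a \<beta>)" ..
        also have "\<dots> = 0"
          using that by (simp add: Q_def poly_eval_hom poly_eval_form_of common_zero_def)
        finally show ?thesis .
      qed
      have "M a *\<^sub>v v = 0\<^sub>v k"
        by (rule eq_vecI) (auto simp: M_def v_def scalar_prod_def Q0[unfolded lessThan_atLeast0])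
      moreover have "v \<noteq> 0\<^sub>v k"
      proof -
        obtain j where j: "j \<in> {1..n}" "x j \<noteq> 0"
          using \<open>common_zero a x\<close> unfolding common_zero_def by blast
        then have "single j N \<in> set bs" using single_in_monomials[of j n N] by (simp add: bs B_def)
        then obtain c where "c < k" "bs ! c = single j N" by (auto simp: in_set_conv_nth k_def)
        then have "v $ c \<noteq> 0" using j by (simp add: v_def)
        then show ?thesis using \<open>c < k\<close> by auto
      qed
      moreover have "v \<in> carrier_vec k" by (simp add: v_def)
      ultimately show ?thesis unfolding det_0_iff_vec_prod_zero_field[OF M] by blast
    qed
    then show ?thesis by (auto simp: vanishing_def D)
  qed
  moreover have "poly_eval a D = 1" if "\<And>\<beta>. \<beta> \<in> B \<Longrightarrow> Q a \<beta> = single \<beta> 1" for a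
  proof -
    have "M a = 1\<^sub>m k"
      using that bsB bs(2) unfolding M_def
      by (intro eq_matI) (auto simp: lookup_single when_def nth_eq_iff_index_eq k_def)
    then show ?thesis by (simp add: D)
  qed
  moreover have "poly_eval a' D = (\<Prod>\<beta>\<in>B. f \<beta>) * poly_eval a D"
    if eq: "\<And>\<beta>. \<beta> \<in> B \<Longrightarrow> Q a' \<beta> = Const (f \<beta>) * Q a \<beta>" for a a' f
  proof -
    have "M a' = mat k k (\<lambda>(r, c). f (bs ! r) * M a $$ (r, c))"
      using eq bsB unfolding M_def by (intro eq_matI) (auto simp: lookup_Const_mult)
    then have "det (M a') = (\<Prod>r<k. f (bs ! r)) * det (M a)" by (simp add: det_scale_rows)
    also have "(\<Prod>r<k. f (bs ! r)) = (\<Prod>\<beta>\<in>B. f \<beta>)" by (rule prod.reindex_bij_betw[OF bij])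
    finally show ?thesis by (simp add: D)
  qed
  ultimately show ?thesis by (intro that) blast+
qed

section \<open>Macaulay's determinants\<close>

definition diag_point :: coeff_point where
  "diag_point = (\<lambda>(i, \<alpha>). 1 when \<alpha> = single i d)"

definition scale_form :: "nat \<Rightarrow> complex \<Rightarrow> coeff_point \<Rightarrow> coeff_point" where
  "scale_form k s a = (\<lambda>v. if v \<in> {k} \<times> UNIV then s * a v else a v)"

lemma form_of_diag_point: "i \<in> {1..n} \<Longrightarrow> form_of diag_point i = single (single i d) 1"
  by (rule poly_mapping_eqI)
    (auto simp: form_of_def diag_point_def lookup_sum lookup_single when_def single_in_monomials
      intro!: sum.neutral)

lemma form_of_scale_form: "form_of (scale_form k s a) i = Const (if i = k then s else 1) * form_of a i"
  by (auto simp: form_of_def scale_form_def sum_distrib_left Const_def mult_single)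

text \<open>In row \<open>\<beta>\<close> a factor \<open>x_i^d\<close> of the monomial is replaced
  by the \<open>i\<close>-th form, so the diagonal system gives the identity matrix. The form
  \<open>k\<close> is used only if all other exponents are below \<open>d\<close>; these exponents
  determine \<open>\<beta>\<close>, so at most \<open>d^(n - 1)\<close> rows scale with that
  form.\<close>

lemma macaulay_determinant:
  assumes k: "k \<in> {1..n}"
  shows "\<exists>D e. e \<le> d ^ (n - 1) \<and> D \<in> vanishing \<and> D \<in> vars_in coeff_vars \<and>
    poly_eval diag_point D = 1 \<and> (\<forall>a s. poly_eval (scale_form k s a) D = s ^ e * poly_eval a D)"
proof -
  \<comment> \<open>The least degree in which every monomial is divisible by some
    \<open>x_i^d\<close>.\<close>
  define N where "N = n * (d - 1) + 1"
  have N: "N \<ge> d" using n2 d1 unfolding N_def by (cases n; cases d) auto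
  let ?B = "monomials_of_degree n N"
  let ?P = "\<lambda>\<beta> i. i \<in> {1..n} \<and> i \<noteq> k \<and> d \<le> lookup \<beta> i"
  define idx where "idx = (\<lambda>\<beta>. if \<exists>i. ?P \<beta> i then SOME i. ?P \<beta> i else k)"
  have sum_B: "(\<Sum>i=1..n. lookup \<beta> i) = N" if "\<beta> \<in> ?B" for \<beta>
    using that wt_superset[of "{1..n}" \<beta> UNIV] by (simp add: monomials_of_degree_altdef)
  have idx: "idx \<beta> \<in> {1..n} \<and> d \<le> lookup \<beta> (idx \<beta>)" if "\<beta> \<in> ?B" for \<beta>
  proof (cases "\<exists>i. ?P \<beta> i")
    case True
    then have "?P \<beta> (SOME i. ?P \<beta> i)" by (rule someI_ex)
    then show ?thesis using True by (simp add: idx_def)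
  next
    case False
    have "d \<le> lookup \<beta> k"
    proof (rule ccontr)
      assume "\<not> d \<le> lookup \<beta> k"
      then have "lookup \<beta> i \<le> d - 1" if "i \<in> {1..n}" for i using that False by (cases "i = k") force+
      then have "(\<Sum>i=1..n. lookup \<beta> i) \<le> (\<Sum>i=1..n. d - 1)" by (rule sum_mono)
      then show False using sum_B[OF \<open>\<beta> \<in> ?B\<close>] by (simp add: N_def)
    qed
    moreover have "idx \<beta> = k" unfolding idx_def by (rule if_not_P[OF False])
    ultimately show ?thesis using k by simp
  qed
  define H :: "(nat \<Rightarrow>\<^sub>0 nat) \<Rightarrow> nat \<Rightarrow> nat cpoly" where
    "H = (\<lambda>\<beta> i. if \<beta> \<in> ?B \<and> i = idx \<beta> then single (\<beta> - single i d) 1 else 0)"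
  have minus: "\<beta> = (\<beta> - single (idx \<beta>) d) + single (idx \<beta>) d" if "\<beta> \<in> ?B" for \<beta>
    using idx[OF that] by (intro poly_mapping_eqI) (auto simp: lookup_add lookup_minus lookup_single when_def)
  have H: "is_form n (N - d) (H \<beta> i)" for \<beta> i
  proof (cases "\<beta> \<in> ?B \<and> i = idx \<beta>")
    case True
    then have \<beta>: "\<beta> \<in> ?B" by simp
    let ?\<nu> = "\<beta> - single (idx \<beta>) d"
    have "wt UNIV \<beta> = wt UNIV ?\<nu> + d"
      using arg_cong[OF minus[OF \<beta>], of "wt UNIV"] by (simp add: wt_add) (simp add: wt_def)
    moreover have "keys ?\<nu> \<subseteq> keys \<beta>" by (auto simp: in_keys_iff lookup_minus)
    ultimately have "?\<nu> \<in> monomials_of_degree n (N - d)"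
      using \<beta> unfolding monomials_of_degree_altdef by auto
    then show ?thesis using True by (simp add: H_def is_form_def)
  qed (auto simp: H_def)
  let ?Q = "\<lambda>a \<beta>. \<Sum>i=1..n. H \<beta> i * form_of a i"
  have Q: "?Q a \<beta> = single (\<beta> - single (idx \<beta>) d) 1 * form_of a (idx \<beta>)" if "\<beta> \<in> ?B" for a \<beta>
  proof -
    have "?Q a \<beta> = (\<Sum>i\<in>{idx \<beta>}. H \<beta> i * form_of a i)"
      using idx[OF that] by (intro sum.mono_neutral_right) (auto simp: H_def)
    then show ?thesis using that by (simp add: H_def)
  qed
  obtain D where D: "D \<in> vanishing" "D \<in> vars_in coeff_vars"
    and one: "\<forall>a. (\<forall>\<beta>\<in>?B. ?Q a \<beta> = single \<beta> 1) \<longrightarrow> poly_eval a D = 1"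
    and scale: "\<forall>a a' f. (\<forall>\<beta>\<in>?B. ?Q a' \<beta> = Const (f \<beta>) * ?Q a \<beta>) \<longrightarrow>
       poly_eval a' D = (\<Prod>\<beta>\<in>?B. f \<beta>) * poly_eval a D"
    by (rule resultant_determinant[OF N, of H, OF H])
  have "poly_eval diag_point D = 1"
  proof (rule one[rule_format])
    fix \<beta> assume \<beta>: "\<beta> \<in> ?B"
    then show "?Q diag_point \<beta> = single \<beta> 1"
      unfolding Q[OF \<beta>] using idx[OF \<beta>] minus[OF \<beta>] by (simp add: form_of_diag_point mult_single)
  qed
  moreover define e where "e = card {\<beta>\<in>?B. idx \<beta> = k}"
  have "poly_eval (scale_form k s a) D = s ^ e * poly_eval a D" for a s
  proof -
    have "poly_eval (scale_form k s a) D = (\<Prod>\<beta>\<in>?B. if idx \<beta> = k then s else 1) * poly_eval a D"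
    proof (rule scale[rule_format])
      fix \<beta> assume \<beta>: "\<beta> \<in> ?B"
      show "?Q (scale_form k s a) \<beta> = Const (if idx \<beta> = k then s else 1) * ?Q a \<beta>"
        unfolding Q[OF \<beta>] unfolding form_of_scale_form by (rule mult.left_commute)
    qed
    also have "(\<Prod>\<beta>\<in>?B. if idx \<beta> = k then s else 1) = s ^ e"
      by (simp add: prod.If_cases e_def Collect_conj_eq Int_commute)
    finally show ?thesis .
  qed
  moreover have "e \<le> d ^ (n - 1)"
  proof -
    let ?J = "{1..n} - {k}"
    let ?r = "\<lambda>\<beta>. restrict (lookup \<beta>) ?J"
    let ?C = "{\<beta>\<in>?B. idx \<beta> = k}"
    have small: "lookup \<beta> i < d" if "\<beta> \<in> ?C" "i \<in> ?J" for \<beta> i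
    proof (rule ccontr)
      assume "\<not> lookup \<beta> i < d"
      then have ex: "\<exists>i. ?P \<beta> i" using that by (intro exI[of _ i]) auto
      then have "?P \<beta> (SOME i. ?P \<beta> i)" by (rule someI_ex)
      then have "idx \<beta> \<noteq> k" using ex by (simp add: idx_def)
      then show False using that by simp
    qed
    have "inj_on ?r ?C"
    proof (intro inj_onI poly_mapping_eqI)
      fix \<beta> \<beta>' i assume *: "\<beta> \<in> ?C" "\<beta>' \<in> ?C" "?r \<beta> = ?r \<beta>'"
      have J: "lookup \<beta> j = lookup \<beta>' j" if "j \<in> ?J" for j using fun_cong[OF *(3), of j] that by simp
      have "lookup \<beta> k + (\<Sum>j\<in>?J. lookup \<beta> j) = lookup \<beta>' k + (\<Sum>j\<in>?J. lookup \<beta>' j)"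
        using sum_B[of \<beta>] sum_B[of \<beta>'] * k sum.remove[of "{1..n}" k "lookup \<beta>"]
          sum.remove[of "{1..n}" k "lookup \<beta>'"] by simp
      then have "lookup \<beta> k = lookup \<beta>' k" using J by simp
      moreover have "lookup \<beta> i = 0 \<and> lookup \<beta>' i = 0" if "i \<notin> {1..n}"
        using * that by (auto simp: monomials_of_degree_altdef in_keys_iff)
      ultimately show "lookup \<beta> i = lookup \<beta>' i" using J by (cases "i \<in> {1..n}"; cases "i = k") auto
    qed
    moreover have "?r ` ?C \<subseteq> (\<Pi>\<^sub>E i\<in>?J. {..<d})"
      using small by (intro image_subsetI restrict_PiE_iff[THEN iffD2]) simp
    moreover have "finite (\<Pi>\<^sub>E i\<in>?J. {..<d})" by (intro finite_PiE) auto
    ultimately have "e \<le> card (\<Pi>\<^sub>E i\<in>?J. {..<d})" unfolding e_def by (rule card_inj_on_le)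
    then show ?thesis using k by (simp add: card_PiE)
  qed
  ultimately show ?thesis using D by blast
qed

end

section \<open>The Nullstellensatz\<close>

text \<open>Elimination: an equation with a nonzero coefficient is solved for the unknown
  \<open>b\<close>, which leaves one equation and one unknown fewer.\<close>

lemma linear_dependence:
  fixes w :: "'a \<Rightarrow> 'b \<Rightarrow> 'c::field"
  assumes "finite K" "finite A" "card A > card K"
  shows "\<exists>c. (\<exists>a\<in>A. c a \<noteq> 0) \<and> (\<forall>k\<in>K. (\<Sum>a\<in>A. c a * w a k) = 0)"
  using assms
proof (induction K arbitrary: A w)
  case empty
  then obtain a where "a \<in> A" by (metis card.empty less_irrefl ex_in_conv)
  then show ?case by (intro exI[of _ "\<lambda>_. 1"]) auto
next
  case (insert k K)
  show ?case
  proof (cases "\<forall>a\<in>A. w a k = 0")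
    case True
    have "card K < card A" using insert by simp
    from insert.IH[OF insert.prems(1) this, of w] True show ?thesis by auto
  next
    case False
    then obtain b where b: "b \<in> A" "w b k \<noteq> 0" by blast
    define w' where "w' = (\<lambda>a j. w a j - w a k / w b k * w b j)"
    have "card K < card (A - {b})" using insert b by simp
    from insert.IH[OF _ this, of w'] insert.prems(1) obtain c where
      c: "\<exists>a\<in>A - {b}. c a \<noteq> 0" "\<forall>j\<in>K. (\<Sum>a\<in>A - {b}. c a * w' a j) = 0" by auto
    define e where "e = - (\<Sum>a\<in>A - {b}. c a * w a k) / w b k"
    have "(\<Sum>a\<in>A. (c(b := e)) a * w a j) = 0" if "j \<in> insert k K" for j
    proof -
      have "(\<Sum>a\<in>A. (c(b := e)) a * w a j) = e * w b j + (\<Sum>a\<in>A - {b}. c a * w a j)"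
        using b insert.prems(1) by (subst sum.remove[of _ b]) auto
      also have "e * w b j = - (\<Sum>a\<in>A - {b}. c a * (w a k / w b k * w b j))"
      proof -
        have "e * w b j = - ((\<Sum>a\<in>A - {b}. c a * w a k) * (w b j / w b k))" by (simp add: e_def)
        then show ?thesis by (simp add: sum_distrib_right sum_divide_distrib mult.assoc)
      qed
      also have "\<dots> + (\<Sum>a\<in>A - {b}. c a * w a j) = (\<Sum>a\<in>A - {b}. c a * w' a j)"
        by (simp add: w'_def algebra_simps sum_subtractf)
      also have "\<dots> = 0"
      proof (cases "j = k")
        case True
        then have "w' a j = 0" for a using b by (simp add: w'_def)
        then show ?thesis by simp
      qed (use c that in auto)
      finally show ?thesis .
    qed
    then show ?thesis using c by (intro exI[of _ "c(b := e)"]) auto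
  qed
qed

section \<open>Maximal ideals and the weak Nullstellensatz\<close>

definition is_ideal :: "'v cpoly set \<Rightarrow> bool" where
  "is_ideal I \<longleftrightarrow> 0 \<in> I \<and> (\<forall>x\<in>I. \<forall>y\<in>I. x + y \<in> I) \<and> (\<forall>x\<in>I. \<forall>y. y * x \<in> I)"

lemma is_idealD:
  assumes "is_ideal I"
  shows "0 \<in> I" "x \<in> I \<Longrightarrow> y \<in> I \<Longrightarrow> x + y \<in> I" "x \<in> I \<Longrightarrow> y * x \<in> I"
    "x \<in> I \<Longrightarrow> x * y \<in> I" "x \<in> I \<Longrightarrow> y \<in> I \<Longrightarrow> x - y \<in> I"
proof -
  show *: "0 \<in> I" "x \<in> I \<Longrightarrow> y \<in> I \<Longrightarrow> x + y \<in> I" "\<And>x y. x \<in> I \<Longrightarrow> y * x \<in> I" for x y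
    using assms by (auto simp: is_ideal_def)
  show "x \<in> I \<Longrightarrow> x * y \<in> I" using *(3)[of x y] by (simp add: mult.commute)
  show "x \<in> I \<Longrightarrow> y \<in> I \<Longrightarrow> x - y \<in> I" using *(2)[of x "- y"] *(3)[of y "- 1"] by simp
qed

lemma is_ideal_sum: "is_ideal I \<Longrightarrow> (\<And>i. i \<in> A \<Longrightarrow> f i \<in> I) \<Longrightarrow> sum f A \<in> I"
  by (induction A rule: infinite_finite_induct) (auto intro: is_idealD)

text \<open>Zorn's lemma. The last conjunct is maximality in the form used later: everything outside
  \<open>M\<close> is invertible modulo \<open>M\<close>.\<close>

lemma maximal_ideal_exists:
  assumes "is_ideal I" "1 \<notin> I"
  shows "\<exists>M. is_ideal M \<and> I \<subseteq> M \<and> 1 \<notin> M \<and> (\<forall>x. x \<notin> M \<longrightarrow> (\<exists>q. 1 - q * x \<in> M))"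
proof -
  define \<A> where "\<A> = {J. is_ideal J \<and> I \<subseteq> J \<and> 1 \<notin> J}"
  have "\<A> \<noteq> {}" using assms by (auto simp: \<A>_def)
  moreover have "\<Union> C \<in> \<A>" if C: "C \<noteq> {}" "subset.chain \<A> C" for C
  proof -
    have sub: "J \<in> \<A>" if "J \<in> C" for J using C that by (auto simp: subset.chain_def)
    have "is_ideal (\<Union> C)" unfolding is_ideal_def
    proof (intro conjI ballI allI)
      show "0 \<in> \<Union> C" using C(1) sub by (fastforce simp: \<A>_def is_ideal_def)
      fix x assume "x \<in> \<Union> C"
      then obtain J where J: "J \<in> C" "x \<in> J" by blast
      show "y * x \<in> \<Union> C" for y using J sub[OF J(1)] unfolding \<A>_def is_ideal_def by blast
      fix y assume "y \<in> \<Union> C"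
      then obtain J' where J': "J' \<in> C" "y \<in> J'" by blast
      have "J \<subseteq> J' \<or> J' \<subseteq> J" using C(2) J J' by (auto simp: subset.chain_def)
      then show "x + y \<in> \<Union> C"
      proof
        assume "J \<subseteq> J'"
        then have "x + y \<in> J'" using J J' sub[OF J'(1)] by (auto simp: \<A>_def is_ideal_def)
        then show ?thesis using J' by blast
      next
        assume "J' \<subseteq> J"
        then have "x + y \<in> J" using J J' sub[OF J(1)] by (auto simp: \<A>_def is_ideal_def)
        then show ?thesis using J by blast
      qed
    qed
    then show ?thesis using C(1) sub by (fastforce simp: \<A>_def)
  qed
  ultimately obtain M where M: "M \<in> \<A>" "\<And>X. X \<in> \<A> \<Longrightarrow> M \<subseteq> X \<Longrightarrow> X = M"
    using subset_Zorn_nonempty[of \<A>] by blast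
  have id: "is_ideal M" using M by (simp add: \<A>_def)
  have "\<exists>q. 1 - q * x \<in> M" if "x \<notin> M" for x
  proof -
    define J where "J = {m + q * x |m q. m \<in> M}"
    have "is_ideal J" unfolding is_ideal_def
    proof (intro conjI ballI allI)
      show "0 \<in> J" unfolding J_def using is_idealD(1)[OF id] by (auto intro!: exI[of _ 0])
      fix y assume "y \<in> J"
      then obtain m q where y: "m \<in> M" "y = m + q * x" by (auto simp: J_def)
      have "z * y = z * m + (z * q) * x" for z using y by (simp add: algebra_simps)
      then show "z * y \<in> J" for z unfolding J_def using is_idealD(3)[OF id y(1)] by blast
      fix z assume "z \<in> J"
      then obtain m' q' where z: "m' \<in> M" "z = m' + q' * x" by (auto simp: J_def)
      have "y + z = (m + m') + (q + q') * x" using y z by (simp add: algebra_simps)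
      then show "y + z \<in> J" unfolding J_def using is_idealD(2)[OF id y(1) z(1)] by blast
    qed
    moreover have MJ: "M \<subseteq> J" unfolding J_def by (force intro: exI[of _ 0])
    moreover have "x \<in> J" unfolding J_def using is_idealD(1)[OF id] by (force intro: exI[of _ 1])
    ultimately have "J \<notin> \<A>" using M(2)[of J] \<open>x \<notin> M\<close> by blast
    then have "1 \<in> J" using \<open>is_ideal J\<close> MJ M(1) by (auto simp: \<A>_def)
    then obtain m q where "m \<in> M" "1 = m + q * x" by (auto simp: J_def)
    moreover from this have "1 - q * x = m" by (metis add_diff_cancel_right')
    ultimately have "1 - q * x \<in> M" by simp
    then show ?thesis by blast
  qed
  then show ?thesis using M(1) by (auto simp: \<A>_def)
qed

definition subst_univ :: "'v \<Rightarrow> complex poly \<Rightarrow> 'v cpoly" where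
  "subst_univ v p = (\<Sum>i\<le>degree p. Const (coeff p i) * Var v ^ i)"

lemma poly_eval_subst_univ: "poly_eval a (subst_univ v p) = poly p (a v)"
  by (simp add: subst_univ_def poly_eval_hom poly_altdef)

text \<open>
  In a maximal ideal, some \<open>x\<^sub>v - c\<close> lies: otherwise the uncountably many inverses of
  the \<open>x\<^sub>v - c\<close> are linearly dependent, as the polynomials have countable dimension, and
  clearing denominators in a relation gives a polynomial in \<open>x\<^sub>v\<close> alone.
\<close>

lemma maximal_ideal_linear:
  fixes M :: "nat cpoly set"
  assumes M: "is_ideal M" "1 \<notin> M" and max: "\<forall>x. x \<notin> M \<longrightarrow> (\<exists>q. 1 - q * x \<in> M)"
  shows "\<exists>c. Var v - Const c \<in> M"
proof (rule ccontr)
  assume neg: "\<nexists>c. Var v - Const c \<in> M"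
  note I = is_idealD[OF M(1)]
  have prime: "x \<in> M \<or> y \<in> M" if "x * y \<in> M" for x y
  proof (cases "x \<in> M")
    case False
    then obtain q where "1 - q * x \<in> M" using max by blast
    then have "(1 - q * x) * y + q * (x * y) \<in> M" by (rule I(2)[OF I(4) I(3)[OF that]])
    moreover have "(1 - q * x) * y + q * (x * y) = y" by (simp add: algebra_simps)
    ultimately show ?thesis by simp
  qed simp
  \<comment> \<open>A nonzero complex polynomial splits into linear factors, and the prime ideal
    \<open>M\<close> is assumed to contain none of those.\<close>
  have no_univ: "subst_univ v p \<notin> M" if "p \<noteq> 0" for p
    using that
  proof (induction "degree p" arbitrary: p rule: less_induct)
    case less
    show ?case
    proof (cases "degree p = 0")
      case True
      then obtain c where c: "p = [:c:]" using degree_eq_zeroE by blast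
      have eq: "Const (1 / c) * subst_univ v p = 1"
        using less.prems c by (intro poly_eval_eqI) (simp add: poly_eval_hom poly_eval_subst_univ)
      show ?thesis
      proof
        assume "subst_univ v p \<in> M"
        from I(3)[OF this, of "Const (1 / c)"] show False using eq M(2) by simp
      qed
    next
      case False
      then have "\<not> constant (poly p)" by (simp add: constant_degree)
      then obtain z where "poly p z = 0" using fundamental_theorem_of_algebra by blast
      then obtain q where q: "p = [:- z, 1:] * q" using poly_eq_0_iff_dvd by (auto simp: dvd_def)
      then have "q \<noteq> 0" using less.prems by auto
      have "degree p = 1 + degree q" unfolding q using \<open>q \<noteq> 0\<close> by (subst degree_mult_eq) auto
      then have "subst_univ v q \<notin> M" using less.hyps \<open>q \<noteq> 0\<close> by simp
      moreover have "subst_univ v p = (Var v - Const z) * subst_univ v q"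
        by (intro poly_eval_eqI) (simp add: poly_eval_hom poly_eval_subst_univ q algebra_simps)
      ultimately show ?thesis using prime neg by auto
    qed
  qed
  define L where "L = (\<lambda>c. Var v - Const c :: nat cpoly)"
  have "\<forall>c. \<exists>q. 1 - q * L c \<in> M" using neg max by (auto simp: L_def)
  then obtain Q where Q: "\<And>c. 1 - Q c * L c \<in> M" by metis
  \<comment> \<open>One number bounding both the indices of the indeterminates and the exponents, so
    polynomials with bound \<open>m\<close> lie in the span of the finite set \<open>K m\<close>;
    these spans exhaust the ring countably.\<close>
  define bound where "bound = (\<lambda>p :: nat cpoly. \<Sum>\<mu>\<in>keys p. \<Sum>v\<in>keys \<mu>. v + lookup \<mu> v)"
  define K where "K = (\<lambda>m. {\<mu> :: nat \<Rightarrow>\<^sub>0 nat. keys \<mu> \<subseteq> {..m} \<and> (\<forall>v. lookup \<mu> v \<le> m)})"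
  have finK: "finite (K m)" for m unfolding K_def by (rule finite_bounded_monomials) simp
  have keysK: "keys p \<subseteq> K (bound p)" for p
  proof
    fix \<mu> assume \<mu>: "\<mu> \<in> keys p"
    have "v + lookup \<mu> v \<le> bound p" if "v \<in> keys \<mu>" for v
    proof -
      have "v + lookup \<mu> v \<le> (\<Sum>v\<in>keys \<mu>. v + lookup \<mu> v)"
        using that by (intro member_le_sum[of v]) auto
      also have "\<dots> \<le> bound p" unfolding bound_def using \<mu> by (intro member_le_sum[of \<mu>]) auto
      finally show ?thesis .
    qed
    then have le: "v \<le> bound p" "lookup \<mu> v \<le> bound p" if "v \<in> keys \<mu>" for v
      using that by fastforce+
    have "lookup \<mu> v \<le> bound p" for v
      using le(2)[of v] by (cases "v \<in> keys \<mu>") (auto simp: in_keys_iff)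
    then show "\<mu> \<in> K (bound p)" using le(1) unfolding K_def by auto
  qed
  have "\<exists>m. infinite {c. bound (Q c) = m}"
  proof (rule ccontr)
    assume "\<nexists>m. infinite {c. bound (Q c) = m}"
    then have "countable (\<Union>m. {c. bound (Q c) = m})" by (intro countable_UN) (auto intro: countable_finite)
    moreover have "(\<Union>m. {c. bound (Q c) = m}) = UNIV" by auto
    ultimately show False using uncountable_UNIV_complex by simp
  qed
  then obtain m where "infinite {c. bound (Q c) = m}" by blast
  then obtain A where A: "finite A" "card A = card (K m) + 1" "A \<subseteq> {c. bound (Q c) = m}"
    using infinite_arbitrarily_large by blast
  obtain l where l: "\<exists>c\<in>A. l c \<noteq> 0" "\<forall>\<mu>\<in>K m. (\<Sum>c\<in>A. l c * lookup (Q c) \<mu>) = 0"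
    using linear_dependence[OF finK A(1), of m "\<lambda>c. lookup (Q c)"] A(2) by auto
  have rel: "(\<Sum>c\<in>A. Const (l c) * Q c) = 0"
  proof (rule poly_mapping_eqI)
    fix \<mu>
    have "lookup (\<Sum>c\<in>A. Const (l c) * Q c) \<mu> = (\<Sum>c\<in>A. l c * lookup (Q c) \<mu>)"
      by (simp add: lookup_sum lookup_Const_mult)
    also have "\<dots> = 0"
    proof (cases "\<mu> \<in> K m")
      case False
      have "lookup (Q c) \<mu> = 0" if "c \<in> A" for c
        using keysK[of "Q c"] A(3) that False by (auto simp: in_keys_iff)
      then show ?thesis by simp
    qed (use l in auto)
    finally show "lookup (\<Sum>c\<in>A. Const (l c) * Q c) \<mu> = lookup 0 \<mu>" by simp
  qed
  \<comment> \<open>The relation among the inverses of the \<open>x_v - c\<close>, multiplied by all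
    denominators. At a point \<open>c\<close> of \<open>A\<close> only its own summand
    survives.\<close>
  define G where "G = (\<Sum>c\<in>A. smult (l c) (\<Prod>b\<in>A - {c}. [:- b, 1:]))"
  have "G \<noteq> 0"
  proof
    obtain c where c: "c \<in> A" "l c \<noteq> 0" using l by blast
    have "poly G c = (\<Sum>c'\<in>A. l c' * (\<Prod>b\<in>A - {c'}. c - b))"
      by (simp add: G_def poly_sum poly_prod)
    also have "\<dots> = (\<Sum>c'\<in>{c}. l c' * (\<Prod>b\<in>A - {c'}. c - b))"
      using c A(1) by (intro sum.mono_neutral_right) (auto simp: prod_zero_iff)
    also have "\<dots> \<noteq> 0" using c A(1) by (auto simp: prod_zero_iff)
    finally have "poly G c \<noteq> 0" .
    moreover assume "G = 0"
    ultimately show False by simp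
  qed
  moreover have "subst_univ v G \<in> M"
  proof -
    have "subst_univ v G = (\<Sum>c\<in>A. Const (l c) * (\<Prod>b\<in>A - {c}. L b))"
      by (intro poly_eval_eqI)
        (simp add: poly_eval_subst_univ poly_eval_hom G_def poly_sum poly_prod L_def algebra_simps)
    \<comment> \<open>Modulo \<open>M\<close>, the product lacking \<open>L c\<close> equals
      \<open>Q c\<close> times the full product, so the linear relation \<open>rel\<close> makes the
      sum vanish there.\<close>
    also have "\<dots> = (\<Sum>c\<in>A. (Const (l c) * (\<Prod>b\<in>A - {c}. L b)) * (1 - Q c * L c)) +
        (\<Sum>c\<in>A. Const (l c) * Q c) * (\<Prod>b\<in>A. L b)"
      unfolding sum_distrib_right sum.distrib[symmetric]
    proof (intro sum.cong refl)
      fix c assume "c \<in> A"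
      then have "(\<Prod>b\<in>A. L b) = L c * (\<Prod>b\<in>A - {c}. L b)" using A(1) by (intro prod.remove)
      then show "Const (l c) * (\<Prod>b\<in>A - {c}. L b) = Const (l c) * (\<Prod>b\<in>A - {c}. L b) * (1 - Q c * L c) +
          Const (l c) * Q c * (\<Prod>b\<in>A. L b)" by (simp add: algebra_simps)
    qed
    also have "\<dots> \<in> M" unfolding rel using Q by (auto intro!: is_ideal_sum[OF M(1)] I(3))
    finally show ?thesis .
  qed
  ultimately show False using no_univ by blast
qed

text \<open>A maximal ideal over \<open>I\<close> contains all \<open>Var v - Const (a v)\<close>,
  so each polynomial is congruent to its value at \<open>a\<close>; a nonzero value of a member
  would be a unit in the ideal.\<close>

theorem weak_nullstellensatz:
  fixes I :: "nat cpoly set"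
  assumes "is_ideal I" "1 \<notin> I"
  shows "\<exists>a. \<forall>f\<in>I. poly_eval a f = 0"
proof -
  obtain M where M: "is_ideal M" "I \<subseteq> M" "1 \<notin> M" "\<forall>x. x \<notin> M \<longrightarrow> (\<exists>q. 1 - q * x \<in> M)"
    using maximal_ideal_exists[OF assms] by blast
  note id = is_idealD[OF M(1)]
  have "\<forall>v. \<exists>c. Var v - Const c \<in> M" using maximal_ideal_linear[OF M(1,3,4)] by blast
  then obtain a where a: "\<And>v. Var v - Const (a v) \<in> M" by metis
  have red: "f - Const (poly_eval a f) \<in> M" for f
  proof (induction f rule: cpoly_induct)
    case (add p q)
    then have "(p - Const (poly_eval a p)) + (q - Const (poly_eval a q)) \<in> M" by (rule id)
    then show ?case by (simp add: poly_eval_hom Const_add algebra_simps)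
  next
    case (mult p q)
    have "p * (q - Const (poly_eval a q)) + Const (poly_eval a q) * (p - Const (poly_eval a p)) \<in> M"
      by (intro id mult)
    then show ?case by (simp add: poly_eval_hom Const_mult algebra_simps)
  qed (simp_all add: id a)
  have "poly_eval a f = 0" if "f \<in> M" for f
  proof (rule ccontr)
    assume "poly_eval a f \<noteq> 0"
    moreover have "Const (poly_eval a f) \<in> M"
      using id(5)[OF that red[of f]] by simp
    then have "Const (1 / poly_eval a f) * Const (poly_eval a f) \<in> M" by (rule id)
    ultimately show False using M(3) by (simp flip: Const_mult)
  qed
  then show ?thesis using M(2) by blast
qed

section \<open>Systems with only the trivial zero, and existence of the resultant\<close>

context generic_forms
begin

definition ideal_of :: "coeff_point \<Rightarrow> nat cpoly set" where
  "ideal_of a = {\<Sum>i=1..n. g i * form_of a i |g. True}"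

lemma ideal_ofI: "x = (\<Sum>i=1..n. g i * form_of a i) \<Longrightarrow> x \<in> ideal_of a"
  unfolding ideal_of_def by (intro CollectI exI[of _ g] conjI TrueI)

lemma is_ideal_ideal_of: "is_ideal (ideal_of a)"
  unfolding is_ideal_def
proof (intro conjI ballI allI)
  show "0 \<in> ideal_of a" by (rule ideal_ofI[of _ "\<lambda>_. 0"]) simp
  fix x assume "x \<in> ideal_of a"
  then obtain g where x: "x = (\<Sum>i=1..n. g i * form_of a i)" by (auto simp: ideal_of_def)
  have "y * x = (\<Sum>i=1..n. (y * g i) * form_of a i)" for y
    by (simp add: x sum_distrib_left mult.assoc)
  then show "y * x \<in> ideal_of a" for y by (rule ideal_ofI)
  fix y assume "y \<in> ideal_of a"
  then obtain h where y: "y = (\<Sum>i=1..n. h i * form_of a i)" by (auto simp: ideal_of_def)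
  have "x + y = (\<Sum>i=1..n. (g i + h i) * form_of a i)"
    by (simp add: x y sum.distrib distrib_right)
  then show "x + y \<in> ideal_of a" by (rule ideal_ofI)
qed

lemma form_of_in_ideal_of:
  assumes "i \<in> {1..n}"
  shows "form_of a i \<in> ideal_of a"
proof (rule ideal_ofI[of _ "\<lambda>k. if k = i then 1 else 0"])
  have "(\<Sum>k=1..n. (if k = i then 1 else 0) * form_of a k) = (\<Sum>k\<in>{i}. form_of a k)"
    using assms by (intro sum.mono_neutral_cong_right) auto
  then show "form_of a i = (\<Sum>k=1..n. (if k = i then 1 else 0) * form_of a k)" by simp
qed

lemma wt_form_of: "\<nu> \<in> keys (form_of a i) \<Longrightarrow> wt UNIV \<nu> = d"
  using is_form_form_of[of a i] unfolding is_form_def monomials_of_degree_altdef by blast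

lemma filt_wt_in_ideal_of:
  assumes "x \<in> ideal_of a"
  shows "filt (\<lambda>\<mu>. wt UNIV \<mu> = e) x \<in> ideal_of a"
proof -
  obtain g where x: "x = (\<Sum>i=1..n. g i * form_of a i)" using assms by (auto simp: ideal_of_def)
  have "filt (\<lambda>\<mu>. wt UNIV \<mu> = e) (g i * form_of a i) =
      filt (\<lambda>\<mu>. wt UNIV \<mu> + d = e) (g i) * form_of a i" for i
    by (rule filt_mult) (simp add: wt_add wt_form_of)
  then have "filt (\<lambda>\<mu>. wt UNIV \<mu> = e) x =
      (\<Sum>i=1..n. filt (\<lambda>\<mu>. wt UNIV \<mu> + d = e) (g i) * form_of a i)"
    by (simp add: x filt_sum)
  then show ?thesis by (rule ideal_ofI)
qed

text \<open>
  Dehomogenising at \<open>x\<^sub>j = 1\<close> gives \<open>1 = f + g (x\<^sub>j - 1)\<close> with \<open>f\<close> in the ideal of the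
  forms; the homogeneous components of this identity telescope.
\<close>

lemma power_in_ideal_of:
  assumes "\<nexists>x. common_zero a x" and j: "j \<in> {1..n}"
  shows "\<exists>N. Var j ^ N \<in> ideal_of a"
proof -
  define J where "J = {f + g * (Var j - 1) |f g. f \<in> ideal_of a}"
  note id = is_idealD[OF is_ideal_ideal_of[of a]]
  have "is_ideal J" unfolding is_ideal_def
  proof (intro conjI ballI allI)
    show "0 \<in> J" unfolding J_def using id(1) by (auto intro!: exI[of _ 0])
    fix x assume "x \<in> J"
    then obtain f g where x: "f \<in> ideal_of a" "x = f + g * (Var j - 1)" by (auto simp: J_def)
    have "y * x = y * f + (y * g) * (Var j - 1)" for y unfolding x(2) by (simp add: algebra_simps)
    then show "y * x \<in> J" for y unfolding J_def using id(3)[OF x(1)] by blast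
    fix y assume "y \<in> J"
    then obtain f' g' where y: "f' \<in> ideal_of a" "y = f' + g' * (Var j - 1)" by (auto simp: J_def)
    have "x + y = (f + f') + (g + g') * (Var j - 1)" unfolding x(2) y(2) by (simp add: algebra_simps)
    then show "x + y \<in> J" unfolding J_def using id(2)[OF x(1) y(1)] by blast
  qed
  have "1 \<in> J"
  proof (rule ccontr)
    assume "1 \<notin> J"
    from weak_nullstellensatz[OF \<open>is_ideal J\<close> this] obtain x where x: "\<And>f. f \<in> J \<Longrightarrow> poly_eval x f = 0"
      by blast
    have "0 + 1 * (Var j - 1) \<in> J" unfolding J_def using id(1) by blast
    from x[OF this] have "x j = 1" by (simp add: poly_eval_hom)
    moreover have "form_val a i x = 0" if "i \<in> {1..n}" for i
    proof -
      have "form_of a i + 0 * (Var j - 1) \<in> J" unfolding J_def using form_of_in_ideal_of[OF that] by blast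
      from x[OF this] show ?thesis by (simp add: poly_eval_form_of)
    qed
    ultimately have "common_zero a x" unfolding common_zero_def using j by (intro conjI bexI[of _ j]) auto
    then show False using assms by blast
  qed
  then obtain f g where fg: "f \<in> ideal_of a" "1 = f + g * (Var j - 1)" by (auto simp: J_def)
  define hc where "hc = (\<lambda>e. filt (\<lambda>\<mu> :: nat \<Rightarrow>\<^sub>0 nat. wt UNIV \<mu> = e))"
  have hc_f: "hc e f \<in> ideal_of a" for e unfolding hc_def by (rule filt_wt_in_ideal_of[OF fg(1)])
  have wt_Var: "\<nu> \<in> keys (Var j) \<Longrightarrow> wt UNIV \<nu> = 1" for \<nu> :: "nat \<Rightarrow>\<^sub>0 nat"
    by (auto simp: Var_def wt_def)
  have hc_1: "hc e 1 = (1 when e = 0)" for e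
    unfolding hc_def using filt_single[of "\<lambda>\<mu>. wt UNIV \<mu> = e" 0 1] by (simp add: wt_def when_def)
  have hc_eq: "hc e 1 = hc e f + hc e (g * Var j) - hc e g" for e
  proof -
    have "1 = f + g * Var j - g" using fg(2) by (simp add: algebra_simps)
    then have "hc e 1 = hc e (f + g * Var j - g)" by simp
    then show ?thesis by (simp add: hc_def filt_add filt_diff)
  qed
  have hc_Suc: "hc (Suc e) (g * Var j) = hc e g * Var j" for e
    unfolding hc_def by (rule filt_mult) (simp add: wt_add wt_Var)
  have hc_0: "hc 0 (g * Var j) = 0"
  proof -
    have "hc 0 (g * Var j) = filt (\<lambda>_. False) g * Var j"
      unfolding hc_def by (rule filt_mult) (simp add: wt_add wt_Var)
    also have "filt (\<lambda>_. False) g = 0" by (rule poly_mapping_eqI) (simp add: lookup_filt)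
    finally show ?thesis by simp
  qed
  \<comment> \<open>In degree 0 the identity says that \<open>hc 0 g\<close> is congruent to -1, and
    in degree \<open>N + 1\<close> that \<open>hc (Suc N) g\<close> is congruent to
    \<open>hc N g * Var j\<close>, modulo the ideal.\<close>
  have tele: "Var j ^ N + hc N g \<in> ideal_of a" for N
  proof (induction N)
    case 0
    have "1 + hc 0 g = hc 0 f" using hc_eq[of 0] by (simp add: hc_1 hc_0 algebra_simps)
    then show ?case using hc_f[of 0] by simp
  next
    case (Suc N)
    have "hc (Suc N) g = hc (Suc N) f + hc N g * Var j"
      using hc_eq[of "Suc N"] by (simp add: hc_1 hc_Suc algebra_simps)
    then have "Var j ^ Suc N + hc (Suc N) g = Var j * (Var j ^ N + hc N g) + hc (Suc N) f"
      by (simp add: algebra_simps)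
    then show ?case using id(2)[OF id(3)[OF Suc] hc_f] by simp
  qed
  define N where "N = Suc (\<Sum>\<mu>\<in>keys g. wt UNIV \<mu>)"
  have "hc N g = 0"
  proof (rule poly_mapping_eqI)
    fix \<mu>
    have "wt UNIV \<mu> < N" if "\<mu> \<in> keys g"
      unfolding N_def using member_le_sum[of \<mu> "keys g" "wt UNIV"] that by simp
    then show "lookup (hc N g) \<mu> = lookup 0 \<mu>"
      by (auto simp: hc_def lookup_filt when_def in_keys_iff)
  qed
  then show ?thesis using tele[of N] by auto
qed

text \<open>In a large degree all monomials lie in the ideal of the forms. The multipliers that
  express them at \<open>a\<close>, kept fixed for all systems, give a determinant that is 1 at
  \<open>a\<close>.\<close>

lemma witness_of_no_common_zero:
  assumes "\<nexists>x. common_zero a x"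
  shows "\<exists>D\<in>vanishing. poly_eval a D \<noteq> 0"
proof -
  note id = is_idealD[OF is_ideal_ideal_of[of a]]
  obtain Nf where Nf: "\<And>j. j \<in> {1..n} \<Longrightarrow> Var j ^ Nf j \<in> ideal_of a"
    using power_in_ideal_of[OF assms] by metis
  define N0 where "N0 = (\<Sum>j=1..n. Nf j)"
  have N0: "Var j ^ N0 \<in> ideal_of a" if "j \<in> {1..n}" for j
  proof -
    have "Nf j \<le> N0" unfolding N0_def using that by (intro member_le_sum) auto
    then have "Var j ^ N0 = (Var j ^ (N0 - Nf j) * Var j ^ Nf j :: nat cpoly)" by (simp flip: power_add)
    then show ?thesis using id(3)[OF Nf[OF that]] by simp
  qed
  \<comment> \<open>Larger than \<open>n * N0\<close>, so some exponent reaches \<open>N0\<close>;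
    the summand \<open>d\<close> also provides \<open>N \<ge> d\<close>.\<close>
  define N where "N = n * N0 + d"
  have N: "N \<ge> d" by (simp add: N_def)
  let ?B = "monomials_of_degree n N"
  have "single \<beta> 1 \<in> ideal_of a" if \<beta>: "\<beta> \<in> ?B" for \<beta>
  proof -
    have "\<exists>j\<in>{1..n}. N0 \<le> lookup \<beta> j"
    proof (rule ccontr)
      assume "\<not> (\<exists>j\<in>{1..n}. N0 \<le> lookup \<beta> j)"
      then have "(\<Sum>j=1..n. lookup \<beta> j) \<le> (\<Sum>j=1..n. N0)" by (intro sum_mono) force
      moreover have "(\<Sum>j=1..n. lookup \<beta> j) = N"
        using \<beta> wt_superset[of "{1..n}" \<beta> UNIV] by (simp add: monomials_of_degree_altdef)
      ultimately show False using d1 by (simp add: N_def)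
    qed
    then obtain j where j: "j \<in> {1..n}" "N0 \<le> lookup \<beta> j" by blast
    have "\<beta> = (\<beta> - single j N0) + single j N0"
      using j by (intro poly_mapping_eqI) (auto simp: lookup_add lookup_minus lookup_single when_def)
    then have "single \<beta> 1 = (single (\<beta> - single j N0) 1 * Var j ^ N0 :: nat cpoly)"
      by (simp add: Var_power mult_single)
    then show ?thesis using id(3)[OF N0[OF j(1)]] by simp
  qed
  then have "\<forall>\<beta>. \<exists>g. \<beta> \<in> ?B \<longrightarrow> single \<beta> 1 = (\<Sum>i=1..n. g i * form_of a i)"
    by (auto simp: ideal_of_def)
  then obtain G where G: "\<And>\<beta>. \<beta> \<in> ?B \<Longrightarrow> single \<beta> 1 = (\<Sum>i=1..n. G \<beta> i * form_of a i)" by metis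
  \<comment> \<open>Only the part of degree \<open>N - d\<close> of a multiplier contributes to the
    degree \<open>N\<close> part of the identity.\<close>
  define H where "H = (\<lambda>\<beta> i. filt (\<lambda>\<mu>. \<mu> \<in> monomials_of_degree n (N - d)) (G \<beta> i))"
  have H: "is_form n (N - d) (H \<beta> i)" for \<beta> i
    by (auto simp: is_form_def H_def keys_filt)
  have eq: "(\<Sum>i=1..n. H \<beta> i * form_of a i) = single \<beta> 1" if \<beta>: "\<beta> \<in> ?B" for \<beta>
  proof -
    have "filt (\<lambda>\<mu>. \<mu> \<in> ?B) (G \<beta> i * form_of a i) = H \<beta> i * form_of a i" for i
      unfolding H_def
    proof (rule filt_mult)
      fix \<mu> \<nu> assume "\<nu> \<in> keys (form_of a i)"
      then have \<nu>: "keys \<nu> \<subseteq> {1..n}" "wt UNIV \<nu> = d"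
        using is_form_form_of[of a i] by (auto simp: is_form_def monomials_of_degree_altdef)
      have "keys (\<mu> + \<nu>) = keys \<mu> \<union> keys \<nu>" by (auto simp: in_keys_iff lookup_add)
      then show "\<mu> + \<nu> \<in> ?B \<longleftrightarrow> \<mu> \<in> monomials_of_degree n (N - d)"
        using \<nu> N by (auto simp: monomials_of_degree_altdef wt_add)
    qed
    then have "(\<Sum>i=1..n. H \<beta> i * form_of a i) = filt (\<lambda>\<mu>. \<mu> \<in> ?B) (single \<beta> 1)"
      by (simp add: G[OF \<beta>] filt_sum)
    then show ?thesis using \<beta> by (simp add: filt_single)
  qed
  obtain D where "D \<in> vanishing" "D \<in> vars_in coeff_vars"
    and one: "\<forall>b. (\<forall>\<beta>\<in>?B. (\<Sum>i=1..n. H \<beta> i * form_of b i) = single \<beta> 1) \<longrightarrow> poly_eval b D = 1"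
    and "\<forall>b b' f. (\<forall>\<beta>\<in>?B. (\<Sum>i=1..n. H \<beta> i * form_of b' i) =
        Const (f \<beta>) * (\<Sum>i=1..n. H \<beta> i * form_of b i)) \<longrightarrow>
       poly_eval b' D = (\<Prod>\<beta>\<in>?B. f \<beta>) * poly_eval b D"
    by (rule resultant_determinant[OF N, of H, OF H])
  moreover have "poly_eval a D = 1" using one eq by blast
  ultimately show ?thesis by (intro bexI[of _ D]) auto
qed

text \<open>Macaulay's determinant is a nonzero member of \<open>vanishing\<close>, so a prime
  \<open>Q\<close> lies there. As \<open>Q\<close> divides that determinant, which is 1 at the
  diagonal system, it can be normalized.\<close>

lemma resultant_generator_exists:
  "\<exists>R. R \<in> vanishing \<and> R \<in> vars_in coeff_vars \<and> (\<forall>S\<in>vanishing. R dvd S) \<and> poly_eval diag_point R = 1"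
proof -
  obtain D where D: "D \<in> vanishing" "D \<in> vars_in coeff_vars" "poly_eval diag_point D = 1"
    using macaulay_determinant[of 1] n2 by auto
  then have "D \<noteq> 0" by (auto simp: poly_eval_zero)
  obtain Q where Q: "Q \<in> vanishing" "Q \<in> vars_in coeff_vars" "prime_elem Q"
    using prime_factor_in_prime_ideal[OF D(2) _ \<open>D \<noteq> 0\<close> D(1) vanishing_prime vanishing_not_unit]
    by auto
  have gen: "Q dvd S" if "S \<in> vanishing" for S
    by (rule prime_elem_generates[OF vanishing_diff vanishing_mult vanishing_free_eq_0 Q(1,3) that])
  define c where "c = poly_eval diag_point Q"
  have "c \<noteq> 0" using gen[OF D(1)] D(3) by (auto simp: dvd_def c_def poly_eval_mult)
  interpret V: subring_set "vars_in coeff_vars" by (rule subring_vars_in)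
  have "Const (1 / c) * Q dvd S" if S: "S \<in> vanishing" for S
  proof -
    obtain K where "S = Q * K" using gen[OF S] by (auto simp: dvd_def)
    then have "S = (Const (1 / c) * Q) * (Const c * K)"
      using \<open>c \<noteq> 0\<close> by (intro poly_eval_eqI) (simp add: poly_eval_mult)
    then show ?thesis by (rule dvdI)
  qed
  moreover have "Const (1 / c) * Q \<in> vanishing" using vanishing_mult[OF Q(1), of "Const (1 / c)"] by (simp add: mult.commute)
  moreover have "Const (1 / c) * Q \<in> vars_in coeff_vars" by (intro V.mult_mem Q Const_in_vars)
  moreover have "poly_eval diag_point (Const (1 / c) * Q) = 1"
    using \<open>c \<noteq> 0\<close> by (simp add: poly_eval_mult c_def)
  ultimately show ?thesis by blast
qed

lemma form_val_coeffs_of: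
  "is_form n d (F i) \<Longrightarrow> form_val (coeffs_of F) i x = poly_eval x (F i)"
  by (subst poly_eval_superset'[of "monomials_of_degree n d"])
    (auto simp: is_form_def form_val_def coeffs_of_def)

lemma has_nontrivial_common_zero_iff:
  assumes "\<forall>i\<in>{1..n}. is_form n d (F i)"
  shows "has_nontrivial_common_zero n F \<longleftrightarrow> (\<exists>x. common_zero (coeffs_of F) x)"
  using assms by (simp add: has_nontrivial_common_zero_def common_zero_def form_val_coeffs_of)

lemma form_val_scale_form: "form_val (scale_form k s a) i x = (if i = k then s else 1) * form_val a i x"
  by (simp add: form_val_def scale_form_def sum_distrib_left mult.assoc)

lemma common_zero_scale:
  assumes "common_zero a x" "c \<noteq> 0"
  shows "common_zero a (\<lambda>v. c * x v)"
  using assms by (auto simp: common_zero_def form_val_scale)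

lemma common_zero_normalized:
  assumes "common_zero a x"
  obtains y j where "common_zero a y" "j \<in> {1..n}" "y j = 1" "\<forall>i\<in>{1..n}. cmod (y i) \<le> 1"
proof -
  obtain i0 where i0: "i0 \<in> {1..n}" "x i0 \<noteq> 0" using assms by (auto simp: common_zero_def)
  define m where "m = Max ((\<lambda>i. cmod (x i)) ` {1..n})"
  have "m \<in> (\<lambda>i. cmod (x i)) ` {1..n}" unfolding m_def using i0 by (intro Max_in) auto
  then obtain j where j: "j \<in> {1..n}" "cmod (x j) = m" by auto
  have le: "cmod (x i) \<le> m" if "i \<in> {1..n}" for i using that by (simp add: m_def)
  have "m > 0" using le[OF i0(1)] i0(2) by (meson less_le_trans zero_less_norm_iff)
  then have "x j \<noteq> 0" using j by auto
  show ?thesis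
  proof (rule that)
    show "common_zero a (\<lambda>v. (1 / x j) * x v)"
      using \<open>x j \<noteq> 0\<close> by (intro common_zero_scale assms) simp
    show "j \<in> {1..n}" "1 / x j * x j = 1" using j \<open>x j \<noteq> 0\<close> by auto
    show "\<forall>i\<in>{1..n}. cmod (1 / x j * x i) \<le> 1"
      using le j \<open>m > 0\<close> by (simp add: norm_mult norm_divide divide_simps)
  qed
qed

end

section \<open>Degree and size of the resultant\<close>

text \<open>Up to sign, \<open>poly p 0\<close> is the product of the roots.\<close>

lemma monic_roots_in_disc:
  fixes p :: "complex poly"
  assumes "lead_coeff p = 1" "\<And>z. poly p z = 0 \<Longrightarrow> cmod z \<le> 1"
  shows "cmod (poly p 0) \<le> 1"
  using assms
proof (induction "degree p" arbitrary: p)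
  case 0
  then obtain c where "p = [:c:]" using degree_eq_zeroE by metis
  then show ?case using 0 by simp
next
  case (Suc k)
  then have "\<not> constant (poly p)" by (simp add: constant_degree)
  then obtain z where z: "poly p z = 0" using fundamental_theorem_of_algebra by blast
  then obtain q where q: "p = [:- z, 1:] * q" using poly_eq_0_iff_dvd by (auto simp: dvd_def)
  have "q \<noteq> 0" using Suc.hyps(2) q by auto
  then have "degree p = 1 + degree q" unfolding q by (subst degree_mult_eq) auto
  moreover have "lead_coeff q = 1" using Suc.prems(1) unfolding q by (simp add: lead_coeff_mult del: mult_pCons_left)
  moreover have "poly q w = 0 \<Longrightarrow> cmod w \<le> 1" for w using Suc.prems(2)[of w] q by simp
  ultimately have "cmod (poly q 0) \<le> 1" using Suc.hyps by simp
  moreover have "cmod z \<le> 1" using Suc.prems(2) z by simp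
  ultimately show ?case unfolding q by (simp add: norm_mult mult_le_one)
qed

locale resultant = generic_forms +
  fixes R :: "(nat \<times> (nat \<Rightarrow>\<^sub>0 nat)) cpoly"
  assumes R_vanishing: "R \<in> vanishing" and R_vars: "R \<in> vars_in coeff_vars"
    and R_dvd: "S \<in> vanishing \<Longrightarrow> R dvd S" and R_diag: "poly_eval diag_point R = 1"
begin

lemma R_nonzero: "R \<noteq> 0"
  using R_diag by (auto simp: poly_eval_zero)

lemma R_eq_0_iff: "poly_eval a R = 0 \<longleftrightarrow> (\<exists>x. common_zero a x)"
proof
  show "\<exists>x. common_zero a x \<Longrightarrow> poly_eval a R = 0" using R_vanishing by (auto simp: vanishing_def)
  show "\<exists>x. common_zero a x" if "poly_eval a R = 0"
  proof (rule ccontr)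
    assume "\<nexists>x. common_zero a x"
    from witness_of_no_common_zero[OF this] obtain D where D: "D \<in> vanishing" "poly_eval a D \<noteq> 0" by blast
    from R_dvd[OF D(1)] obtain K where "D = R * K" by (auto simp: dvd_def)
    then show False using D(2) that by (simp add: poly_eval_mult)
  qed
qed

lemma R_irreducible: "irreducible R"
proof (rule irreducibleI)
  show "\<not> R dvd 1" using R_vanishing vanishing_not_unit by blast
  fix A B assume AB: "R = A * B"
  have unit: "Y dvd 1" if "R = X * Y" "X \<in> vanishing" for X Y
  proof -
    obtain K where K: "X = R * K" using R_dvd[OF \<open>X \<in> vanishing\<close>] by (auto simp: dvd_def)
    have "R * 1 = X * Y" using \<open>R = X * Y\<close> by simp
    also have "\<dots> = R * (K * Y)" unfolding K by (rule mult.assoc)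
    finally have "1 = K * Y" using R_nonzero by (metis mult_left_cancel)
    then show ?thesis by (metis dvd_triv_right)
  qed
  have "A \<in> vanishing \<or> B \<in> vanishing" using R_vanishing AB by (intro vanishing_prime) simp
  then show "A dvd 1 \<or> B dvd 1"
    using unit[of A B] unit[of B A] AB by (auto simp: mult.commute)
qed (rule R_nonzero)

lemma coeffs_of_diag: "coeffs_of (\<lambda>i. Var i ^ d) = diag_point"
  by (auto simp: coeffs_of_def diag_point_def Var_power lookup_single when_def fun_eq_iff)

lemma is_resultant_R: "is_resultant n d R"
  unfolding is_resultant_def
proof (intro conjI allI impI)
  show "\<forall>\<mu>\<in>keys R. keys \<mu> \<subseteq> coeff_vars" using R_vars by (simp add: vars_in_def)
  show "poly_eval (coeffs_of (\<lambda>i. Var i ^ d)) R = 1" by (simp add: coeffs_of_diag R_diag)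
qed (auto simp: R_irreducible R_eq_0_iff has_nontrivial_common_zero_iff)

text \<open>\<open>R'\<close> vanishes on all systems with a common zero, so \<open>R\<close>
  divides it; irreducibility makes the cofactor a unit, hence constant, and the normalization makes
  it 1.\<close>

lemma is_resultant_unique:
  assumes "is_resultant n d R'"
  shows "R' = R"
proof -
  have vars: "R' \<in> vars_in coeff_vars" and irr: "irreducible R'" and diag: "poly_eval diag_point R' = 1"
    and zero: "\<And>F. \<forall>i\<in>{1..n}. is_form n d (F i) \<Longrightarrow>
      poly_eval (coeffs_of F) R' = 0 \<longleftrightarrow> has_nontrivial_common_zero n F"
    using assms by (auto simp: is_resultant_def vars_in_def coeffs_of_diag)
  have "poly_eval a R' = 0" if "common_zero a x" for a x
  proof -
    have form: "\<forall>i\<in>{1..n}. is_form n d (form_of a i)" by (simp add: is_form_form_of)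
    have "form_val (coeffs_of (form_of a)) i x = form_val a i x" for i
      using form_val_coeffs_of[of "form_of a", OF is_form_form_of] by (simp add: poly_eval_form_of)
    then have "common_zero (coeffs_of (form_of a)) x" using that by (simp add: common_zero_def)
    then have "poly_eval (coeffs_of (form_of a)) R' = 0"
      using zero[OF form] has_nontrivial_common_zero_iff[OF form] by blast
    moreover have "poly_eval (coeffs_of (form_of a)) R' = poly_eval a R'"
      by (rule poly_eval_cong[OF vars])
        (auto simp: coeffs_of_def form_of_def lookup_sum lookup_single when_def)
    ultimately show ?thesis by simp
  qed
  then have "R' \<in> vanishing" by (auto simp: vanishing_def)
  then obtain C where C: "R' = R * C" using R_dvd by (auto simp: dvd_def)
  then have "C dvd 1" using irreducibleD[OF irr C] R_vanishing vanishing_not_unit by blast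
  then have const: "poly_eval a C = poly_eval diag_point C" for a by (rule poly_eval_unit_const)
  have "poly_eval diag_point C = 1" using diag R_diag by (simp add: C poly_eval_mult)
  then show ?thesis using const by (intro poly_eval_eqI) (simp add: C poly_eval_mult)
qed

lemma resultant_poly_eq: "resultant_poly n d = R"
  unfolding resultant_poly_def using is_resultant_R is_resultant_unique by (rule the_equality)

text \<open>
  The part of \<open>R\<close> of highest degree in the coefficients of the \<open>k\<close>-th form vanishes with \<open>R\<close>, so
  \<open>R\<close> divides it.
\<close>

lemma R_homogeneous: "\<exists>e. \<forall>\<mu>\<in>keys R. wt ({k} \<times> UNIV) \<mu> = e"
proof -
  let ?W = "{k} \<times> UNIV :: (nat \<times> (nat \<Rightarrow>\<^sub>0 nat)) set"
  define e where "e = Max (wt ?W ` keys R)"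
  have e: "wt ?W \<mu> \<le> e" if "\<mu> \<in> keys R" for \<mu> using that by (simp add: e_def)
  define top where "top = filt (\<lambda>\<mu>. wt ?W \<mu> = e) R"
  have "e \<in> wt ?W ` keys R" unfolding e_def using R_nonzero by (intro Max_in) auto
  then obtain \<mu> where "\<mu> \<in> keys R" "wt ?W \<mu> = e" by auto
  then have "\<mu> \<in> keys top" by (simp add: top_def keys_filt)
  then have "top \<noteq> 0" by auto
  define \<gamma> where "\<gamma> = (\<lambda>a :: coeff_point. \<lambda>v. if v \<in> ?W then [:0, a v:] else [:a v:])"
  have \<gamma>: "poly (curve_eval (\<gamma> a) P) s = poly_eval (scale_form k s a) P" for a s P
    by (auto simp: poly_curve_eval \<gamma>_def scale_form_def intro!: arg_cong[of _ _ "\<lambda>a. poly_eval a P"])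
  have deg: "degree (curve_eval (\<gamma> a) R) \<le> e" "coeff (curve_eval (\<gamma> a) R) e = poly_eval a top" for a
    unfolding \<gamma>_def top_def by (rule curve_top; use e in blast)+
  have "poly_eval a top = 0" if "common_zero a x" for a x
  proof -
    have "common_zero (scale_form k s a) x" for s
      using that by (auto simp: common_zero_def form_val_scale_form)
    then have "poly (curve_eval (\<gamma> a) R) s = 0" for s using R_eq_0_iff by (auto simp: \<gamma>)
    then have "curve_eval (\<gamma> a) R = 0" using poly_all_0_iff_0 by blast
    then show ?thesis using deg(2)[of a] by simp
  qed
  then have "top \<in> vanishing" by (auto simp: vanishing_def)
  then obtain C where C: "top = R * C" using R_dvd by (auto simp: dvd_def)
  \<comment> \<open>When the \<open>k\<close>-th form is scaled by \<open>s\<close>,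
    \<open>R\<close> and \<open>C\<close> restrict to polynomials whose product is a multiple of
    \<open>s^e\<close>, while the first already has degree \<open>e\<close>. So the second is
    constant, in fact 1, and \<open>R\<close> restricts to a monomial; then \<open>s = 1\<close> is
    inserted.\<close>
  have "poly_eval a R = poly_eval a top" if a: "poly_eval a top \<noteq> 0" for a
  proof -
    let ?r = "curve_eval (\<gamma> a) R" and ?c = "curve_eval (\<gamma> a) C"
    have "poly (?r * ?c) s = poly (monom (poly_eval a top) e) s" for s
    proof -
      have "poly (?r * ?c) s = poly_eval (scale_form k s a) top" by (simp add: \<gamma> C poly_eval_mult)
      also have "\<dots> = s ^ e * poly_eval a top"
        unfolding scale_form_def by (rule poly_eval_scale_homogeneous) (simp add: top_def keys_filt)
      finally show ?thesis by (simp add: poly_monom)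
    qed
    then have rc: "?r * ?c = monom (poly_eval a top) e" using poly_eq_poly_eq_iff by blast
    then have "degree (?r * ?c) = e" and nz: "?r * ?c \<noteq> 0" using a by (simp_all add: degree_monom_eq)
    moreover have "degree ?r = e" using deg[of a] a by (metis le_antisym le_degree)
    ultimately have "degree ?c = 0" using degree_mult_eq[of ?r ?c] by auto
    then obtain c where c: "?c = [:c:]" using degree_eq_zeroE by blast
    have "c * poly_eval a top = poly_eval a top"
      using arg_cong[OF rc, of "\<lambda>p. coeff p e"] deg(2)[of a] by (simp add: c)
    then have "c = 1" using a by simp
    then have "?r = monom (poly_eval a top) e" using rc c by simp
    then have "poly ?r 1 = poly_eval a top" by (simp add: poly_monom)
    moreover have "scale_form k 1 a = a" by (auto simp: scale_form_def)
    ultimately show ?thesis by (simp add: \<gamma>)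
  qed
  \<comment> \<open>The factor \<open>top\<close> covers the points where \<open>top\<close>
    vanishes.\<close>
  then have "(R - top) * top = 0"
    by (intro poly_eval_eq_0_imp_eq_0) (auto simp: poly_eval_mult poly_eval_diff)
  then have "R = top" using \<open>top \<noteq> 0\<close> by simp
  then have "\<forall>\<mu>\<in>keys R. wt ?W \<mu> = e" by (metis (mono_tags, lifting) keys_filt mem_Collect_eq top_def)
  then show ?thesis by blast
qed

definition next_index :: "nat \<Rightarrow> nat" where
  "next_index i = (if i = n then 1 else i + 1)"

definition position :: "nat \<Rightarrow> nat \<Rightarrow> nat" where
  "position k i = (if i > k then i - k else n + i - k)"

text \<open>The forms \<open>x_i^d - x_(i+1) x_k^(d-1)\<close> for \<open>i \<noteq> k\<close>,
  indices taken cyclically, and \<open>x_(k+1) x_k^(d-1) - s x_k^d\<close> for \<open>k\<close>.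
  Only the \<open>k\<close>-th form involves \<open>s\<close>, to the first power, so the degree in
  \<open>s\<close> of \<open>R\<close> at this point bounds its degree in that form from
  below.\<close>

definition cyclic_point :: "nat \<Rightarrow> complex \<Rightarrow> coeff_point" where
  "cyclic_point k s = (\<lambda>(i, \<alpha>).
     if i = k then (1 when \<alpha> = single (next_index k) 1 + single k (d - 1)) - s * (1 when \<alpha> = single k d)
     else (1 when \<alpha> = single i d) - (1 when \<alpha> = single (next_index i) 1 + single k (d - 1)))"

lemma form_val_cyclic_point:
  assumes "k \<in> {1..n}" "i \<in> {1..n}"
  shows "form_val (cyclic_point k s) i x =
    (if i = k then x (next_index k) * x k ^ (d - 1) - s * x k ^ d
     else x i ^ d - x (next_index i) * x k ^ (d - 1))"
proof -
  have M: "single (next_index i) 1 + single k (d - 1) \<in> monomials_of_degree n d"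
  proof -
    have "next_index i \<in> {1..n}" using assms n2 by (auto simp: next_index_def)
    then have "single (next_index i) 1 + single k (d - 1) \<in> monomials_of_degree n (1 + (d - 1))"
      using assms by (intro monomials_of_degree_add single_in_monomials)
    then show ?thesis using d1 by simp
  qed
  have *: "(\<Sum>\<alpha>\<in>monomials_of_degree n d. c * (1 when \<alpha> = \<beta>) * mono_val x \<alpha>) = c * mono_val x \<beta>"
    if "\<beta> \<in> monomials_of_degree n d" for c :: complex and \<beta>
  proof -
    have "(\<Sum>\<alpha>\<in>monomials_of_degree n d. c * (1 when \<alpha> = \<beta>) * mono_val x \<alpha>) =
        (\<Sum>\<alpha>\<in>{\<beta>}. c * (1 when \<alpha> = \<beta>) * mono_val x \<alpha>)"
      using that by (intro sum.mono_neutral_right) auto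
    then show ?thesis by simp
  qed
  show ?thesis
  proof (cases "i = k")
    case True
    then show ?thesis
      using *[of "single (next_index k) 1 + single k (d - 1)" 1] *[of "single k d" s] M assms
      by (simp add: form_val_def cyclic_point_def left_diff_distrib sum_subtractf single_in_monomials
          mono_val_add)
  next
    case False
    then show ?thesis
      using *[of "single (next_index i) 1 + single k (d - 1)" 1] *[of "single i d" 1] M assms
      by (simp add: form_val_def cyclic_point_def left_diff_distrib sum_subtractf single_in_monomials
          mono_val_add)
  qed
qed

text \<open>
  Lower bound by counting: with \<open>x\<^sub>k = 1\<close> the system of \<^const>\<open>cyclic_point\<close> forces
  \<open>x\<^sub>k\<^sub>+\<^sub>1 = s\<close> and then \<open>s^(d^(n - 1)) = 1\<close>. In the cyclic order, \<^term>\<open>position k i\<close> is the number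
  of steps from \<open>k\<close> to \<open>i\<close>, which is \<open>n\<close> (not \<open>0\<close>) for \<open>i = k\<close>.
\<close>

lemma R_degree:
  assumes k: "k \<in> {1..n}" and \<mu>: "\<mu> \<in> keys R"
  shows "wt ({k} \<times> UNIV) \<mu> = d ^ (n - 1)"
proof -
  let ?W = "{k} \<times> UNIV :: (nat \<times> (nat \<Rightarrow>\<^sub>0 nat)) set"
  obtain e where e: "\<And>\<mu>. \<mu> \<in> keys R \<Longrightarrow> wt ?W \<mu> = e" using R_homogeneous[of k] by blast
  have "e \<le> d ^ (n - 1)"
  proof -
    obtain D e' where D: "e' \<le> d ^ (n - 1)" "D \<in> vanishing" "poly_eval diag_point D = 1"
      "\<And>a s. poly_eval (scale_form k s a) D = s ^ e' * poly_eval a D"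
      using macaulay_determinant[OF k] by blast
    obtain C where C: "D = R * C" using R_dvd[OF D(2)] by (auto simp: dvd_def)
    define \<gamma> where "\<gamma> = (\<lambda>v. if v \<in> ?W then [:0, diag_point v:] else [:diag_point v:])"
    have \<gamma>: "poly (curve_eval \<gamma> P) s = poly_eval (scale_form k s diag_point) P" for s P
      by (auto simp: poly_curve_eval \<gamma>_def scale_form_def intro!: arg_cong[of _ _ "\<lambda>a. poly_eval a P"])
    \<comment> \<open>Scaling the \<open>k\<close>-th form of the diagonal system turns
      \<open>R\<close> into \<open>s^e\<close> and \<open>D\<close> into \<open>s^e'\<close>;
      divisibility compares the exponents.\<close>
    have "poly (monom 1 e * curve_eval \<gamma> C) s = poly (monom 1 e') s" for s
    proof -
      have "poly_eval (scale_form k s diag_point) R = s ^ e * poly_eval diag_point R"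
        unfolding scale_form_def by (rule poly_eval_scale_homogeneous) (rule e)
      then have "s ^ e * poly (curve_eval \<gamma> C) s = poly_eval (scale_form k s diag_point) D"
        by (simp add: C poly_eval_mult R_diag \<gamma>)
      then show ?thesis by (simp add: D poly_monom)
    qed
    then have eq: "monom 1 e * curve_eval \<gamma> C = monom 1 e'" using poly_eq_poly_eq_iff by blast
    then have "curve_eval \<gamma> C \<noteq> 0" by auto
    then have "degree (monom 1 e * curve_eval \<gamma> C) = e + degree (curve_eval \<gamma> C)"
      by (subst degree_mult_eq) (auto simp: degree_monom_eq)
    then have "e \<le> e'" unfolding eq by (simp add: degree_monom_eq)
    then show ?thesis using D(1) by simp
  qed
  moreover have "d ^ (n - 1) \<le> e"
  proof -
    let ?D = "d ^ (n - 1)"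
    define b :: coeff_point where "b = (\<lambda>(i, \<alpha>). 1 when \<alpha> = single (next_index k) 1 + single k (d - 1))"
    define a where "a = (\<lambda>(i, \<alpha>). if i = k then - (1 when \<alpha> = single k d) else cyclic_point k 0 (i, \<alpha>))"
    define h where "h = curve_eval (\<lambda>v. if v \<in> ?W then [:b v, a v:] else [:a v:]) R"
    have "degree h \<le> e" unfolding h_def by (rule curve_top) (simp add: e)
    have h: "poly h s = poly_eval (cyclic_point k s) R" for s
      unfolding h_def poly_curve_eval
      by (rule arg_cong[of _ _ "\<lambda>a. poly_eval a R"]) (auto simp: fun_eq_iff a_def b_def cyclic_point_def)
    have pos_k: "position k i = n \<longleftrightarrow> i = k" and pos_1: "1 \<le> position k i" and pos_n: "position k i \<le> n"
      if "i \<in> {1..n}" for i using that k by (auto simp: position_def)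
    have next_in: "next_index i \<in> {1..n}" if "i \<in> {1..n}" for i using that by (auto simp: next_index_def)
    have pos_next: "position k (next_index i) = position k i + 1" if "i \<in> {1..n}" "i \<noteq> k" for i
      using that k by (auto simp: position_def next_index_def)
    have pos_next_k: "position k (next_index k) = 1" using k n2 by (auto simp: position_def next_index_def)
    have "poly h \<omega> = 0" if \<omega>: "\<omega> ^ ?D = 1" for \<omega>
    proof -
      \<comment> \<open>The chain \<open>x_(i+1) = x_i^d\<close> starts with \<open>\<omega>\<close>
        at the successor of \<open>k\<close> and closes up at \<open>k\<close> with the value
        \<open>\<omega> ^ ?D = 1\<close>.\<close>
      define x where "x = (\<lambda>i. \<omega> ^ (d ^ (position k i - 1)))"
      have xk: "x k = 1" using pos_k[OF k] \<omega> by (simp add: x_def)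
      have "form_val (cyclic_point k \<omega>) i x = 0" if i: "i \<in> {1..n}" for i
      proof (cases "i = k")
        case True
        then show ?thesis using form_val_cyclic_point[OF k k] xk by (simp add: x_def pos_next_k)
      next
        case False
        have "x i ^ d = \<omega> ^ (d ^ (position k i - 1) * d)" by (simp add: x_def power_mult)
        also have "d ^ (position k i - 1) * d = d ^ position k i"
          using pos_1[OF i] by (intro power_minus_mult) simp
        also have "\<omega> ^ (d ^ position k i) = x (next_index i)"
          using pos_next[OF i False] by (simp add: x_def)
        finally show ?thesis using False form_val_cyclic_point[OF k i] xk by simp
      qed
      then have "common_zero (cyclic_point k \<omega>) x" unfolding common_zero_def using k xk
        by (intro conjI bexI[of _ k]) auto
      then show ?thesis using R_eq_0_iff h by auto
    qed
    then have sub: "{z. z ^ ?D = 1} \<subseteq> {z. poly h z = 0}" by auto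
    have "h \<noteq> 0"
    proof
      assume "h = 0"
      then have "poly_eval (cyclic_point k 0) R = 0" using h[of 0] by simp
      then obtain x where x: "common_zero (cyclic_point k 0) x" using R_eq_0_iff by blast
      have xk: "x (next_index k) * x k ^ (d - 1) = 0"
        using x form_val_cyclic_point[OF k k, of 0 x] k by (auto simp: common_zero_def)
      have xi: "x i ^ d = x (next_index i) * x k ^ (d - 1)" if "i \<in> {1..n}" "i \<noteq> k" for i
        using x form_val_cyclic_point[OF k that(1), of 0 x] that by (auto simp: common_zero_def)
      have "x k = 0"
      proof (rule ccontr)
        assume "x k \<noteq> 0"
        \<comment> \<open>If \<open>x k\<close> is nonzero, the \<open>k\<close>-th equation makes
          the next entry 0, and the others carry this forward around the cycle to \<open>k\<close>
          itself.\<close>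
        have "\<forall>i\<in>{1..n}. position k i = Suc t \<longrightarrow> x i = 0" for t
        proof (induction t)
          case 0
          have "i = next_index k" if "i \<in> {1..n}" "position k i = Suc 0" for i
            using that k n2 by (auto simp: position_def next_index_def split: if_splits)
          then show ?case using xk \<open>x k \<noteq> 0\<close> by auto
        next
          case (Suc t)
          show ?case
          proof (intro ballI impI)
            fix i assume i: "i \<in> {1..n}" "position k i = Suc (Suc t)"
            define j where "j = (if i = 1 then n else i - 1)"
            have j: "j \<in> {1..n}" "next_index j = i" using i by (auto simp: j_def next_index_def)
            have "j \<noteq> k" using pos_next_k i j by auto
            then have "position k j = Suc t" using pos_next[OF j(1)] i j by simp
            then have "x j = 0" using Suc j by blast
            then have "x i * x k ^ (d - 1) = 0" using xi[OF j(1) \<open>j \<noteq> k\<close>] j d1 by (simp add: power_0_left)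
            then show "x i = 0" using \<open>x k \<noteq> 0\<close> by simp
          qed
        qed
        from this[of "n - 1"] have "x k = 0" using pos_k[OF k] k n2 by auto
        then show False using \<open>x k \<noteq> 0\<close> by blast
      qed
      \<comment> \<open>For \<open>d = 1\<close> the power \<open>x k ^ (d - 1)\<close> is 1
        although \<open>x k = 0\<close>, so zeros are propagated backwards from \<open>k\<close>
        through \<open>x_(i+1)\<close> instead.\<close>
      have "\<forall>i\<in>{1..n}. n - position k i = t \<longrightarrow> x i = 0" for t
      proof (induction t)
        case 0
        then show ?case using pos_k pos_n \<open>x k = 0\<close> by (metis diff_is_0_eq le_antisym)
      next
        case (Suc t)
        show ?case
        proof (intro ballI impI)
          fix i assume i: "i \<in> {1..n}" "n - position k i = Suc t"
          have "i \<noteq> k" using i pos_k by force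
          then have "n - position k (next_index i) = t" using pos_next[OF i(1)] i by simp
          then have "x (next_index i) = 0" using Suc next_in[OF i(1)] by blast
          then have "x i ^ d = 0" using xi[OF i(1) \<open>i \<noteq> k\<close>] by simp
          then show "x i = 0" by simp
        qed
      qed
      then have "\<forall>i\<in>{1..n}. x i = 0" by blast
      then show False using x by (auto simp: common_zero_def)
    qed
    then have "card {z :: complex. z ^ ?D = 1} \<le> card {z. poly h z = 0}"
      by (intro card_mono sub poly_roots_finite)
    also have "\<dots> \<le> degree h" using \<open>h \<noteq> 0\<close> by (rule card_poly_roots_bound)
    finally have "card {z :: complex. z ^ ?D = 1} \<le> degree h" .
    moreover have "card {z :: complex. z ^ ?D = 1} = ?D"
      using d1 by (intro card_roots_unity_eq) simp
    ultimately show ?thesis using \<open>degree h \<le> e\<close> by simp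
  qed
  ultimately show ?thesis using e[OF \<mu>] by simp
qed

lemma poly_eval_scale_form_R:
  "k \<in> {1..n} \<Longrightarrow> poly_eval (scale_form k s a) R = s ^ (d ^ (n - 1)) * poly_eval a R"
  unfolding scale_form_def by (rule poly_eval_scale_homogeneous) (rule R_degree)

lemma poly_eval_scale_all_R:
  "poly_eval (\<lambda>v. if fst v \<in> {1..n} then c (fst v) * a v else a v) R =
    (\<Prod>i=1..n. c i ^ (d ^ (n - 1))) * poly_eval a R"
proof -
  have "poly_eval (\<lambda>v. if fst v \<in> K then c (fst v) * a v else a v) R =
      (\<Prod>i\<in>K. c i ^ (d ^ (n - 1))) * poly_eval a R" if "finite K" "K \<subseteq> {1..n}" for K
    using that
  proof induction
    case (insert k K)
    have "(\<lambda>v. if fst v \<in> insert k K then c (fst v) * a v else a v) =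
        scale_form k (c k) (\<lambda>v. if fst v \<in> K then c (fst v) * a v else a v)"
      using insert by (auto simp: scale_form_def fun_eq_iff)
    then show ?case using insert by (simp add: poly_eval_scale_form_R mult.assoc)
  qed simp
  then show ?thesis by blast
qed

lemma wt_UNIV_R: "\<mu> \<in> keys R \<Longrightarrow> wt UNIV \<mu> = n * d ^ (n - 1)"
proof -
  assume \<mu>: "\<mu> \<in> keys R"
  then have "keys \<mu> \<subseteq> coeff_vars" using R_vars unfolding vars_in_def by blast
  then have "fst ` keys \<mu> \<subseteq> {1..n}" by force
  then have "wt UNIV \<mu> = (\<Sum>k=1..n. \<Sum>v\<in>{v \<in> keys \<mu>. fst v = k}. lookup \<mu> v)"
    by (simp add: wt_def sum.group)
  also have "\<dots> = (\<Sum>k=1..n. wt ({k} \<times> UNIV) \<mu>)"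
    unfolding wt_def by (intro sum.cong) auto
  also have "\<dots> = (\<Sum>k=1..n. d ^ (n - 1))" using R_degree[OF _ \<mu>] by (intro sum.cong) auto
  finally show ?thesis by simp
qed

lemma R_bound_unit:
  assumes "\<And>i x. i \<in> {1..n} \<Longrightarrow> (\<And>j. j \<in> {1..n} \<Longrightarrow> cmod (x j) \<le> 1) \<Longrightarrow> cmod (form_val a i x) \<le> 1"
  shows "cmod (poly_eval a R) \<le> 1"
proof -
  let ?E = "n * d ^ (n - 1)"
  \<comment> \<open>The vacuous case distinction gives the curve the shape of
    \<open>curve_top\<close>, with total degree as weight; the top coefficient is then
    \<open>R\<close> at the diagonal system.\<close>
  define h where "h = curve_eval (\<lambda>v. if v \<in> UNIV then [:a v, diag_point v:] else [:diag_point v:]) R"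
  have h: "poly h s = poly_eval (\<lambda>v. a v + s * diag_point v) R" for s
    by (simp add: h_def poly_curve_eval)
  have "filt (\<lambda>\<mu>. wt UNIV \<mu> = ?E) R = R"
  proof (rule poly_mapping_eqI)
    fix \<mu>
    show "lookup (filt (\<lambda>\<mu>. wt UNIV \<mu> = ?E) R) \<mu> = lookup R \<mu>"
      using wt_UNIV_R[of \<mu>] by (cases "\<mu> \<in> keys R") (auto simp: lookup_filt when_def in_keys_iff)
  qed
  then have "degree h \<le> ?E" "coeff h ?E = 1"
    using curve_top[of R UNIV ?E a diag_point] wt_UNIV_R R_diag by (auto simp: h_def)
  then have "lead_coeff h = 1" by (metis le_antisym le_degree zero_neq_one)
  moreover have "cmod s \<le> 1" if "poly h s = 0" for s
  proof -
    have "poly_eval (\<lambda>v. a v + s * diag_point v) R = 0" using \<open>poly h s = 0\<close> h by simp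
    then obtain x where "common_zero (\<lambda>v. a v + s * diag_point v) x" unfolding R_eq_0_iff by blast
    then obtain y j where y: "common_zero (\<lambda>v. a v + s * diag_point v) y" "j \<in> {1..n}" "y j = 1"
      "\<forall>i\<in>{1..n}. cmod (y i) \<le> 1"
      by (rule common_zero_normalized)
    have "form_val diag_point j y = 1"
      using y(2,3) form_of_diag_point[of j] by (simp flip: poly_eval_form_of)
    moreover have "form_val (\<lambda>v. a v + s * diag_point v) j y = form_val a j y + s * form_val diag_point j y"
      by (simp add: form_val_def distrib_right sum.distrib sum_distrib_left mult.assoc)
    moreover have "form_val (\<lambda>v. a v + s * diag_point v) j y = 0" using y by (simp add: common_zero_def)
    ultimately have "s = - form_val a j y" by (simp add: add_eq_0_iff)
    then show ?thesis using assms[of j y] y by simp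
  qed
  ultimately have "cmod (poly h 0) \<le> 1" by (rule monic_roots_in_disc)
  then show ?thesis by (simp add: h)
qed

text \<open>The hypothesis bounds values on the unit polydisc, where a common zero can be scaled to
  lie with some entry equal to 1. Homogeneity reduces positive \<open>L i\<close> to
  \<open>R_bound_unit\<close>.\<close>

theorem R_bound:
  assumes L: "\<And>i. i \<in> {1..n} \<Longrightarrow> L i \<ge> 0"
    and bound: "\<And>i x. i \<in> {1..n} \<Longrightarrow> (\<And>j. j \<in> {1..n} \<Longrightarrow> cmod (x j) \<le> 1) \<Longrightarrow>
      cmod (form_val a i x) \<le> L i"
  shows "cmod (poly_eval a R) \<le> (\<Prod>i=1..n. L i ^ (d ^ (n - 1)))"
proof (cases "\<exists>k\<in>{1..n}. L k = 0")
  case True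
  then obtain k where k: "k \<in> {1..n}" "L k = 0" by blast
  \<comment> \<open>The \<open>k\<close>-th form cannot be normalized. Replacing it by 0 makes
    \<open>R\<close> vanish, so the other forms have a common zero; moved into the polydisc, it is
    also a zero of the \<open>k\<close>-th form because \<open>L k = 0\<close>.\<close>
  have "poly_eval (scale_form k 0 a) R = 0" using k d1 by (simp add: poly_eval_scale_form_R power_0_left)
  then obtain x where "common_zero (scale_form k 0 a) x" using R_eq_0_iff by blast
  then obtain y j where y: "common_zero (scale_form k 0 a) y" "j \<in> {1..n}" "y j = 1"
    "\<forall>i\<in>{1..n}. cmod (y i) \<le> 1"
    by (rule common_zero_normalized)
  have "form_val a i y = 0" if i: "i \<in> {1..n}" for i
  proof (cases "i = k")
    case True
    then show ?thesis using bound[of k y] y(4) k by simp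
  next
    case False
    have "form_val (scale_form k 0 a) i y = 0" using y(1) i by (simp add: common_zero_def)
    then show ?thesis using False by (simp add: form_val_scale_form)
  qed
  then have "common_zero a y" using y(1) by (simp add: common_zero_def)
  then have "poly_eval a R = 0" using R_eq_0_iff by blast
  then show ?thesis using L by (auto intro!: prod_nonneg)
next
  case False
  then have pos: "L i > 0" if "i \<in> {1..n}" for i using L[OF that] that by force
  define b where "b = (\<lambda>v. if fst v \<in> {1..n} then of_real (1 / L (fst v)) * a v else a v)"
  have "cmod (poly_eval b R) \<le> 1"
  proof (rule R_bound_unit)
    fix i and x :: "nat \<Rightarrow> complex" assume i: "i \<in> {1..n}" and x: "\<And>j. j \<in> {1..n} \<Longrightarrow> cmod (x j) \<le> 1"
    have "form_val b i x = of_real (1 / L i) * form_val a i x"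
      using i by (simp add: form_val_def b_def sum_distrib_left mult.assoc)
    then have "cmod (form_val b i x) = cmod (form_val a i x) / L i"
      using pos[OF i] by (simp add: norm_mult norm_divide)
    moreover have "cmod (form_val a i x) \<le> L i" using x by (intro bound i)
    ultimately show "cmod (form_val b i x) \<le> 1" using pos[OF i] by simp
  qed
  moreover have "cmod (poly_eval a R) = cmod (poly_eval b R) * (\<Prod>i=1..n. L i ^ (d ^ (n - 1)))"
  proof -
    have "poly_eval b R = (\<Prod>i=1..n. of_real (1 / L i) ^ (d ^ (n - 1))) * poly_eval a R"
      unfolding b_def by (rule poly_eval_scale_all_R)
    then have eq: "cmod (poly_eval b R) = (\<Prod>i=1..n. (1 / L i) ^ (d ^ (n - 1))) * cmod (poly_eval a R)"
      using L by (simp add: norm_mult norm_power norm_divide prod_norm[symmetric])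
    have inv: "(\<Prod>i=1..n. (1 / L i) ^ (d ^ (n - 1))) * (\<Prod>i=1..n. L i ^ (d ^ (n - 1))) = 1"
      unfolding prod.distrib[symmetric] power_mult_distrib[symmetric]
      using pos by (intro prod.neutral) force
    show ?thesis unfolding eq using inv by (simp only: mult.assoc mult.left_commute mult.commute mult_1_right)
  qed
  moreover have "(\<Prod>i=1..n. L i ^ (d ^ (n - 1))) \<ge> 0" using L by (intro prod_nonneg) auto
  ultimately show ?thesis using mult_left_le_one_le[of _ "cmod (poly_eval b R)"] by simp
qed

end

lemma is_form_tensor_form: "is_form n (m - 1) (tensor_form n m T i)"
  unfolding tensor_form_def
proof (intro is_form_sum)
  fix l assume l: "l \<in> multi_indices n (m - 1)"
  have "(\<Sum>v\<leftarrow>l. single v 1) \<in> monomials_of_degree n (length l)" if "set l \<subseteq> {1..n}" for l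
    using that
  proof (induction l)
    case Nil
    then show ?case by (simp add: monomials_of_degree_def)
  next
    case (Cons v l)
    then have "single v 1 + (\<Sum>v\<leftarrow>l. single v 1) \<in> monomials_of_degree n (1 + length l)"
      by (intro monomials_of_degree_add single_in_monomials) auto
    then show ?case by simp
  qed
  from this[of l] show "is_form n (m - 1) (Const (T (i # l)) * prod_list (map Var l))"
    using l by (auto simp: Const_times_prod_list_Var is_form_def multi_indices_def)
qed

theorem proposition10p1:
  fixes m n :: nat and T :: "nat list \<Rightarrow> complex"
  assumes "m \<ge> 2" and "n \<ge> 2"
  shows "cmod (Edet n m T) \<le>
    (\<Prod>i=1..n. (\<Sum>l\<in>multi_indices n (m - 1). cmod (T (i # l))) ^ ((m - 1) ^ (n - 1)))"
proof -
  interpret generic_forms n "m - 1" using assms by unfold_locales auto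
  obtain R where "R \<in> vanishing \<and> R \<in> vars_in coeff_vars \<and> (\<forall>S\<in>vanishing. R dvd S) \<and>
      poly_eval diag_point R = 1"
    using resultant_generator_exists by blast
  then interpret resultant n "m - 1" R by unfold_locales auto
  let ?a = "coeffs_of (tensor_form n m T)"
  \<comment> \<open>Entries of \<open>T\<close> with the same monomial merge into one coefficient,
    so the values are estimated through \<open>tensor_apply\<close>, where the triangle inequality
    gives the row sum directly.\<close>
  have "cmod (form_val ?a i x) \<le> (\<Sum>l\<in>multi_indices n (m - 1). cmod (T (i # l)))"
    if x: "\<And>j. j \<in> {1..n} \<Longrightarrow> cmod (x j) \<le> 1" for i x
  proof -
    have le: "cmod (prod_list (map x l)) \<le> 1" if "set l \<subseteq> {1..n}" for l
      using that by (induction l) (auto simp: norm_mult x intro!: mult_le_one)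
    have "form_val ?a i x = tensor_apply n m T x i"
      unfolding form_val_coeffs_of[of "tensor_form n m T", OF is_form_tensor_form]
      by (rule poly_eval_tensor_form)
    also have "cmod \<dots> \<le> (\<Sum>l\<in>multi_indices n (m - 1). cmod (T (i # l) * prod_list (map x l)))"
      unfolding tensor_apply_def by (rule norm_sum)
    also have "\<dots> \<le> (\<Sum>l\<in>multi_indices n (m - 1). cmod (T (i # l)))"
      using le by (intro sum_mono) (auto simp: norm_mult multi_indices_def intro!: mult_left_le)
    finally show ?thesis .
  qed
  then show ?thesis
    unfolding Edet_def Res_def resultant_poly_eq by (intro R_bound sum_nonneg) auto
qed

end
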